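(* Let $M,N$ be $A$-modules, and $\ell\in L$. Then \[ (M\otimes N)_{\ell} = \bigoplus_{\ell_1\ell_2=\ell} M_{\ell_1}\otimes {}^{\ell_1}\!N_{\ell_2} \] and \[ (M^* )_{\ell} = {}^{\ell^{-1}}\!(M_{\ell^{-1}})^*. \]
   Context: Let $G$ and $L$ be finite groups with an action of $L$ on $G$ by group automorphisms, written $(x,g)\mapsto {}^{x}g$ for $x\in L$, $g\in G$. Let $k$ be an algebraically closed field of characteristic $p$ dividing the order of $G$. Write $\otimes=\otimes_k$. Let $k[G]=\mathrm{Hom}_k(kG,k)$, with basis $\{p_g\mid g\in G\}$ dual to $G$, and let $k[L]=\mathrm{Hom}_k(kL,k)$ be the coordinate ring of $L$, with basis $\{p_\ell\mid \ell\in L\}$ dual to $L$. Let $k[G]\# kL$ be the smash product: as a vector space it is $k[G]\otimes kL$, with multiplication $(p_g\otimes x)(p_h\otimes y)=\delta_{g,{}^{x}h}\,p_g\otimes xy$ for $g,h\in G$, $x,y\in L$, and it is a Hopf algebra with the tensor product coalgebra structure. Let $A=\mathrm{Hom}_k(k[G]\# kL,k)$ be the dual Hopf algebra. As an algebra, $A=kG\otimes k[L]$ (tensor product algebra), and its comultiplication, counit and coinverse (antipode) are given by \[ \Delta(g\otimes p_\ell)=\sum_{x\in L}(g\otimes p_x)\otimes({}^{x^{-1}}g\otimes p_{x^{-1}\ell}),\qquad \varepsilon(g\otimes p_\ell)=\delta_{1,\ell},\qquad S(g\otimes p_\ell)={}^{\ell^{-1}}(g^{-1})\otimes p_{\ell^{-1}}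 \] for $g\in G$, $\ell\in L$. For $A$-modules $M,N$, the space $M\otimes N$ is an $A$-module via $\Delta$, and $M^*=\mathrm{Hom}_k(M,k)$ is an $A$-module via $(a\cdot f)(m)=f(S(a)m)$ for $a\in A$, $f\in M^*$, $m\in M$. Tensor products and duals of $kG$-modules are the usual ones for group representations. The algebra $k[L]$ is semisimple and its indecomposable representations are one-dimensional, corresponding to the elements of $L$; $k_\ell$ denotes the one-dimensional representation corresponding to $\ell\in L$. Every left $A$-module $M$ has a canonical decomposition $M=\bigoplus_{\ell\in L}M_\ell\otimes k_\ell$, where each $M_\ell$ is a $kG$-module; this defines the notation $M_\ell$, and $(M\otimes N)_\ell$ and $(M^* )_\ell$ are the corresponding components of $M\otimes N$ and $M^*$. For a $kG$-module $U$ and $y\in L$, ${}^{y}U$ denotes the conjugate of the $kG$-module $U$ by the action of the element $y$ on $G$.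
   Formalization: The second formula is proved as (M^* )_ℓ = ^ℓ(M_{ℓ^{-1}})^* instead of ^{ℓ^{-1}}(M_{ℓ^{-1}})^*, with g acting on ^yU as ^{y^{-1}}g acts on U, the convention the first formula forces; the printed exponent fails under it. *)

theory Defs
  imports "HOL-Algebra.Algebra"
begin

section \<open>Linear algebra over a field\<close>

definition ring_char :: "('k, 'r) ring_scheme \<Rightarrow> nat" where
  "ring_char K = (if \<exists>n>0. add_pow K (n::nat) \<one>\<^bsub>K\<^esub> = \<zero>\<^bsub>K\<^esub>
     then (LEAST n. n > 0 \<and> add_pow K (n::nat) \<one>\<^bsub>K\<^esub> = \<zero>\<^bsub>K\<^esub>) else 0)"

text \<open>A vector space over \<open>K\<close> is a record satisfying \<^locale>\<open>module\<close>; the inherited fields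
  \<open>mult\<close> and \<open>one\<close> play no role for it and are left undefined in the constructions below.\<close>

definition linear_map ::
    "('k, 'r) ring_scheme \<Rightarrow> ('k, 'v, 'x) module_scheme \<Rightarrow> ('k, 'w, 'y) module_scheme \<Rightarrow> ('v \<Rightarrow> 'w) set"
  where
  "linear_map K V W = {f. f \<in> carrier V \<rightarrow> carrier W
     \<and> (\<forall>u\<in>carrier V. \<forall>v\<in>carrier V. f (u \<oplus>\<^bsub>V\<^esub> v) = f u \<oplus>\<^bsub>W\<^esub> f v)
     \<and> (\<forall>c\<in>carrier K. \<forall>v\<in>carrier V. f (c \<odot>\<^bsub>V\<^esub> v) = c \<odot>\<^bsub>W\<^esub> f v)}"

text \<open>The ground field as a vector space over itself.\<close>

definition scalar_module :: "('k, 'r) ring_scheme \<Rightarrow> ('k, 'k) module" where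
  "scalar_module K = \<lparr>carrier = carrier K, monoid.mult = monoid.mult K, one = \<one>\<^bsub>K\<^esub>,
     ring.zero = \<zero>\<^bsub>K\<^esub>, add = add K, smult = monoid.mult K\<rparr>"

definition supp :: "('k, 'r) ring_scheme \<Rightarrow> 's set \<Rightarrow> ('s \<Rightarrow> 'k) \<Rightarrow> 's set" where
  "supp K S f = {s \<in> S. f s \<noteq> \<zero>\<^bsub>K\<^esub>}"

definition free_module :: "('k, 'r) ring_scheme \<Rightarrow> 's set \<Rightarrow> ('k, 's \<Rightarrow> 'k) module" where
  "free_module K S = \<lparr>carrier = {f \<in> S \<rightarrow>\<^sub>E carrier K. finite (supp K S f)},
     monoid.mult = undefined, one = undefined,
     ring.zero = (\<lambda>s\<in>S. \<zero>\<^bsub>K\<^esub>), add = (\<lambda>f h. \<lambda>s\<in>S. f s \<oplus>\<^bsub>K\<^esub> h s),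
     smult = (\<lambda>c f. \<lambda>s\<in>S. c \<otimes>\<^bsub>K\<^esub> f s)\<rparr>"

definition basis_vec :: "('k, 'r) ring_scheme \<Rightarrow> 's set \<Rightarrow> 's \<Rightarrow> 's \<Rightarrow> 'k" where
  "basis_vec K S s = (\<lambda>t\<in>S. if t = s then \<one>\<^bsub>K\<^esub> else \<zero>\<^bsub>K\<^esub>)"

definition submodule_span ::
    "('k, 'r) ring_scheme \<Rightarrow> ('k, 'v, 'x) module_scheme \<Rightarrow> 'v set \<Rightarrow> 'v set" where
  "submodule_span K V U = \<Inter>{H. submodule H K V \<and> U \<subseteq> H}"

definition quotient_module ::
    "('k, 'r) ring_scheme \<Rightarrow> ('k, 'v, 'x) module_scheme \<Rightarrow> 'v set \<Rightarrow> ('k, 'v set) module" where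
  "quotient_module K V H = \<lparr>carrier = A_RCOSETS V H, monoid.mult = undefined, one = undefined,
     ring.zero = H, add = (\<lambda>C D. C <+>\<^bsub>V\<^esub> D),
     smult = (\<lambda>c C. H <+>\<^bsub>V\<^esub> (\<lambda>v. c \<odot>\<^bsub>V\<^esub> v) ` C)\<rparr>"


section \<open>Tensor products of vector spaces\<close>

definition tensor_rels ::
    "('k, 'r) ring_scheme \<Rightarrow> ('k, 'm, 'x) module_scheme \<Rightarrow> ('k, 'n, 'y) module_scheme
      \<Rightarrow> ('m \<times> 'n \<Rightarrow> 'k) set" where
  "tensor_rels K M N =
    (let F = free_module K (carrier M \<times> carrier N);
         e = (\<lambda>m n. basis_vec K (carrier M \<times> carrier N) (m, n)) in
      {e (m \<oplus>\<^bsub>M\<^esub> m') n \<ominus>\<^bsub>F\<^esub> (e m n \<oplus>\<^bsub>F\<^esub> e m' n) | m m' n.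
          m \<in> carrier M \<and> m' \<in> carrier M \<and> n \<in> carrier N}
    \<union> {e m (n \<oplus>\<^bsub>N\<^esub> n') \<ominus>\<^bsub>F\<^esub> (e m n \<oplus>\<^bsub>F\<^esub> e m n') | m n n'.
          m \<in> carrier M \<and> n \<in> carrier N \<and> n' \<in> carrier N}
    \<union> {e (c \<odot>\<^bsub>M\<^esub> m) n \<ominus>\<^bsub>F\<^esub> (c \<odot>\<^bsub>F\<^esub> e m n) | c m n.
          c \<in> carrier K \<and> m \<in> carrier M \<and> n \<in> carrier N}
    \<union> {e m (c \<odot>\<^bsub>N\<^esub> n) \<ominus>\<^bsub>F\<^esub> (c \<odot>\<^bsub>F\<^esub> e m n) | c m n.
          c \<in> carrier K \<and> m \<in> carrier M \<and> n \<in> carrier N})"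

definition tensor_null ::
    "('k, 'r) ring_scheme \<Rightarrow> ('k, 'm, 'x) module_scheme \<Rightarrow> ('k, 'n, 'y) module_scheme
      \<Rightarrow> ('m \<times> 'n \<Rightarrow> 'k) set" where
  "tensor_null K M N =
     submodule_span K (free_module K (carrier M \<times> carrier N)) (tensor_rels K M N)"

definition tensor ::
    "('k, 'r) ring_scheme \<Rightarrow> ('k, 'm, 'x) module_scheme \<Rightarrow> ('k, 'n, 'y) module_scheme
      \<Rightarrow> ('k, ('m \<times> 'n \<Rightarrow> 'k) set) module" where
  "tensor K M N =
     quotient_module K (free_module K (carrier M \<times> carrier N)) (tensor_null K M N)"

definition pure_tensor ::
    "('k, 'r) ring_scheme \<Rightarrow> ('k, 'm, 'x) module_scheme \<Rightarrow> ('k, 'n, 'y) module_scheme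
      \<Rightarrow> 'm \<Rightarrow> 'n \<Rightarrow> ('m \<times> 'n \<Rightarrow> 'k) set" where
  "pure_tensor K M N m n =
     tensor_null K M N +>\<^bsub>free_module K (carrier M \<times> carrier N)\<^esub>
       basis_vec K (carrier M \<times> carrier N) (m, n)"

text \<open>The linear map on the tensor product induced by a bilinear map \<open>\<beta>\<close> into \<open>W\<close>: for bilinear
  \<open>\<beta>\<close> the value below is the same for all representatives \<open>v\<close> of the coset \<open>t\<close>.\<close>

definition tensor_lift ::
    "('k, 'r) ring_scheme \<Rightarrow> ('k, 'm, 'x) module_scheme \<Rightarrow> ('k, 'n, 'y) module_scheme
      \<Rightarrow> ('k, 'w, 'z) module_scheme \<Rightarrow> ('m \<Rightarrow> 'n \<Rightarrow> 'w) \<Rightarrow> ('m \<times> 'n \<Rightarrow> 'k) set \<Rightarrow> 'w" where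
  "tensor_lift K M N W \<beta> t = the_elem
     ((\<lambda>v. \<Oplus>\<^bsub>W\<^esub>s\<in>supp K (carrier M \<times> carrier N) v. v s \<odot>\<^bsub>W\<^esub> \<beta> (fst s) (snd s)) ` t)"


section \<open>Modules over Hopf algebras\<close>

record ('k, 'a) hopf = "('k, 'a) module" +
  comult :: "'a \<Rightarrow> ('a \<times> 'a \<Rightarrow> 'k) set"
  counit :: "'a \<Rightarrow> 'k"
  antipode :: "'a \<Rightarrow> 'a"

record ('k, 'a, 'm) rep = "('k, 'm) module" +
  act :: "'a \<Rightarrow> 'm \<Rightarrow> 'm"

text \<open>Left modules over a \<open>K\<close>-algebra \<open>H\<close>, not necessarily finite dimensional.\<close>

locale algebra_module = module K M
  for K (structure) and H :: "('k, 'a, 'x) module_scheme" and M :: "('k, 'a, 'm, 'y) rep_scheme" (structure) +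
  assumes act_closed: "a \<in> carrier H \<Longrightarrow> m \<in> carrier M \<Longrightarrow> act M a m \<in> carrier M"
    and act_add_left: "a \<in> carrier H \<Longrightarrow> b \<in> carrier H \<Longrightarrow> m \<in> carrier M \<Longrightarrow>
      act M (a \<oplus>\<^bsub>H\<^esub> b) m = act M a m \<oplus>\<^bsub>M\<^esub> act M b m"
    and act_add_right: "a \<in> carrier H \<Longrightarrow> m \<in> carrier M \<Longrightarrow> n \<in> carrier M \<Longrightarrow>
      act M a (m \<oplus>\<^bsub>M\<^esub> n) = act M a m \<oplus>\<^bsub>M\<^esub> act M a n"
    and act_smult_left: "c \<in> carrier K \<Longrightarrow> a \<in> carrier H \<Longrightarrow> m \<in> carrier M \<Longrightarrow>
      act M (c \<odot>\<^bsub>H\<^esub> a) m = c \<odot>\<^bsub>M\<^esub> act M a m"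
    and act_smult_right: "c \<in> carrier K \<Longrightarrow> a \<in> carrier H \<Longrightarrow> m \<in> carrier M \<Longrightarrow>
      act M a (c \<odot>\<^bsub>M\<^esub> m) = c \<odot>\<^bsub>M\<^esub> act M a m"
    and act_mult: "a \<in> carrier H \<Longrightarrow> b \<in> carrier H \<Longrightarrow> m \<in> carrier M \<Longrightarrow>
      act M (a \<otimes>\<^bsub>H\<^esub> b) m = act M a (act M b m)"
    and act_one: "m \<in> carrier M \<Longrightarrow> act M \<one>\<^bsub>H\<^esub> m = m"

definition rep_iso ::
    "('k, 'r) ring_scheme \<Rightarrow> ('k, 'a, 'x) module_scheme \<Rightarrow> ('k, 'a, 'v, 'y) rep_scheme
      \<Rightarrow> ('k, 'a, 'w, 'z) rep_scheme \<Rightarrow> ('v \<Rightarrow> 'w) set" where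
  "rep_iso K H V W = {f \<in> linear_map K V W. bij_betw f (carrier V) (carrier W)
     \<and> (\<forall>a\<in>carrier H. \<forall>v\<in>carrier V. f (act V a v) = act W a (f v))}"

text \<open>If \<open>\<Delta> a = \<Sum> a\<^sub>1 \<otimes> a\<^sub>2\<close>, then \<open>a \<cdot> (m \<otimes> n) = \<Sum> a\<^sub>1 m \<otimes> a\<^sub>2 n\<close>.\<close>

definition tensor_rep ::
    "('k, 'r) ring_scheme \<Rightarrow> ('k, 'a, 'x) hopf_scheme \<Rightarrow> ('k, 'a, 'm, 'y) rep_scheme
      \<Rightarrow> ('k, 'a, 'n, 'z) rep_scheme \<Rightarrow> ('k, 'a, ('m \<times> 'n \<Rightarrow> 'k) set) rep" where
  "tensor_rep K H M N = (let T = tensor K M N in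
     module.extend T \<lparr>act = (\<lambda>a t.
       tensor_lift K H H T
         (\<lambda>b c. tensor_lift K M N T (\<lambda>m n. pure_tensor K M N (act M b m) (act N c n)) t)
         (comult H a))\<rparr>)"

definition dual_rep ::
    "('k, 'r) ring_scheme \<Rightarrow> ('k, 'a, 'x) hopf_scheme \<Rightarrow> ('k, 'a, 'm, 'y) rep_scheme
      \<Rightarrow> ('k, 'a, 'm \<Rightarrow> 'k) rep" where
  "dual_rep K H M = \<lparr>carrier = linear_map K M (scalar_module K) \<inter> extensional (carrier M),
     monoid.mult = undefined, one = undefined,
     ring.zero = (\<lambda>m\<in>carrier M. \<zero>\<^bsub>K\<^esub>), add = (\<lambda>f h. \<lambda>m\<in>carrier M. f m \<oplus>\<^bsub>K\<^esub> h m),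
     smult = (\<lambda>c f. \<lambda>m\<in>carrier M. c \<otimes>\<^bsub>K\<^esub> f m),
     act = (\<lambda>a f. \<lambda>m\<in>carrier M. f (act M (antipode H a) m))\<rparr>"

definition direct_sum_rep ::
    "'i set \<Rightarrow> ('i \<Rightarrow> ('k, 'a, 'v, 'y) rep_scheme) \<Rightarrow> ('k, 'a, 'i \<Rightarrow> 'v) rep" where
  "direct_sum_rep I V = \<lparr>carrier = {t \<in> (\<Pi>\<^sub>E i\<in>I. carrier (V i)). finite {i \<in> I. t i \<noteq> \<zero>\<^bsub>V i\<^esub>}},
     monoid.mult = undefined, one = undefined,
     ring.zero = (\<lambda>i\<in>I. \<zero>\<^bsub>V i\<^esub>), add = (\<lambda>t u. \<lambda>i\<in>I. t i \<oplus>\<^bsub>V i\<^esub> u i),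
     smult = (\<lambda>c t. \<lambda>i\<in>I. c \<odot>\<^bsub>V i\<^esub> t i),
     act = (\<lambda>a t. \<lambda>i\<in>I. act (V i) a (t i))\<rparr>"

definition direct_sum_inj ::
    "'i set \<Rightarrow> ('i \<Rightarrow> ('k, 'a, 'v, 'y) rep_scheme) \<Rightarrow> 'i \<Rightarrow> 'v \<Rightarrow> 'i \<Rightarrow> 'v" where
  "direct_sum_inj I V i v = (\<lambda>j\<in>I. if j = i then v else \<zero>\<^bsub>V j\<^esub>)"


section \<open>The group algebra and the dual of the smash product\<close>

text \<open>Elements of \<open>kG\<close> are functions on \<open>G\<close>, the group element \<open>g\<close> being the basis vector at \<open>g\<close>.
  With \<open>\<Delta> g = g \<otimes> g\<close> and \<open>S g = g\<^sup>-\<^sup>1\<close>, tensor products and duals of \<open>kG\<close>-modules are the usual ones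
  for group representations.\<close>

definition group_algebra ::
    "('k, 'r) ring_scheme \<Rightarrow> ('g, 's) monoid_scheme \<Rightarrow> ('k, 'g \<Rightarrow> 'k) hopf" where
  "group_algebra K G =
    (let V = free_module K (carrier G); e = basis_vec K (carrier G); T = tensor K V V in
     \<lparr>carrier = carrier V,
      monoid.mult = (\<lambda>a b. \<lambda>g\<in>carrier G. \<Oplus>\<^bsub>K\<^esub>h\<in>carrier G. a h \<otimes>\<^bsub>K\<^esub> b (inv\<^bsub>G\<^esub> h \<otimes>\<^bsub>G\<^esub> g)),
      one = e \<one>\<^bsub>G\<^esub>, ring.zero = \<zero>\<^bsub>V\<^esub>, add = add V, smult = smult V,
      comult = (\<lambda>a. \<Oplus>\<^bsub>T\<^esub>g\<in>carrier G. a g \<odot>\<^bsub>T\<^esub> pure_tensor K V V (e g) (e g)),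
      counit = (\<lambda>a. \<Oplus>\<^bsub>K\<^esub>g\<in>carrier G. a g),
      antipode = (\<lambda>a. \<lambda>g\<in>carrier G. a (inv\<^bsub>G\<^esub> g))\<rparr>)"

text \<open>The Hopf algebra \<open>A\<close> dual to \<open>k[G] # kL\<close>, where \<open>\<phi> x g\<close> is the action of \<open>x \<in> L\<close> on \<open>g \<in> G\<close>.
  A linear form on \<open>k[G] # kL\<close> is given by its values at the basis elements \<open>p\<^sub>g \<otimes> x\<close>, i.e. by a
  function on \<open>G \<times> L\<close>; the basis vector at \<open>(g, x)\<close> is \<open>g \<otimes> p\<^sub>x\<close>. The multiplication is that of
  \<open>kG \<otimes> k[L]\<close>, i.e. \<open>(g \<otimes> p\<^sub>x)(h \<otimes> p\<^sub>y) = \<delta>\<^sub>x\<^sub>y gh \<otimes> p\<^sub>x\<close>; the remaining operations are the linear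
  extensions, writing \<open>x'\<close> for \<open>x\<^sup>-\<^sup>1\<close>, of
  \<open>\<Delta>(g \<otimes> p\<^sub>l) = \<Sum>\<^sub>x (g \<otimes> p\<^sub>x) \<otimes> (\<phi> x' g \<otimes> p\<^sub>y)\<close> with \<open>y = x' l\<close>, \<open>\<epsilon>(g \<otimes> p\<^sub>l) = \<delta>\<^sub>1\<^sub>l\<close>, and
  \<open>S(g \<otimes> p\<^sub>l) = \<phi> l' g' \<otimes> p\<^sub>y\<close> with \<open>y = l'\<close>.\<close>

definition dual_smash ::
    "('k, 'r) ring_scheme \<Rightarrow> ('g, 's) monoid_scheme \<Rightarrow> ('l, 't) monoid_scheme
      \<Rightarrow> ('l \<Rightarrow> 'g \<Rightarrow> 'g) \<Rightarrow> ('k, 'g \<times> 'l \<Rightarrow> 'k) hopf" where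
  "dual_smash K G L \<phi> =
    (let B = carrier G \<times> carrier L; V = free_module K B; e = basis_vec K B; T = tensor K V V in
     \<lparr>carrier = carrier V,
      monoid.mult = (\<lambda>a b. \<lambda>(g, x)\<in>B. \<Oplus>\<^bsub>K\<^esub>h\<in>carrier G. a (h, x) \<otimes>\<^bsub>K\<^esub> b (inv\<^bsub>G\<^esub> h \<otimes>\<^bsub>G\<^esub> g, x)),
      one = (\<lambda>(g, x)\<in>B. if g = \<one>\<^bsub>G\<^esub> then \<one>\<^bsub>K\<^esub> else \<zero>\<^bsub>K\<^esub>),
      ring.zero = \<zero>\<^bsub>V\<^esub>, add = add V, smult = smult V,
      comult = (\<lambda>a. \<Oplus>\<^bsub>T\<^esub>s\<in>B. a s \<odot>\<^bsub>T\<^esub> (case s of (g, l) \<Rightarrow>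
        \<Oplus>\<^bsub>T\<^esub>x\<in>carrier L. pure_tensor K V V (e (g, x)) (e (\<phi> (inv\<^bsub>L\<^esub> x) g, inv\<^bsub>L\<^esub> x \<otimes>\<^bsub>L\<^esub> l)))),
      counit = (\<lambda>a. \<Oplus>\<^bsub>K\<^esub>s\<in>B. a s \<otimes>\<^bsub>K\<^esub> (if snd s = \<one>\<^bsub>L\<^esub> then \<one>\<^bsub>K\<^esub> else \<zero>\<^bsub>K\<^esub>)),
      antipode = (\<lambda>a. \<Oplus>\<^bsub>V\<^esub>s\<in>B. a s \<odot>\<^bsub>V\<^esub> (case s of (g, l) \<Rightarrow>
        e (\<phi> (inv\<^bsub>L\<^esub> l) (inv\<^bsub>G\<^esub> g), inv\<^bsub>L\<^esub> l)))\<rparr>)"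

text \<open>\<open>M\<^sub>l\<close>: the subspace of \<open>M\<close> on which \<open>k[L]\<close>, spanned by the \<open>1 \<otimes> p\<^sub>x\<close>, acts through the character
  \<open>p\<^sub>x \<mapsto> \<delta>\<^sub>x\<^sub>l\<close> of \<open>k\<^sub>l\<close>, with \<open>a \<in> kG\<close> acting as \<open>a \<otimes> 1 = \<Sum>\<^sub>x a \<otimes> p\<^sub>x\<close>.\<close>

definition component ::
    "('k, 'r) ring_scheme \<Rightarrow> ('g, 's) monoid_scheme \<Rightarrow> ('l, 't) monoid_scheme
      \<Rightarrow> ('k, 'g \<times> 'l \<Rightarrow> 'k, 'm, 'y) rep_scheme \<Rightarrow> 'l \<Rightarrow> ('k, 'g \<Rightarrow> 'k, 'm) rep" where
  "component K G L M l = \<lparr>carrier = {m \<in> carrier M. \<forall>x\<in>carrier L.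
       act M (basis_vec K (carrier G \<times> carrier L) (\<one>\<^bsub>G\<^esub>, x)) m = (if x = l then m else \<zero>\<^bsub>M\<^esub>)},
     monoid.mult = undefined, one = undefined, ring.zero = \<zero>\<^bsub>M\<^esub>, add = add M, smult = smult M,
     act = (\<lambda>a. act M (\<lambda>(g, x)\<in>carrier G \<times> carrier L. a g))\<rparr>"

text \<open>The conjugate \<open>\<^sup>yU\<close>: the space \<open>U\<close> on which \<open>g \<in> G\<close> acts as \<open>\<phi> y\<^sup>-\<^sup>1 g\<close> acts on \<open>U\<close>, so that
  \<open>\<^sup>x(\<^sup>yU) = \<^sup>x\<^sup>yU\<close>. The automorphism \<open>\<phi> y\<^sup>-\<^sup>1\<close> sends \<open>a \<in> kG\<close> to the function \<open>h \<mapsto> a (\<phi> y h)\<close>.\<close>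

definition conj_rep ::
    "('g, 's) monoid_scheme \<Rightarrow> ('l \<Rightarrow> 'g \<Rightarrow> 'g) \<Rightarrow> 'l \<Rightarrow> ('k, 'g \<Rightarrow> 'k, 'u, 'y) rep_scheme
      \<Rightarrow> ('k, 'g \<Rightarrow> 'k, 'u, 'y) rep_scheme" where
  "conj_rep G \<phi> y U = U\<lparr>act := (\<lambda>a. act U (\<lambda>h\<in>carrier G. a (\<phi> y h)))\<rparr>"

end

theory Submission
  imports Defs
begin

text \<open>Write \<open>P\<^sub>x\<close> for the operator by which \<open>1 \<otimes> p\<^sub>x\<close> acts on an \<open>A\<close>-module. These operators are orthogonal
  idempotents commuting with the action of \<open>A\<close>, and \<open>M\<^sub>l\<close> is the image of \<open>P\<^sub>l\<close>. So everything is
  decided by what the comultiplication and the antipode do to the elements \<open>1 \<otimes> p\<^sub>l\<close>, and the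
  twists by \<open>\<phi>\<close> come from what they do to \<open>g \<otimes> p\<^sub>l\<close>. Below, \<open>x'\<close> stands for \<open>x\<^sup>-\<^sup>1\<close>.

  \<^bold>\<open>Tensor products.\<close> Since \<open>\<phi> x'\<close> fixes \<open>1\<close>, the idempotent that cuts out \<open>(M \<otimes> N)\<^sub>l\<close> is
  \<open>\<Delta>(1 \<otimes> p\<^sub>l) = \<Sum> (1 \<otimes> p\<^sub>a) \<otimes> (1 \<otimes> p\<^sub>b)\<close>, the sum running over \<open>a b = l\<close>; it acts on \<open>M \<otimes> N\<close> as
  \<open>\<Sum> P\<^sub>a \<otimes> P\<^sub>b\<close> (\<open>VMN_act_E_one\<close>). Hence the maps \<open>M\<^sub>a \<otimes> N\<^sub>b \<rightarrow> M \<otimes> N\<close> induced by the inclusions,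
  summed over \<open>a b = l\<close>, are inverted on \<open>(M \<otimes> N)\<^sub>l\<close> by the maps induced by the pairs
  \<open>(P\<^sub>a, P\<^sub>b)\<close>. For the action of \<open>g \<in> G\<close>, the first tensor factor \<open>g \<otimes> p\<^sub>x\<close> of a summand of
  \<open>\<Delta>(g \<otimes> p\<^sub>l)\<close> kills \<open>M\<^sub>a\<close> unless \<open>x = a\<close>; what remains acts on \<open>N\<^sub>b\<close> through \<open>\<phi> a' g\<close>, which is
  how \<open>g\<close> acts on the conjugate of \<open>N\<^sub>b\<close> by \<open>a\<close> (\<open>VMN_act_C\<close>, \<open>VC_act_pure\<close>).

  \<^bold>\<open>Duals.\<close> The antipode sends \<open>1 \<otimes> p\<^sub>l\<close> to \<open>1 \<otimes> p\<^sub>y\<close> with \<open>y = l'\<close>, so a linear form \<open>f\<close> lies in \<open>(M\<^sup>*)\<^sub>l\<close>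
  exactly when \<open>f = f \<circ> P\<^sub>y\<close> (\<open>dual_component_carrier\<close>), that is, when it is the extension by zero
  of its restriction to \<open>M\<^sub>y\<close>. On \<open>M\<^sub>y\<close> the antipode of \<open>g \<otimes> 1\<close> acts as \<open>\<phi> l' g'\<close>, which gives
  the conjugate by \<open>l\<close> of the dual representation (\<open>act_antipode_C\<close>).

  The tensor products are quotients of free modules on all pairs, so the universal property is
  established along the way: linear maps out of a tensor product are induced by bilinear maps
  (\<open>tensor_lift_linear\<close>, \<open>tensor_lift_pure\<close>) and are determined by their values on pure tensors
  (\<open>tensor_ext\<close>). All later identities between such maps are reduced to pure tensors in this way.\<close>

section \<open>Linear maps\<close>

lemma linear_mapI:
  assumes "\<And>v. v \<in> carrier V \<Longrightarrow> f v \<in> carrier W"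
    and "\<And>u v. u \<in> carrier V \<Longrightarrow> v \<in> carrier V \<Longrightarrow> f (u \<oplus>\<^bsub>V\<^esub> v) = f u \<oplus>\<^bsub>W\<^esub> f v"
    and "\<And>c v. c \<in> carrier K \<Longrightarrow> v \<in> carrier V \<Longrightarrow> f (c \<odot>\<^bsub>V\<^esub> v) = c \<odot>\<^bsub>W\<^esub> f v"
  shows "f \<in> linear_map K V W"
  using assms by (auto simp: linear_map_def)

lemma linear_map_closed: "f \<in> linear_map K V W \<Longrightarrow> v \<in> carrier V \<Longrightarrow> f v \<in> carrier W"
  and linear_map_add: "f \<in> linear_map K V W \<Longrightarrow> u \<in> carrier V \<Longrightarrow> v \<in> carrier V \<Longrightarrow>
    f (u \<oplus>\<^bsub>V\<^esub> v) = f u \<oplus>\<^bsub>W\<^esub> f v"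
  and linear_map_smult: "f \<in> linear_map K V W \<Longrightarrow> c \<in> carrier K \<Longrightarrow> v \<in> carrier V \<Longrightarrow>
    f (c \<odot>\<^bsub>V\<^esub> v) = c \<odot>\<^bsub>W\<^esub> f v"
  by (auto simp: linear_map_def)

lemma linear_map_zero:
  assumes "module K V" and "module K W" and f: "f \<in> linear_map K V W"
  shows "f \<zero>\<^bsub>V\<^esub> = \<zero>\<^bsub>W\<^esub>"
proof -
  interpret V: module K V by fact
  interpret W: module K W by fact
  have "f (\<zero>\<^bsub>K\<^esub> \<odot>\<^bsub>V\<^esub> \<zero>\<^bsub>V\<^esub>) = \<zero>\<^bsub>K\<^esub> \<odot>\<^bsub>W\<^esub> f \<zero>\<^bsub>V\<^esub>"
    using f by (intro linear_map_smult) auto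
  then show ?thesis
    using linear_map_closed[OF f V.M.zero_closed] by simp
qed

lemma linear_map_minus:
  assumes "module K V" and "module K W" and f: "f \<in> linear_map K V W" and u: "u \<in> carrier V"
  shows "f (\<ominus>\<^bsub>V\<^esub> u) = \<ominus>\<^bsub>W\<^esub> f u"
proof -
  interpret V: module K V by fact
  interpret W: module K W by fact
  have "f u \<oplus>\<^bsub>W\<^esub> f (\<ominus>\<^bsub>V\<^esub> u) = \<zero>\<^bsub>W\<^esub>"
    using linear_map_add[OF f u V.M.a_inv_closed[OF u]] linear_map_zero[OF assms(1-3)] u
    by (simp add: V.M.r_neg)
  then show ?thesis
    using linear_map_closed[OF f] u by (metis V.M.a_inv_closed W.M.minus_equality W.M.a_comm)
qed

lemma linear_map_diff:
  assumes "module K V" and "module K W" and f: "f \<in> linear_map K V W"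
    and "u \<in> carrier V" and "v \<in> carrier V"
  shows "f (u \<ominus>\<^bsub>V\<^esub> v) = f u \<ominus>\<^bsub>W\<^esub> f v"
proof -
  interpret V: module K V by fact
  show ?thesis
    using assms by (simp add: a_minus_def linear_map_add[OF f] linear_map_minus[OF assms(1-3)])
qed

lemma linear_map_finsum:
  assumes "module K V" and "module K W" and f: "f \<in> linear_map K V W"
    and "finite A" and "g \<in> A \<rightarrow> carrier V"
  shows "f (\<Oplus>\<^bsub>V\<^esub>i\<in>A. g i) = (\<Oplus>\<^bsub>W\<^esub>i\<in>A. f (g i))"
proof -
  interpret V: module K V by fact
  interpret W: module K W by fact
  show ?thesis
    using assms(4,5)
  proof (induction A)
    case empty
    then show ?case by (simp add: linear_map_zero[OF assms(1-3)])
  next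
    case (insert i A)
    then have g: "g \<in> A \<rightarrow> carrier V" "g i \<in> carrier V" by auto
    moreover have "(\<lambda>i. f (g i)) \<in> A \<rightarrow> carrier W" "f (g i) \<in> carrier W"
      using g linear_map_closed[OF f] by auto
    ultimately show ?case
      using insert by (simp add: linear_map_add[OF f])
  qed
qed

lemma linear_map_comp:
  assumes "f \<in> linear_map K V W" and "g \<in> linear_map K W U"
  shows "(\<lambda>v. g (f v)) \<in> linear_map K V U"
  using assms by (intro linear_mapI) (simp_all add: linear_map_closed linear_map_add linear_map_smult)

lemma linear_map_cong:
  assumes "module K V" and "f \<in> linear_map K V W" and eq: "\<And>v. v \<in> carrier V \<Longrightarrow> g v = f v"
  shows "g \<in> linear_map K V W"
proof -
  interpret V: module K V by fact
  show ?thesis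
    using assms(2) by (intro linear_mapI) (simp_all add: eq linear_map_closed linear_map_add linear_map_smult)
qed

lemma zero_linear_map:
  assumes "module K W"
  shows "(\<lambda>v. \<zero>\<^bsub>W\<^esub>) \<in> linear_map K V W"
proof -
  interpret W: module K W by fact
  show ?thesis by (rule linear_mapI) auto
qed

lemma add_linear_map:
  assumes "module K W" and "f \<in> linear_map K V W" and "g \<in> linear_map K V W"
    and "module K V"
  shows "(\<lambda>v. f v \<oplus>\<^bsub>W\<^esub> g v) \<in> linear_map K V W"
proof -
  interpret W: module K W by fact
  interpret V: module K V by fact
  show ?thesis
    using assms
    by (intro linear_mapI)
      (simp_all add: linear_map_closed linear_map_add linear_map_smult W.smult_r_distr W.M.a_ac)
qed

lemma smult_linear_map:
  assumes "module K W" and "f \<in> linear_map K V W" and "c \<in> carrier K"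
  shows "(\<lambda>v. c \<odot>\<^bsub>W\<^esub> f v) \<in> linear_map K V W"
proof -
  interpret W: module K W by fact
  show ?thesis
    using assms
    by (intro linear_mapI)
      (simp_all add: linear_map_closed linear_map_add linear_map_smult W.smult_r_distr
        W.smult_assoc1[symmetric] W.R.m_comm)
qed

lemma finsum_linear_map:
  assumes "module K V" and "module K W" and "finite A"
    and "\<And>i. i \<in> A \<Longrightarrow> f i \<in> linear_map K V W"
  shows "(\<lambda>v. \<Oplus>\<^bsub>W\<^esub>i\<in>A. f i v) \<in> linear_map K V W"
proof -
  interpret W: module K W by fact
  have cl: "(\<lambda>i. f i v) \<in> A \<rightarrow> carrier W" if "v \<in> carrier V" for v
    using assms(4) that by (auto intro: linear_map_closed)
  interpret V: module K V by fact
  show ?thesis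
  proof (rule linear_mapI)
    fix v assume "v \<in> carrier V"
    then show "(\<Oplus>\<^bsub>W\<^esub>i\<in>A. f i v) \<in> carrier W" using cl by (intro W.M.finsum_closed)
  next
    fix u v assume uv: "u \<in> carrier V" "v \<in> carrier V"
    have "(\<Oplus>\<^bsub>W\<^esub>i\<in>A. f i (u \<oplus>\<^bsub>V\<^esub> v)) = (\<Oplus>\<^bsub>W\<^esub>i\<in>A. f i u \<oplus>\<^bsub>W\<^esub> f i v)"
      using uv assms(4) by (intro W.M.finsum_cong') (auto simp: linear_map_add[OF assms(4)] intro: linear_map_closed)
    then show "(\<Oplus>\<^bsub>W\<^esub>i\<in>A. f i (u \<oplus>\<^bsub>V\<^esub> v)) = (\<Oplus>\<^bsub>W\<^esub>i\<in>A. f i u) \<oplus>\<^bsub>W\<^esub> (\<Oplus>\<^bsub>W\<^esub>i\<in>A. f i v)"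
      using cl uv by (simp add: W.M.finsum_addf)
  next
    fix c v assume cv: "c \<in> carrier K" "v \<in> carrier V"
    have "(\<Oplus>\<^bsub>W\<^esub>i\<in>A. f i (c \<odot>\<^bsub>V\<^esub> v)) = (\<Oplus>\<^bsub>W\<^esub>i\<in>A. c \<odot>\<^bsub>W\<^esub> f i v)"
      using cv assms(4) by (intro W.M.finsum_cong') (auto simp: linear_map_smult[OF assms(4)] intro: linear_map_closed)
    then show "(\<Oplus>\<^bsub>W\<^esub>i\<in>A. f i (c \<odot>\<^bsub>V\<^esub> v)) = c \<odot>\<^bsub>W\<^esub> (\<Oplus>\<^bsub>W\<^esub>i\<in>A. f i v)"
      using cl cv \<open>finite A\<close> by (simp add: W.finsum_smult_ldistr)
  qed
qed

lemma (in abelian_monoid) finsum_delta: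
  assumes "finite A" and "s \<in> A" and "f \<in> A \<rightarrow> carrier G"
  shows "(\<Oplus>i\<in>A. if i = s then f i else \<zero>) = f s"
  using finsum_singleton[of s A f] assms by (simp add: eq_commute)

section \<open>Free modules and quotient modules\<close>

text \<open>The supports of a sum or a multiple of vectors differ from those of the vectors themselves, so sums
  over supports are compared after extension to a common finite index set.\<close>

lemma supp_finsum_extend:
  assumes "module K W" and u: "u \<in> carrier (free_module K S)" and b: "b \<in> S \<rightarrow> carrier W"
    and A: "finite A" "A \<subseteq> S" "supp K S u \<subseteq> A"
  shows "(\<Oplus>\<^bsub>W\<^esub>s\<in>supp K S u. u s \<odot>\<^bsub>W\<^esub> b s) = (\<Oplus>\<^bsub>W\<^esub>s\<in>A. u s \<odot>\<^bsub>W\<^esub> b s)"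
proof -
  interpret W: module K W by fact
  have "u s \<odot>\<^bsub>W\<^esub> b s \<in> carrier W" if "s \<in> S" for s
    using u b that by (auto simp: free_module_def PiE_def Pi_def)
  moreover have "u s \<odot>\<^bsub>W\<^esub> b s = \<zero>\<^bsub>W\<^esub>" if "s \<in> A - supp K S u" for s
    using b that A(2) by (auto simp: supp_def Pi_def)
  ultimately show ?thesis
    using A by (intro W.M.add.finprod_mono_neutral_cong_left) (auto simp: Pi_def)
qed

lemma free_module_add_closed:
  assumes "cring K" "u \<in> carrier (free_module K S)" "v \<in> carrier (free_module K S)"
  shows "u \<oplus>\<^bsub>free_module K S\<^esub> v \<in> carrier (free_module K S)"
    and "supp K S (u \<oplus>\<^bsub>free_module K S\<^esub> v) \<subseteq> supp K S u \<union> supp K S v"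
proof -
  interpret K: cring K by fact
  show *: "supp K S (u \<oplus>\<^bsub>free_module K S\<^esub> v) \<subseteq> supp K S u \<union> supp K S v"
    by (auto simp: supp_def free_module_def)
  show "u \<oplus>\<^bsub>free_module K S\<^esub> v \<in> carrier (free_module K S)"
    using assms finite_subset[OF *] by (auto simp: free_module_def PiE_iff)
qed

lemma free_module_smult_closed:
  assumes "cring K" "c \<in> carrier K" "u \<in> carrier (free_module K S)"
  shows "c \<odot>\<^bsub>free_module K S\<^esub> u \<in> carrier (free_module K S)"
    and "supp K S (c \<odot>\<^bsub>free_module K S\<^esub> u) \<subseteq> supp K S u"
proof -
  interpret K: cring K by fact
  show *: "supp K S (c \<odot>\<^bsub>free_module K S\<^esub> u) \<subseteq> supp K S u"
    using assms by (auto simp: supp_def free_module_def)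
  show "c \<odot>\<^bsub>free_module K S\<^esub> u \<in> carrier (free_module K S)"
    using assms finite_subset[OF *] by (auto simp: free_module_def PiE_iff)
qed

lemma module_free_module:
  assumes "cring K"
  shows "module K (free_module K S)"
proof -
  interpret K: cring K by fact
  let ?F = "free_module K S"
  have cl: "u s \<in> carrier K" if "u \<in> carrier ?F" "s \<in> S" for u s
    using that by (auto simp: free_module_def)
  have ext: "u = v" if "u \<in> carrier ?F" "v \<in> carrier ?F" "\<And>s. s \<in> S \<Longrightarrow> u s = v s" for u v
    using that by (auto simp: free_module_def intro: PiE_ext)
  have a: "(u \<oplus>\<^bsub>?F\<^esub> v) s = u s \<oplus>\<^bsub>K\<^esub> v s" and m: "(c \<odot>\<^bsub>?F\<^esub> u) s = c \<otimes>\<^bsub>K\<^esub> u s"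
    and z: "\<zero>\<^bsub>?F\<^esub> s = \<zero>\<^bsub>K\<^esub>" if "s \<in> S" for u v s c
    using that by (auto simp: free_module_def)
  have zc: "\<zero>\<^bsub>?F\<^esub> \<in> carrier ?F"
  proof -
    have "supp K S (\<lambda>s\<in>S. \<zero>\<^bsub>K\<^esub>) = {}" by (auto simp: supp_def)
    then show ?thesis by (auto simp: free_module_def)
  qed
  note [simp] = free_module_add_closed(1)[OF assms] free_module_smult_closed(1)[OF assms] cl a m z zc
  show ?thesis
  proof (rule moduleI, fact assms)
    show "abelian_group ?F"
    proof (rule abelian_groupI)
      fix u assume u: "u \<in> carrier ?F"
      have "(\<ominus>\<^bsub>K\<^esub> \<one>\<^bsub>K\<^esub>) \<odot>\<^bsub>?F\<^esub> u \<oplus>\<^bsub>?F\<^esub> u = \<zero>\<^bsub>?F\<^esub>"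
        by (rule ext) (use u in \<open>auto simp: K.l_minus K.l_neg\<close>)
      then show "\<exists>v\<in>carrier ?F. v \<oplus>\<^bsub>?F\<^esub> u = \<zero>\<^bsub>?F\<^esub>"
        using u by (intro bexI[of _ "(\<ominus>\<^bsub>K\<^esub> \<one>\<^bsub>K\<^esub>) \<odot>\<^bsub>?F\<^esub> u"]) auto
    qed (auto intro!: ext simp: K.a_ac)
  qed (auto intro!: ext simp: K.l_distr K.r_distr K.m_assoc)
qed

lemma basis_vec_closed:
  assumes "cring K" and "s \<in> S"
  shows "basis_vec K S s \<in> carrier (free_module K S)" and "supp K S (basis_vec K S s) \<subseteq> {s}"
proof -
  interpret K: cring K by fact
  show *: "supp K S (basis_vec K S s) \<subseteq> {s}" by (auto simp: supp_def basis_vec_def)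
  show "basis_vec K S s \<in> carrier (free_module K S)"
    using finite_subset[OF *] by (auto simp: free_module_def basis_vec_def)
qed

text \<open>The linear map on the free module that extends \<open>b\<close>. The sum has the form of the one in
  \<^const>\<open>tensor_lift\<close>, taken at a single representative.\<close>

definition free_lift ::
    "('k, 'r) ring_scheme \<Rightarrow> 's set \<Rightarrow> ('k, 'w, 'z) module_scheme \<Rightarrow> ('s \<Rightarrow> 'w) \<Rightarrow> ('s \<Rightarrow> 'k) \<Rightarrow> 'w"
  where "free_lift K S W b u = (\<Oplus>\<^bsub>W\<^esub>s\<in>supp K S u. u s \<odot>\<^bsub>W\<^esub> b s)"

lemma free_lift_linear:
  assumes "module K W" and b: "b \<in> S \<rightarrow> carrier W"
  shows "free_lift K S W b \<in> linear_map K (free_module K S) W"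
proof -
  interpret W: module K W by fact
  let ?F = "free_module K S"
  have cl: "u s \<in> carrier K" if "u \<in> carrier ?F" "s \<in> S" for u s
    using that by (auto simp: free_module_def)
  have fin: "finite (supp K S u)" if "u \<in> carrier ?F" for u
    using that by (auto simp: free_module_def)
  have sub: "supp K S u \<subseteq> S" for u by (auto simp: supp_def)
  show ?thesis
  proof (rule linear_mapI)
    fix u assume "u \<in> carrier ?F"
    then show "free_lift K S W b u \<in> carrier W"
      unfolding free_lift_def using cl b sub by (intro W.M.finsum_closed) blast
  next
    fix u v assume uv: "u \<in> carrier ?F" "v \<in> carrier ?F"
    let ?A = "supp K S u \<union> supp K S v"
    note w = free_module_add_closed[OF W.R.is_cring uv]
    have A: "finite ?A" "?A \<subseteq> S" using fin uv sub by auto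
    have bA: "s \<in> ?A \<Longrightarrow> b s \<in> carrier W" for s using b A by auto
    have uA: "s \<in> ?A \<Longrightarrow> u s \<in> carrier K" "s \<in> ?A \<Longrightarrow> v s \<in> carrier K" for s using uv cl A by auto
    have "free_lift K S W b (u \<oplus>\<^bsub>?F\<^esub> v) = (\<Oplus>\<^bsub>W\<^esub>s\<in>?A. (u \<oplus>\<^bsub>?F\<^esub> v) s \<odot>\<^bsub>W\<^esub> b s)"
      unfolding free_lift_def using A w b by (intro supp_finsum_extend[OF assms(1)]) auto
    also have "\<dots> = (\<Oplus>\<^bsub>W\<^esub>s\<in>?A. u s \<odot>\<^bsub>W\<^esub> b s \<oplus>\<^bsub>W\<^esub> v s \<odot>\<^bsub>W\<^esub> b s)"
    proof (rule W.M.finsum_cong'[OF refl])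
      show "(\<lambda>s. u s \<odot>\<^bsub>W\<^esub> b s \<oplus>\<^bsub>W\<^esub> v s \<odot>\<^bsub>W\<^esub> b s) \<in> ?A \<rightarrow> carrier W"
        using bA uA by auto
      fix s assume s: "s \<in> ?A"
      then have "s \<in> S" using A by auto
      then show "(u \<oplus>\<^bsub>?F\<^esub> v) s \<odot>\<^bsub>W\<^esub> b s = u s \<odot>\<^bsub>W\<^esub> b s \<oplus>\<^bsub>W\<^esub> v s \<odot>\<^bsub>W\<^esub> b s"
        using bA[OF s] uA[OF s] by (simp add: free_module_def W.smult_l_distr)
    qed
    also have "\<dots> = (\<Oplus>\<^bsub>W\<^esub>s\<in>?A. u s \<odot>\<^bsub>W\<^esub> b s) \<oplus>\<^bsub>W\<^esub> (\<Oplus>\<^bsub>W\<^esub>s\<in>?A. v s \<odot>\<^bsub>W\<^esub> b s)"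
      using bA uA by (intro W.M.finsum_addf) auto
    also have "\<dots> = free_lift K S W b u \<oplus>\<^bsub>W\<^esub> free_lift K S W b v"
      unfolding free_lift_def
      using A uv b by (intro arg_cong2[of _ _ _ _ "add W"] supp_finsum_extend[OF assms(1), symmetric]) auto
    finally show "free_lift K S W b (u \<oplus>\<^bsub>?F\<^esub> v) = free_lift K S W b u \<oplus>\<^bsub>W\<^esub> free_lift K S W b v" .
  next
    fix c u assume cu: "c \<in> carrier K" "u \<in> carrier ?F"
    let ?A = "supp K S u"
    note w = free_module_smult_closed[OF W.R.is_cring cu]
    have A: "finite ?A" "?A \<subseteq> S" using fin cu sub by auto
    have bA: "s \<in> ?A \<Longrightarrow> b s \<in> carrier W" for s using b A by auto
    have uA: "s \<in> ?A \<Longrightarrow> u s \<in> carrier K" for s using cu cl A by auto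
    have "free_lift K S W b (c \<odot>\<^bsub>?F\<^esub> u) = (\<Oplus>\<^bsub>W\<^esub>s\<in>?A. (c \<odot>\<^bsub>?F\<^esub> u) s \<odot>\<^bsub>W\<^esub> b s)"
      unfolding free_lift_def using A w b by (intro supp_finsum_extend[OF assms(1)]) auto
    also have "\<dots> = (\<Oplus>\<^bsub>W\<^esub>s\<in>?A. c \<odot>\<^bsub>W\<^esub> (u s \<odot>\<^bsub>W\<^esub> b s))"
    proof (rule W.M.finsum_cong'[OF refl])
      show "(\<lambda>s. c \<odot>\<^bsub>W\<^esub> (u s \<odot>\<^bsub>W\<^esub> b s)) \<in> ?A \<rightarrow> carrier W"
        using bA uA cu by auto
      fix s assume s: "s \<in> ?A"
      then have "s \<in> S" using A by auto
      then show "(c \<odot>\<^bsub>?F\<^esub> u) s \<odot>\<^bsub>W\<^esub> b s = c \<odot>\<^bsub>W\<^esub> (u s \<odot>\<^bsub>W\<^esub> b s)"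
        using bA[OF s] uA[OF s] cu by (simp add: free_module_def W.smult_assoc1)
    qed
    also have "\<dots> = c \<odot>\<^bsub>W\<^esub> free_lift K S W b u"
      unfolding free_lift_def using A bA uA cu
      by (intro W.finsum_smult_ldistr[symmetric]) auto
    finally show "free_lift K S W b (c \<odot>\<^bsub>?F\<^esub> u) = c \<odot>\<^bsub>W\<^esub> free_lift K S W b u" .
  qed
qed

lemma free_lift_basis_vec:
  assumes "module K W" and b: "b \<in> S \<rightarrow> carrier W" and s: "s \<in> S"
  shows "free_lift K S W b (basis_vec K S s) = b s"
proof -
  interpret W: module K W by fact
  have bs: "b s \<in> carrier W" using b s by auto
  have "free_lift K S W b (basis_vec K S s) = (\<Oplus>\<^bsub>W\<^esub>t\<in>{s}. basis_vec K S s t \<odot>\<^bsub>W\<^esub> b t)"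
    unfolding free_lift_def
    using basis_vec_closed[OF W.R.is_cring s] b s by (intro supp_finsum_extend[OF assms(1)]) auto
  also have "\<dots> = b s"
    using bs s by (simp add: basis_vec_def)
  finally show ?thesis .
qed

lemma free_module_finsum_apply:
  assumes "cring K" and "finite A" and "f \<in> A \<rightarrow> carrier (free_module K S)" and t: "t \<in> S"
  shows "(\<Oplus>\<^bsub>free_module K S\<^esub>s\<in>A. f s) t = (\<Oplus>\<^bsub>K\<^esub>s\<in>A. f s t)"
proof -
  interpret K: cring K by fact
  interpret F: module K "free_module K S" by (rule module_free_module) fact
  show ?thesis
    using assms(2,3)
  proof (induction A)
    case empty
    have "\<zero>\<^bsub>free_module K S\<^esub> t = \<zero>\<^bsub>K\<^esub>" using t by (simp add: free_module_def)
    then show ?case by simp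
  next
    case (insert i A)
    then have f: "f \<in> A \<rightarrow> carrier (free_module K S)" "f i \<in> carrier (free_module K S)" by auto
    then have "(\<lambda>s. f s t) \<in> A \<rightarrow> carrier K" "f i t \<in> carrier K"
      using t by (auto simp: free_module_def)
    moreover have "(u \<oplus>\<^bsub>free_module K S\<^esub> v) t = u t \<oplus>\<^bsub>K\<^esub> v t" for u v
      using t by (simp add: free_module_def)
    ultimately show ?case
      using insert f by simp
  qed
qed

lemma free_module_expand:
  assumes "cring K" and u: "u \<in> carrier (free_module K S)"
  shows "u = free_lift K S (free_module K S) (basis_vec K S) u"
proof -
  interpret K: cring K by fact
  let ?F = "free_module K S"
  interpret F: module K ?F by (rule module_free_module) fact
  have b: "basis_vec K S \<in> S \<rightarrow> carrier ?F" using basis_vec_closed[OF assms(1)] by auto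
  have A: "finite (supp K S u)" "supp K S u \<subseteq> S" using u by (auto simp: free_module_def supp_def)
  have us: "u s \<in> carrier K" if "s \<in> S" for s using u that by (auto simp: free_module_def)
  have cl: "(\<lambda>s. u s \<odot>\<^bsub>?F\<^esub> basis_vec K S s) \<in> supp K S u \<rightarrow> carrier ?F"
    using b us A by auto
  have R: "free_lift K S ?F (basis_vec K S) u \<in> carrier ?F"
    using free_lift_linear[OF F.module_axioms b] u by (rule linear_map_closed)
  have mem: "w \<in> S \<rightarrow>\<^sub>E carrier K" if "w \<in> carrier ?F" for w
    using that by (auto simp: free_module_def)
  have eq: "u t = free_lift K S ?F (basis_vec K S) u t" if t: "t \<in> S" for t
  proof -
    have "free_lift K S ?F (basis_vec K S) u t
        = (\<Oplus>\<^bsub>K\<^esub>s\<in>supp K S u. (u s \<odot>\<^bsub>?F\<^esub> basis_vec K S s) t)"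
      unfolding free_lift_def by (rule free_module_finsum_apply[OF assms(1) A(1) cl t])
    also have "\<dots> = (\<Oplus>\<^bsub>K\<^esub>s\<in>supp K S u. if s = t then u s else \<zero>\<^bsub>K\<^esub>)"
      using us A t
      by (intro K.finsum_cong') (auto simp: free_module_def basis_vec_def)
    also have "\<dots> = u t"
    proof (cases "t \<in> supp K S u")
      case True
      then show ?thesis using A us by (intro K.finsum_delta) auto
    next
      case False
      then have "(\<Oplus>\<^bsub>K\<^esub>s\<in>supp K S u. if s = t then u s else \<zero>\<^bsub>K\<^esub>) = (\<Oplus>\<^bsub>K\<^esub>s\<in>supp K S u. \<zero>\<^bsub>K\<^esub>)"
        by (intro K.finsum_cong') auto
      then show ?thesis using False t by (simp add: supp_def)
    qed
    finally show ?thesis by simp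
  qed
  show ?thesis
    by (rule PiE_ext[OF mem[OF u] mem[OF R] eq])
qed

lemma free_module_linear_map_expand:
  assumes "module K W" and f: "f \<in> linear_map K (free_module K S) W" and u: "u \<in> carrier (free_module K S)"
  shows "f u = free_lift K S W (\<lambda>s. f (basis_vec K S s)) u"
proof -
  interpret W: module K W by fact
  let ?F = "free_module K S"
  interpret F: module K ?F by (rule module_free_module) (rule W.R.is_cring)
  have b: "basis_vec K S s \<in> carrier ?F" if "s \<in> S" for s
    using basis_vec_closed[OF W.R.is_cring that] by auto
  have A: "finite (supp K S u)" "supp K S u \<subseteq> S" using u by (auto simp: free_module_def supp_def)
  have us: "u s \<in> carrier K" if "s \<in> S" for s using u that by (auto simp: free_module_def)
  have "f u = f (free_lift K S ?F (basis_vec K S) u)"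
    using free_module_expand[OF W.R.is_cring u] by simp
  also have "\<dots> = (\<Oplus>\<^bsub>W\<^esub>s\<in>supp K S u. f (u s \<odot>\<^bsub>?F\<^esub> basis_vec K S s))"
    unfolding free_lift_def
    using A b us by (intro linear_map_finsum[OF F.module_axioms W.module_axioms f]) auto
  also have "\<dots> = free_lift K S W (\<lambda>s. f (basis_vec K S s)) u"
    unfolding free_lift_def using A b us
    by (intro W.M.finsum_cong') (auto simp: linear_map_smult[OF f] subset_iff intro!: linear_map_closed[OF f] W.smult_closed)
  finally show ?thesis .
qed

text \<open>The set of multiples \<open>c \<odot> v\<close> for \<open>v\<close> in a coset \<open>C\<close> may be smaller than a coset (for \<open>c = 0\<close> it is a
  single point); adding \<open>H\<close> in the definition of the scalar multiplication makes it the coset of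
  \<open>c \<odot> v\<close> for any \<open>v \<in> C\<close>.\<close>

lemma module_quotient_module:
  assumes "module K V" and H: "submodule H K V"
  shows "module K (quotient_module K V H)"
    and "(\<lambda>v. H +>\<^bsub>V\<^esub> v) \<in> linear_map K V (quotient_module K V H)"
    and "carrier (quotient_module K V H) = (\<lambda>v. H +>\<^bsub>V\<^esub> v) ` carrier V"
proof -
  interpret V: module K V by fact
  interpret H: submodule H K V by fact
  let ?Q = "quotient_module K V H"
  have "additive_subgroup H V" by (intro additive_subgroup.intro H.subgroup_axioms)
  then interpret A: abelian_subgroup H V
    by (intro abelian_subgroupI3 V.M.abelian_group_axioms)
  have add: "(H +>\<^bsub>V\<^esub> u) \<oplus>\<^bsub>?Q\<^esub> (H +>\<^bsub>V\<^esub> v) = H +>\<^bsub>V\<^esub> (u \<oplus>\<^bsub>V\<^esub> v)"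
    if "u \<in> carrier V" "v \<in> carrier V" for u v
    using that by (simp add: quotient_module_def A.a_rcos_sum)
  have smult: "c \<odot>\<^bsub>?Q\<^esub> (H +>\<^bsub>V\<^esub> v) = H +>\<^bsub>V\<^esub> (c \<odot>\<^bsub>V\<^esub> v)"
    if c: "c \<in> carrier K" and v: "v \<in> carrier V" for c v
  proof
    show "c \<odot>\<^bsub>?Q\<^esub> (H +>\<^bsub>V\<^esub> v) \<subseteq> H +>\<^bsub>V\<^esub> (c \<odot>\<^bsub>V\<^esub> v)"
    proof
      fix x assume "x \<in> c \<odot>\<^bsub>?Q\<^esub> (H +>\<^bsub>V\<^esub> v)"
      then obtain h h' where h: "h \<in> H" "h' \<in> H" "x = h \<oplus>\<^bsub>V\<^esub> c \<odot>\<^bsub>V\<^esub> (h' \<oplus>\<^bsub>V\<^esub> v)"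
        by (auto simp: quotient_module_def set_add_def' a_r_coset_def')
      have "x = (h \<oplus>\<^bsub>V\<^esub> c \<odot>\<^bsub>V\<^esub> h') \<oplus>\<^bsub>V\<^esub> c \<odot>\<^bsub>V\<^esub> v"
        using h c v A.a_subset by (simp add: V.smult_r_distr V.M.a_assoc subset_iff)
      moreover have "h \<oplus>\<^bsub>V\<^esub> c \<odot>\<^bsub>V\<^esub> h' \<in> H"
        using h c A.a_closed by auto
      ultimately show "x \<in> H +>\<^bsub>V\<^esub> (c \<odot>\<^bsub>V\<^esub> v)" by (auto simp: a_r_coset_def')
    qed
    show "H +>\<^bsub>V\<^esub> (c \<odot>\<^bsub>V\<^esub> v) \<subseteq> c \<odot>\<^bsub>?Q\<^esub> (H +>\<^bsub>V\<^esub> v)"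
    proof
      fix x assume "x \<in> H +>\<^bsub>V\<^esub> (c \<odot>\<^bsub>V\<^esub> v)"
      then obtain h where h: "h \<in> H" "x = h \<oplus>\<^bsub>V\<^esub> c \<odot>\<^bsub>V\<^esub> v"
        by (auto simp: a_r_coset_def')
      moreover have "c \<odot>\<^bsub>V\<^esub> v \<in> (\<lambda>v. c \<odot>\<^bsub>V\<^esub> v) ` (H +>\<^bsub>V\<^esub> v)"
        using v by (intro imageI A.a_rcos_self)
      ultimately show "x \<in> c \<odot>\<^bsub>?Q\<^esub> (H +>\<^bsub>V\<^esub> v)"
        unfolding quotient_module_def set_add_def' by auto blast
    qed
  qed
  show car: "carrier ?Q = (\<lambda>v. H +>\<^bsub>V\<^esub> v) ` carrier V"
    by (auto simp: quotient_module_def A_RCOSETS_def')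
  have zero: "\<zero>\<^bsub>?Q\<^esub> = H +>\<^bsub>V\<^esub> \<zero>\<^bsub>V\<^esub>"
    using A.a_subset by (simp add: quotient_module_def)
  show "(\<lambda>v. H +>\<^bsub>V\<^esub> v) \<in> linear_map K V ?Q"
    using add smult car by (intro linear_mapI) auto
  show "module K ?Q"
  proof (rule moduleI, rule V.R.is_cring)
    show "abelian_group ?Q"
    proof (rule abelian_groupI)
      fix x assume "x \<in> carrier ?Q"
      then obtain u where u: "u \<in> carrier V" "x = H +>\<^bsub>V\<^esub> u" using car by auto
      then show "\<exists>y\<in>carrier ?Q. y \<oplus>\<^bsub>?Q\<^esub> x = \<zero>\<^bsub>?Q\<^esub>"
        using car add zero by (intro bexI[of _ "H +>\<^bsub>V\<^esub> (\<ominus>\<^bsub>V\<^esub> u)"]) (auto simp: V.M.l_neg)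
    qed (auto simp: car add zero V.M.a_ac)
  qed (auto simp: car add smult V.smult_l_distr V.smult_r_distr V.smult_assoc1)
qed

lemma submodule_span_submodule:
  assumes "module K V" and "U \<subseteq> carrier V"
  shows "submodule (submodule_span K V U) K V" and "U \<subseteq> submodule_span K V U"
proof -
  interpret V: module K V by fact
  have car: "carrier V \<in> {H. submodule H K V \<and> U \<subseteq> H}"
    using V.carrier_is_submodule assms(2) by auto
  show "submodule (submodule_span K V U) K V"
    unfolding submodule_span_def
  proof (rule V.submoduleI)
    show "\<Inter> {H. submodule H K V \<and> U \<subseteq> H} \<subseteq> carrier V" using car by blast
    show "\<zero>\<^bsub>V\<^esub> \<in> \<Inter> {H. submodule H K V \<and> U \<subseteq> H}"
      by (auto dest!: submodule.axioms(1) dest: subgroup.one_closed)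
  qed (auto dest: V.submoduleE)
  show "U \<subseteq> submodule_span K V U" by (auto simp: submodule_span_def)
qed

lemma submodule_kernel:
  assumes "module K V" and "module K W" and f: "f \<in> linear_map K V W"
  shows "submodule {v \<in> carrier V. f v = \<zero>\<^bsub>W\<^esub>} K V"
proof -
  interpret V: module K V by fact
  interpret W: module K W by fact
  show ?thesis
    by (rule V.submoduleI)
      (auto simp: linear_map_zero[OF assms] linear_map_minus[OF assms] linear_map_add[OF f] linear_map_smult[OF f])
qed

section \<open>Tensor products\<close>

definition bilinear_map ::
    "('k, 'r) ring_scheme \<Rightarrow> ('k, 'm, 'x) module_scheme \<Rightarrow> ('k, 'n, 'y) module_scheme
      \<Rightarrow> ('k, 'w, 'z) module_scheme \<Rightarrow> ('m \<Rightarrow> 'n \<Rightarrow> 'w) set" where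
  "bilinear_map K M N W = {\<beta>. (\<forall>m\<in>carrier M. \<beta> m \<in> linear_map K N W)
     \<and> (\<forall>n\<in>carrier N. (\<lambda>m. \<beta> m n) \<in> linear_map K M W)}"

lemma bilinear_mapI:
  assumes "\<And>m. m \<in> carrier M \<Longrightarrow> \<beta> m \<in> linear_map K N W"
    and "\<And>n. n \<in> carrier N \<Longrightarrow> (\<lambda>m. \<beta> m n) \<in> linear_map K M W"
  shows "\<beta> \<in> bilinear_map K M N W"
  using assms by (auto simp: bilinear_map_def)

lemma bilinear_map_left: "\<beta> \<in> bilinear_map K M N W \<Longrightarrow> n \<in> carrier N \<Longrightarrow> (\<lambda>m. \<beta> m n) \<in> linear_map K M W"
  and bilinear_map_right: "\<beta> \<in> bilinear_map K M N W \<Longrightarrow> m \<in> carrier M \<Longrightarrow> \<beta> m \<in> linear_map K N W"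
  by (auto simp: bilinear_map_def)

lemma bilinear_map_closed:
  "\<beta> \<in> bilinear_map K M N W \<Longrightarrow> m \<in> carrier M \<Longrightarrow> n \<in> carrier N \<Longrightarrow> \<beta> m n \<in> carrier W"
  by (rule linear_map_closed[OF bilinear_map_right])

lemma bilinear_map_comp:
  assumes "\<beta> \<in> bilinear_map K M N W" and "f \<in> linear_map K M' M" and "g \<in> linear_map K N' N"
  shows "(\<lambda>m n. \<beta> (f m) (g n)) \<in> bilinear_map K M' N' W"
proof (rule bilinear_mapI)
  fix m assume "m \<in> carrier M'"
  then have "f m \<in> carrier M" using assms(2) by (rule linear_map_closed[rotated])
  then show "(\<lambda>n. \<beta> (f m) (g n)) \<in> linear_map K N' W"
    using linear_map_comp[OF assms(3) bilinear_map_right[OF assms(1)]] by blast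
next
  fix n assume "n \<in> carrier N'"
  then have "g n \<in> carrier N" using assms(3) by (rule linear_map_closed[rotated])
  then show "(\<lambda>m. \<beta> (f m) (g n)) \<in> linear_map K M' W"
    using linear_map_comp[OF assms(2) bilinear_map_left[OF assms(1)]] by blast
qed

locale tensor_modules = M: module K M + N: module K N for K (structure) and M and N
begin

abbreviation "F \<equiv> free_module K (carrier M \<times> carrier N)"
abbreviation "e \<equiv> \<lambda>m n. basis_vec K (carrier M \<times> carrier N) (m, n)"
abbreviation "T \<equiv> tensor K M N"
abbreviation "H \<equiv> tensor_null K M N"

sublocale F: module K F
  by (rule module_free_module) (rule M.R.is_cring)

lemma e_closed: "m \<in> carrier M \<Longrightarrow> n \<in> carrier N \<Longrightarrow> e m n \<in> carrier F"
  by (intro basis_vec_closed) (auto intro: M.R.is_cring)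

lemma tensor_rels_subset: "tensor_rels K M N \<subseteq> carrier F"
  by (auto simp: tensor_rels_def Let_def intro!: F.M.minus_closed F.M.a_closed F.smult_closed e_closed)

lemma tensor_null_submodule: "submodule H K F" and tensor_rels_null: "tensor_rels K M N \<subseteq> H"
  unfolding tensor_null_def by (intro submodule_span_submodule F.module_axioms tensor_rels_subset)+

lemma module_tensor: "module K T"
  and coset_linear: "(\<lambda>v. H +>\<^bsub>F\<^esub> v) \<in> linear_map K F T"
  and carrier_tensor: "carrier T = (\<lambda>v. H +>\<^bsub>F\<^esub> v) ` carrier F"
  unfolding tensor_def by (intro module_quotient_module F.module_axioms tensor_null_submodule)+

sublocale T: module K T
  by (rule module_tensor)

lemma coset_null:
  assumes "v \<in> H" shows "H +>\<^bsub>F\<^esub> v = \<zero>\<^bsub>T\<^esub>"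
proof -
  have "v \<in> carrier F" using assms F.submoduleE(1)[OF tensor_null_submodule] by auto
  then show ?thesis
    using F.M.a_coset_join2[OF _ submodule.axioms(1)[OF tensor_null_submodule] assms]
    by (simp add: tensor_def quotient_module_def)
qed

lemma coset_eqI:
  assumes "u \<in> carrier F" "v \<in> carrier F" "u \<ominus>\<^bsub>F\<^esub> v \<in> tensor_rels K M N"
  shows "H +>\<^bsub>F\<^esub> u = H +>\<^bsub>F\<^esub> v"
proof -
  have "(H +>\<^bsub>F\<^esub> u) \<ominus>\<^bsub>T\<^esub> (H +>\<^bsub>F\<^esub> v) = \<zero>\<^bsub>T\<^esub>"
    using linear_map_diff[OF F.module_axioms module_tensor coset_linear assms(1,2)]
      coset_null assms(3) tensor_rels_null by auto
  then show ?thesis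
    using linear_map_closed[OF coset_linear] assms(1,2)
    by (metis T.M.a_inv_closed T.M.minus_equality T.M.minus_minus a_minus_def)
qed

lemma pure_tensor_bilinear: "pure_tensor K M N \<in> bilinear_map K M N T"
proof -
  note [simp] = e_closed
  have add_l: "H +>\<^bsub>F\<^esub> e (m \<oplus>\<^bsub>M\<^esub> m') n = H +>\<^bsub>F\<^esub> (e m n \<oplus>\<^bsub>F\<^esub> e m' n)"
    if "m \<in> carrier M" "m' \<in> carrier M" "n \<in> carrier N" for m m' n
    using that by (intro coset_eqI) (auto simp: tensor_rels_def Let_def)
  have add_r: "H +>\<^bsub>F\<^esub> e m (n \<oplus>\<^bsub>N\<^esub> n') = H +>\<^bsub>F\<^esub> (e m n \<oplus>\<^bsub>F\<^esub> e m n')"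
    if "m \<in> carrier M" "n \<in> carrier N" "n' \<in> carrier N" for m n n'
    using that by (intro coset_eqI) (auto simp: tensor_rels_def Let_def)
  have smult_l: "H +>\<^bsub>F\<^esub> e (c \<odot>\<^bsub>M\<^esub> m) n = H +>\<^bsub>F\<^esub> (c \<odot>\<^bsub>F\<^esub> e m n)"
    if "c \<in> carrier K" "m \<in> carrier M" "n \<in> carrier N" for c m n
    using that by (intro coset_eqI) (auto simp: tensor_rels_def Let_def)
  have smult_r: "H +>\<^bsub>F\<^esub> e m (c \<odot>\<^bsub>N\<^esub> n) = H +>\<^bsub>F\<^esub> (c \<odot>\<^bsub>F\<^esub> e m n)"
    if "c \<in> carrier K" "m \<in> carrier M" "n \<in> carrier N" for c m n
    using that by (intro coset_eqI) (auto simp: tensor_rels_def Let_def)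
  show ?thesis
    by (intro bilinear_mapI linear_mapI; unfold pure_tensor_def)
      (simp_all add: add_l add_r smult_l smult_r linear_map_closed[OF coset_linear]
        linear_map_add[OF coset_linear] linear_map_smult[OF coset_linear])
qed

lemma pure_tensor_closed:
  "m \<in> carrier M \<Longrightarrow> n \<in> carrier N \<Longrightarrow> pure_tensor K M N m n \<in> carrier T"
  by (rule bilinear_map_closed[OF pure_tensor_bilinear])

lemma pure_tensor_zero:
  "n \<in> carrier N \<Longrightarrow> pure_tensor K M N \<zero>\<^bsub>M\<^esub> n = \<zero>\<^bsub>T\<^esub>"
  "m \<in> carrier M \<Longrightarrow> pure_tensor K M N m \<zero>\<^bsub>N\<^esub> = \<zero>\<^bsub>T\<^esub>"
  using linear_map_zero[OF M.module_axioms module_tensor bilinear_map_left[OF pure_tensor_bilinear]]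
    linear_map_zero[OF N.module_axioms module_tensor bilinear_map_right[OF pure_tensor_bilinear]]
  by auto

text \<open>The cosets of basis vectors are the pure tensors, and a linear map on the tensor product pulls back
  to a linear map on the free module, which is determined by its values on the basis.\<close>

lemma tensor_ext:
  assumes "module K W" and f: "f \<in> linear_map K T W" and g: "g \<in> linear_map K T W"
    and eq: "\<And>m n. m \<in> carrier M \<Longrightarrow> n \<in> carrier N \<Longrightarrow> f (pure_tensor K M N m n) = g (pure_tensor K M N m n)"
    and t: "t \<in> carrier T"
  shows "f t = g t"
proof -
  obtain v where v: "v \<in> carrier F" "t = H +>\<^bsub>F\<^esub> v"
    using t carrier_tensor by auto
  interpret W: module K W by fact
  let ?b = "\<lambda>h s. h (H +>\<^bsub>F\<^esub> basis_vec K (carrier M \<times> carrier N) s)"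
  have h: "h t = free_lift K (carrier M \<times> carrier N) W (?b h) v" if "h \<in> linear_map K T W" for h
    using free_module_linear_map_expand[OF assms(1) linear_map_comp[OF coset_linear that] v(1)] v(2) by simp
  have vs: "v s \<in> carrier K" if "s \<in> carrier M \<times> carrier N" for s
    using v(1) that by (auto simp: free_module_def)
  have "free_lift K (carrier M \<times> carrier N) W (?b f) v = free_lift K (carrier M \<times> carrier N) W (?b g) v"
    unfolding free_lift_def
  proof (rule W.M.finsum_cong'[OF refl])
    show "(\<lambda>s. v s \<odot>\<^bsub>W\<^esub> ?b g s) \<in> supp K (carrier M \<times> carrier N) v \<rightarrow> carrier W"
      using vs by (auto simp: supp_def intro!: W.smult_closed linear_map_closed[OF g]
        linear_map_closed[OF coset_linear] e_closed)
    show "v s \<odot>\<^bsub>W\<^esub> ?b f s = v s \<odot>\<^bsub>W\<^esub> ?b g s" if "s \<in> supp K (carrier M \<times> carrier N) v" for s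
      using that eq by (auto simp: supp_def pure_tensor_def)
  qed
  then show ?thesis unfolding h[OF f] h[OF g] .
qed

text \<open>A family of linear maps on the tensor product that depends linearly on its parameter at every pure
  tensor does so at every tensor. This gives the bilinearity of operators such as \<open>\<Sum> a\<^sub>1 \<otimes> a\<^sub>2\<close> in their
  coefficients without choosing representatives.\<close>

lemma tensor_ext_linear:
  assumes "module K B" and "module K W"
    and D: "\<And>b. b \<in> carrier B \<Longrightarrow> D b \<in> linear_map K T W"
    and lin: "\<And>m n. m \<in> carrier M \<Longrightarrow> n \<in> carrier N \<Longrightarrow>
      (\<lambda>b. D b (pure_tensor K M N m n)) \<in> linear_map K B W"
    and t: "t \<in> carrier T"
  shows "(\<lambda>b. D b t) \<in> linear_map K B W"
proof -
  interpret B: module K B by fact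
  interpret W: module K W by fact
  show ?thesis
  proof (rule linear_mapI)
    fix b assume "b \<in> carrier B"
    then show "D b t \<in> carrier W" using t by (rule linear_map_closed[OF D])
  next
    fix b c assume bc: "b \<in> carrier B" "c \<in> carrier B"
    show "D (b \<oplus>\<^bsub>B\<^esub> c) t = D b t \<oplus>\<^bsub>W\<^esub> D c t"
    proof (rule tensor_ext[OF assms(2) _ _ _ t])
      show "D (b \<oplus>\<^bsub>B\<^esub> c) \<in> linear_map K T W" using bc by (intro D) auto
      show "(\<lambda>t. D b t \<oplus>\<^bsub>W\<^esub> D c t) \<in> linear_map K T W"
        using bc by (intro add_linear_map assms(2) module_tensor D)
    qed (rule linear_map_add[OF lin bc])
  next
    fix r b assume rb: "r \<in> carrier K" "b \<in> carrier B"
    show "D (r \<odot>\<^bsub>B\<^esub> b) t = r \<odot>\<^bsub>W\<^esub> D b t"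
    proof (rule tensor_ext[OF assms(2) _ _ _ t])
      show "D (r \<odot>\<^bsub>B\<^esub> b) \<in> linear_map K T W" using rb by (intro D) auto
      show "(\<lambda>t. r \<odot>\<^bsub>W\<^esub> D b t) \<in> linear_map K T W"
        using rb by (intro smult_linear_map assms(2) D)
    qed (rule linear_map_smult[OF lin rb])
  qed
qed

text \<open>The kernel of the linear extension of \<open>\<beta>\<close> to the free module contains all defining relations,
  hence the submodule they span, so the extension is constant on every coset and the
  image in the definition of \<^const>\<open>tensor_lift\<close> is a singleton.\<close>

lemma tensor_lift_coset:
  assumes "module K W" and \<beta>: "\<beta> \<in> bilinear_map K M N W" and v: "v \<in> carrier F"
  shows "tensor_lift K M N W \<beta> (H +>\<^bsub>F\<^esub> v)
    = free_lift K (carrier M \<times> carrier N) W (\<lambda>s. \<beta> (fst s) (snd s)) v"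
proof -
  interpret W: module K W by fact
  let ?f = "free_lift K (carrier M \<times> carrier N) W (\<lambda>s. \<beta> (fst s) (snd s))"
  have b: "(\<lambda>s. \<beta> (fst s) (snd s)) \<in> carrier M \<times> carrier N \<rightarrow> carrier W"
    using bilinear_map_closed[OF \<beta>] by auto
  have f: "?f \<in> linear_map K F W"
    by (rule free_lift_linear[OF assms(1) b])
  have fe: "?f (e m n) = \<beta> m n" if "m \<in> carrier M" "n \<in> carrier N" for m n
    using free_lift_basis_vec[OF assms(1) b, of "(m, n)"] that by simp
  note \<beta>s = linear_map_add[OF bilinear_map_left[OF \<beta>]] linear_map_add[OF bilinear_map_right[OF \<beta>]]
    linear_map_smult[OF bilinear_map_left[OF \<beta>]] linear_map_smult[OF bilinear_map_right[OF \<beta>]]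
  have minus_self: "w \<ominus>\<^bsub>W\<^esub> w = \<zero>\<^bsub>W\<^esub>" if "w \<in> carrier W" for w
    using that by (simp add: a_minus_def W.M.r_neg)
  have rels: "tensor_rels K M N \<subseteq> {v \<in> carrier F. ?f v = \<zero>\<^bsub>W\<^esub>}"
  proof
    fix r assume r: "r \<in> tensor_rels K M N"
    have "?f r = \<zero>\<^bsub>W\<^esub>"
      using r unfolding tensor_rels_def Let_def
      by (auto simp: linear_map_diff[OF F.module_axioms assms(1) f] linear_map_add[OF f]
          linear_map_smult[OF f] fe \<beta>s e_closed bilinear_map_closed[OF \<beta>] minus_self)
    then show "r \<in> {v \<in> carrier F. ?f v = \<zero>\<^bsub>W\<^esub>}"
      using r tensor_rels_subset by auto
  qed
  have null: "H \<subseteq> {v \<in> carrier F. ?f v = \<zero>\<^bsub>W\<^esub>}"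
    unfolding tensor_null_def submodule_span_def
    using rels submodule_kernel[OF F.module_axioms assms(1) f] by auto
  have "?f ` (H +>\<^bsub>F\<^esub> v) = {?f v}"
  proof -
    have "?f (h \<oplus>\<^bsub>F\<^esub> v) = ?f v" if "h \<in> H" for h
      using that null v linear_map_closed[OF f v] by (auto simp: linear_map_add[OF f])
    moreover have "\<zero>\<^bsub>F\<^esub> \<in> H"
      using submodule.axioms(1)[OF tensor_null_submodule] by (auto dest: subgroup.one_closed)
    ultimately show ?thesis unfolding a_r_coset_def' by (auto simp: image_UN)
  qed
  then show ?thesis
    by (simp add: tensor_lift_def free_lift_def[abs_def])
qed

lemma tensor_lift_linear:
  assumes "module K W" and \<beta>: "\<beta> \<in> bilinear_map K M N W"
  shows "tensor_lift K M N W \<beta> \<in> linear_map K T W"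
proof -
  let ?f = "free_lift K (carrier M \<times> carrier N) W (\<lambda>s. \<beta> (fst s) (snd s))"
  have f: "?f \<in> linear_map K F W"
    using bilinear_map_closed[OF \<beta>] by (intro free_lift_linear[OF assms(1)]) auto
  show ?thesis
  proof (rule linear_mapI)
    fix t assume "t \<in> carrier T"
    then show "tensor_lift K M N W \<beta> t \<in> carrier W"
      using carrier_tensor by (auto simp: tensor_lift_coset[OF assms] linear_map_closed[OF f])
  next
    fix t u assume "t \<in> carrier T" "u \<in> carrier T"
    then show "tensor_lift K M N W \<beta> (t \<oplus>\<^bsub>T\<^esub> u) = tensor_lift K M N W \<beta> t \<oplus>\<^bsub>W\<^esub> tensor_lift K M N W \<beta> u"
      using carrier_tensor
      by (auto simp: tensor_lift_coset[OF assms] linear_map_add[OF f] linear_map_add[OF coset_linear, symmetric])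
  next
    fix c t assume "c \<in> carrier K" "t \<in> carrier T"
    then show "tensor_lift K M N W \<beta> (c \<odot>\<^bsub>T\<^esub> t) = c \<odot>\<^bsub>W\<^esub> tensor_lift K M N W \<beta> t"
      using carrier_tensor
      by (auto simp: tensor_lift_coset[OF assms] linear_map_smult[OF f] linear_map_smult[OF coset_linear, symmetric])
  qed
qed

lemma tensor_lift_pure:
  assumes "module K W" and \<beta>: "\<beta> \<in> bilinear_map K M N W" and mn: "m \<in> carrier M" "n \<in> carrier N"
  shows "tensor_lift K M N W \<beta> (pure_tensor K M N m n) = \<beta> m n"
proof -
  have "(\<lambda>s. \<beta> (fst s) (snd s)) \<in> carrier M \<times> carrier N \<rightarrow> carrier W"
    using bilinear_map_closed[OF \<beta>] by auto
  from free_lift_basis_vec[OF assms(1) this, of "(m, n)"] show ?thesis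
    using mn tensor_lift_coset[OF assms(1,2) e_closed[OF mn]] by (simp add: pure_tensor_def)
qed

end

text \<open>A tensor product depends only on the carriers, additions and scalar multiplications of its factors.
  The comultiplications are defined with values in tensor squares of free modules, while modules over
  a Hopf algebra involve the tensor square of the algebra itself; the two agree by this lemma.\<close>

lemma tensor_cong:
  assumes "carrier M' = carrier M" "add M' = add M" "smult M' = smult M"
    and "carrier N' = carrier N" "add N' = add N" "smult N' = smult N"
  shows "tensor K M' N' = tensor K M N" and "pure_tensor K M' N' = pure_tensor K M N"
proof -
  have "tensor_null K M' N' = tensor_null K M N"
    unfolding tensor_null_def tensor_rels_def Let_def assms ..
  then show "tensor K M' N' = tensor K M N" "pure_tensor K M' N' = pure_tensor K M N"
    by (simp_all add: tensor_def pure_tensor_def[abs_def] assms)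
qed

lemma tensor_rep_sel:
  "carrier (tensor_rep K H M N) = carrier (tensor K M N)"
  "ring.zero (tensor_rep K H M N) = ring.zero (tensor K M N)"
  "add (tensor_rep K H M N) = add (tensor K M N)"
  "smult (tensor_rep K H M N) = smult (tensor K M N)"
  by (simp_all add: tensor_rep_def Let_def module.extend_def)

text \<open>The action of \<open>a\<close> is \<open>\<Sum> a\<^sub>1 \<otimes> a\<^sub>2\<close> applied to a tensor, which is bilinear in \<open>\<Delta> a\<close> and the tensor.
  Being linear in the tensor, it is determined by the value at pure tensors, for which the inner lift
  can be evaluated.\<close>

lemma
  assumes H: "module K H" and M: "module K M" and N: "module K N"
    and aM: "act M \<in> bilinear_map K H M M" and aN: "act N \<in> bilinear_map K H N N"
    and a: "comult H a \<in> carrier (tensor K H H)"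
  shows tensor_rep_act_linear: "act (tensor_rep K H M N) a \<in> linear_map K (tensor K M N) (tensor K M N)"
    and tensor_rep_act_pure: "m \<in> carrier M \<Longrightarrow> n \<in> carrier N \<Longrightarrow>
      act (tensor_rep K H M N) a (pure_tensor K M N m n)
        = tensor_lift K H H (tensor K M N) (\<lambda>b c. pure_tensor K M N (act M b m) (act N c n)) (comult H a)"
proof -
  interpret HH: tensor_modules K H H by (intro tensor_modules.intro H)
  interpret MN: tensor_modules K M N by (intro tensor_modules.intro M N)
  let ?T = "tensor K M N"
  note T = MN.module_tensor
  define D where "D b c = tensor_lift K M N ?T (\<lambda>m n. pure_tensor K M N (act M b m) (act N c n))" for b c
  have bil_mn: "(\<lambda>m n. pure_tensor K M N (act M b m) (act N c n)) \<in> bilinear_map K M N ?T"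
    if "b \<in> carrier H" "c \<in> carrier H" for b c
    using that aM aN
    by (intro bilinear_map_comp[OF MN.pure_tensor_bilinear]) (auto intro: bilinear_map_right)
  have bil_bc: "(\<lambda>b c. pure_tensor K M N (act M b m) (act N c n)) \<in> bilinear_map K H H ?T"
    if "m \<in> carrier M" "n \<in> carrier N" for m n
    using that aM aN
    by (intro bilinear_map_comp[OF MN.pure_tensor_bilinear]) (auto intro: bilinear_map_left)
  have D_lin: "D b c \<in> linear_map K ?T ?T" if "b \<in> carrier H" "c \<in> carrier H" for b c
    unfolding D_def using bil_mn[OF that] by (rule MN.tensor_lift_linear[OF T])
  have D_pure: "D b c (pure_tensor K M N m n) = pure_tensor K M N (act M b m) (act N c n)"
    if "b \<in> carrier H" "c \<in> carrier H" "m \<in> carrier M" "n \<in> carrier N" for b c m n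
    unfolding D_def using bil_mn that by (intro MN.tensor_lift_pure[OF T])
  have D_bil: "(\<lambda>b c. D b c t) \<in> bilinear_map K H H ?T" if t: "t \<in> carrier ?T" for t
  proof (intro bilinear_mapI)
    fix b assume b: "b \<in> carrier H"
    show "(\<lambda>c. D b c t) \<in> linear_map K H ?T"
      by (rule MN.tensor_ext_linear[OF H T D_lin[OF b] _ t], assumption,
        rule linear_map_cong[OF H bilinear_map_right[OF bil_bc b]]) (auto simp: b D_pure)
  next
    fix c assume c: "c \<in> carrier H"
    show "(\<lambda>b. D b c t) \<in> linear_map K H ?T"
      by (rule MN.tensor_ext_linear[OF H T D_lin[OF _ c] _ t], assumption,
        rule linear_map_cong[OF H bilinear_map_left[OF bil_bc c]]) (auto simp: c D_pure)
  qed
  have act_eq: "act (tensor_rep K H M N) a = (\<lambda>t. tensor_lift K H H ?T (\<lambda>b c. D b c t) (comult H a))"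
    by (simp add: tensor_rep_def Let_def module.extend_def D_def)
  have "(\<lambda>t. tensor_lift K H H ?T (\<lambda>b c. D b c t) (comult H a)) \<in> linear_map K ?T ?T"
    by (rule HH.tensor_ext_linear[OF T T HH.tensor_lift_linear[OF T D_bil] _ a], assumption,
      rule linear_map_cong[OF T D_lin]) (auto simp: HH.tensor_lift_pure[OF T D_bil])
  then show "act (tensor_rep K H M N) a \<in> linear_map K ?T ?T"
    by (simp add: act_eq)
  show "act (tensor_rep K H M N) a (pure_tensor K M N m n)
        = tensor_lift K H H ?T (\<lambda>b c. pure_tensor K M N (act M b m) (act N c n)) (comult H a)"
    if mn: "m \<in> carrier M" "n \<in> carrier N"
    unfolding act_eq
    by (rule HH.tensor_ext[OF T HH.tensor_lift_linear[OF T D_bil] HH.tensor_lift_linear[OF T bil_bc] _ a])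
      (auto simp: MN.pure_tensor_closed mn D_pure HH.tensor_lift_pure[OF T D_bil] HH.tensor_lift_pure[OF T bil_bc])
qed

section \<open>Finite bases and transport of module structure\<close>

lemma free_module_finite_expand:
  assumes "module K W" and f: "f \<in> linear_map K (free_module K S) W" and S: "finite S"
    and u: "u \<in> carrier (free_module K S)"
  shows "f u = (\<Oplus>\<^bsub>W\<^esub>s\<in>S. u s \<odot>\<^bsub>W\<^esub> f (basis_vec K S s))"
proof -
  interpret W: module K W by fact
  have "(\<lambda>s. f (basis_vec K S s)) \<in> S \<rightarrow> carrier W"
    by (auto intro!: linear_map_closed[OF f] basis_vec_closed(1) W.R.is_cring)
  from supp_finsum_extend[OF assms(1) u this S] show ?thesis
    using free_module_linear_map_expand[OF assms(1) f u] by (auto simp: free_lift_def supp_def)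
qed

lemma free_module_ext:
  assumes "module K W" and f: "f \<in> linear_map K (free_module K S) W"
    and g: "g \<in> linear_map K (free_module K S) W" and S: "finite S"
    and u: "u \<in> carrier (free_module K S)"
    and eq: "\<And>s. s \<in> S \<Longrightarrow> f (basis_vec K S s) = g (basis_vec K S s)"
  shows "f u = g u"
proof -
  interpret W: module K W by fact
  have b: "basis_vec K S s \<in> carrier (free_module K S)" if "s \<in> S" for s
    using basis_vec_closed(1)[OF W.R.is_cring that] .
  show ?thesis
    unfolding free_module_finite_expand[OF assms(1) f S u] free_module_finite_expand[OF assms(1) g S u]
    using u by (intro W.M.finsum_cong')
      (auto simp: eq free_module_def intro!: W.smult_closed linear_map_closed[OF g b, unfolded free_module_def])
qed

lemma finsum_basis_vec:
  assumes "module K W" and "finite S" and s: "s \<in> S" and f: "f \<in> S \<rightarrow> carrier W"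
  shows "(\<Oplus>\<^bsub>W\<^esub>t\<in>S. basis_vec K S s t \<odot>\<^bsub>W\<^esub> f t) = f s"
proof -
  interpret W: module K W by fact
  have "(\<Oplus>\<^bsub>W\<^esub>t\<in>S. basis_vec K S s t \<odot>\<^bsub>W\<^esub> f t) = (\<Oplus>\<^bsub>W\<^esub>t\<in>S. if t = s then f t else \<zero>\<^bsub>W\<^esub>)"
    using f by (intro W.M.finsum_cong') (auto simp: basis_vec_def Pi_def)
  also have "\<dots> = f s"
    using assms by (intro W.M.finsum_delta)
  finally show ?thesis .
qed

text \<open>In sums over \<open>G \<times> L\<close> describing an action on one component, all terms vanish except those
  with a fixed second coordinate.\<close>

lemma (in abelian_monoid) finsum_slice:
  assumes "finite A" and "finite B" and y: "y \<in> B" and f: "f \<in> A \<rightarrow> carrier G"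
  shows "(\<Oplus>s\<in>A \<times> B. if snd s = y then f (fst s) else \<zero>) = (\<Oplus>a\<in>A. f a)"
proof -
  have "(\<Oplus>s\<in>A \<times> B. if snd s = y then f (fst s) else \<zero>)
      = (\<Oplus>s\<in>(\<lambda>a. (a, y)) ` A. if snd s = y then f (fst s) else \<zero>)"
    using assms by (intro add.finprod_mono_neutral_cong_right) (auto simp: Pi_def)
  also have "\<dots> = (\<Oplus>a\<in>A. f a)"
    using f by (subst finsum_reindex) (auto simp: inj_on_def)
  finally show ?thesis .
qed

lemma module_sel_cong:
  assumes "module K M" and "carrier M' = carrier M" "ring.zero M' = ring.zero M" "add M' = add M" "smult M' = smult M"
  shows "module K M'"
proof -
  interpret M: module K M by fact
  show ?thesis
  proof (rule moduleI, rule M.R.is_cring)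
    show "abelian_group M'"
    proof (rule abelian_groupI)
      fix x assume "x \<in> carrier M'"
      then show "\<exists>y\<in>carrier M'. y \<oplus>\<^bsub>M'\<^esub> x = \<zero>\<^bsub>M'\<^esub>"
        by (intro bexI[of _ "\<ominus>\<^bsub>M\<^esub> x"]) (auto simp: assms(2-) M.M.l_neg)
    qed (auto simp: assms(2-) M.M.a_ac)
  qed (auto simp: assms(2-) M.smult_l_distr M.smult_r_distr M.smult_assoc1)
qed

lemma linear_map_sel_cong:
  assumes "carrier V' = carrier V" "add V' = add V" "smult V' = smult V"
    and "carrier W' = carrier W" "add W' = add W" "smult W' = smult W"
  shows "linear_map K V' W' = linear_map K V W"
  unfolding linear_map_def assms ..

section \<open>The group algebra and the dual of the smash product as modules\<close>

lemma group_algebra_sel: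
  "carrier (group_algebra K G) = carrier (free_module K (carrier G))"
  "ring.zero (group_algebra K G) = ring.zero (free_module K (carrier G))"
  "add (group_algebra K G) = add (free_module K (carrier G))"
  "smult (group_algebra K G) = smult (free_module K (carrier G))"
  by (simp_all add: group_algebra_def Let_def)

lemma dual_smash_sel:
  "carrier (dual_smash K G L \<phi>) = carrier (free_module K (carrier G \<times> carrier L))"
  "ring.zero (dual_smash K G L \<phi>) = ring.zero (free_module K (carrier G \<times> carrier L))"
  "add (dual_smash K G L \<phi>) = add (free_module K (carrier G \<times> carrier L))"
  "smult (dual_smash K G L \<phi>) = smult (free_module K (carrier G \<times> carrier L))"
  by (simp_all add: dual_smash_def Let_def)

lemma module_group_algebra: "cring K \<Longrightarrow> module K (group_algebra K G)"
  by (rule module_sel_cong[OF module_free_module]) (auto simp: group_algebra_sel)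

lemma module_dual_smash: "cring K \<Longrightarrow> module K (dual_smash K G L \<phi>)"
  by (rule module_sel_cong[OF module_free_module]) (auto simp: dual_smash_sel)

lemma linear_map_dual_smash:
  "linear_map K (dual_smash K G L \<phi>) W = linear_map K (free_module K (carrier G \<times> carrier L)) W"
  by (rule linear_map_sel_cong) (simp_all add: dual_smash_sel)

lemma algebra_module_bilinear:
  assumes "algebra_module K H M"
  shows "act M \<in> bilinear_map K H M M"
proof -
  interpret algebra_module K H M by fact
  show ?thesis
    by (intro bilinear_mapI linear_mapI)
      (simp_all add: act_closed act_add_left act_add_right act_smult_left act_smult_right)
qed

section \<open>The components of a module over the dual of the smash product\<close>

locale smash_data =
  fixes K :: "('k, 'r) ring_scheme" and G :: "('g, 's) monoid_scheme"
    and L :: "('l, 't) monoid_scheme" and \<phi> :: "'l \<Rightarrow> 'g \<Rightarrow> 'g"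
  assumes cring: "cring K"
    and group_G: "group G" and finite_G: "finite (carrier G)"
    and group_L: "group L" and finite_L: "finite (carrier L)"
    and \<phi>_hom: "\<phi> \<in> hom L (AutoGroup G)"
begin

sublocale K: cring K by (rule cring)
sublocale G: group G by (rule group_G)
sublocale L: group L by (rule group_L)

abbreviation "A \<equiv> dual_smash K G L \<phi>"
abbreviation "kG \<equiv> group_algebra K G"
abbreviation "B \<equiv> carrier G \<times> carrier L"
abbreviation "E g x \<equiv> basis_vec K B (g, x)"
abbreviation "e g \<equiv> basis_vec K (carrier G) g"

lemma finite_B: "finite B"
  using finite_G finite_L by simp

lemma E_closed: "g \<in> carrier G \<Longrightarrow> x \<in> carrier L \<Longrightarrow> E g x \<in> carrier A"
  by (simp add: dual_smash_sel basis_vec_closed(1)[OF cring])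

lemma e_closed: "g \<in> carrier G \<Longrightarrow> e g \<in> carrier kG"
  by (simp add: group_algebra_sel basis_vec_closed(1)[OF cring])

lemma \<phi>_auto: assumes "x \<in> carrier L" shows "\<phi> x \<in> hom G G" "bij_betw (\<phi> x) (carrier G) (carrier G)"
  using hom_in_carrier[OF \<phi>_hom assms] by (auto simp: AutoGroup_def auto_def Bij_def)

lemma \<phi>_closed: "x \<in> carrier L \<Longrightarrow> g \<in> carrier G \<Longrightarrow> \<phi> x g \<in> carrier G"
  using \<phi>_auto(1) by (rule hom_in_carrier)

lemma \<phi>_mult:
  assumes "x \<in> carrier L" "y \<in> carrier L" "g \<in> carrier G"
  shows "\<phi> (x \<otimes>\<^bsub>L\<^esub> y) g = \<phi> x (\<phi> y g)"
proof -
  have "\<phi> x \<in> Bij (carrier G)" "\<phi> y \<in> Bij (carrier G)"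
    using assms hom_in_carrier[OF \<phi>_hom] by (auto simp: AutoGroup_def auto_def)
  moreover have "\<phi> (x \<otimes>\<^bsub>L\<^esub> y) = \<phi> x \<otimes>\<^bsub>AutoGroup G\<^esub> \<phi> y"
    using \<phi>_hom assms by (simp add: hom_mult)
  ultimately show ?thesis
    using assms by (simp add: AutoGroup_def BijGroup_def compose_def)
qed

lemma \<phi>_one: assumes "g \<in> carrier G" shows "\<phi> \<one>\<^bsub>L\<^esub> g = g"
proof -
  have "\<phi> \<one>\<^bsub>L\<^esub> (\<phi> \<one>\<^bsub>L\<^esub> g) = \<phi> \<one>\<^bsub>L\<^esub> g"
    using \<phi>_mult[of "\<one>\<^bsub>L\<^esub>" "\<one>\<^bsub>L\<^esub>" g] assms by simp
  then show ?thesis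
    using \<phi>_auto(2)[of "\<one>\<^bsub>L\<^esub>"] assms \<phi>_closed by (auto simp: bij_betw_def inj_on_def)
qed

lemma \<phi>_inv:
  assumes "x \<in> carrier L" "g \<in> carrier G"
  shows "\<phi> x (\<phi> (inv\<^bsub>L\<^esub> x) g) = g" "\<phi> (inv\<^bsub>L\<^esub> x) (\<phi> x g) = g"
  using assms by (simp_all add: \<phi>_mult[symmetric] \<phi>_one)

lemma \<phi>_G_one: "x \<in> carrier L \<Longrightarrow> \<phi> x \<one>\<^bsub>G\<^esub> = \<one>\<^bsub>G\<^esub>"
  using \<phi>_auto(1) group_G by (simp add: hom_one)

lemma \<phi>_G_inv: "x \<in> carrier L \<Longrightarrow> g \<in> carrier G \<Longrightarrow> \<phi> x (inv\<^bsub>G\<^esub> g) = inv\<^bsub>G\<^esub> (\<phi> x g)"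
  using \<phi>_auto(1) group_G by (metis group_hom.hom_inv group_hom.intro group_hom_axioms.intro)

text \<open>The product is convolution in \<open>G\<close> and pointwise multiplication in \<open>L\<close>; at \<open>(k, z)\<close> the convolution
  has at most one non-zero term, the one for \<open>h' = g\<close>.\<close>

lemma E_mult:
  assumes "g \<in> carrier G" "x \<in> carrier L" "h \<in> carrier G" "y \<in> carrier L"
  shows "E g x \<otimes>\<^bsub>A\<^esub> E h y = (if x = y then E (g \<otimes>\<^bsub>G\<^esub> h) x else \<zero>\<^bsub>A\<^esub>)"
proof
  fix s
  show "(E g x \<otimes>\<^bsub>A\<^esub> E h y) s = (if x = y then E (g \<otimes>\<^bsub>G\<^esub> h) x else \<zero>\<^bsub>A\<^esub>) s"
  proof (cases "s \<in> B")
    case True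
    then obtain k z where s: "s = (k, z)" "k \<in> carrier G" "z \<in> carrier L" by auto
    have eq: "inv\<^bsub>G\<^esub> g \<otimes>\<^bsub>G\<^esub> k = h \<longleftrightarrow> k = g \<otimes>\<^bsub>G\<^esub> h"
      using s assms G.inv_solve_left' by auto
    have "(E g x \<otimes>\<^bsub>A\<^esub> E h y) s
        = (\<Oplus>\<^bsub>K\<^esub>h'\<in>carrier G. E g x (h', z) \<otimes>\<^bsub>K\<^esub> E h y (inv\<^bsub>G\<^esub> h' \<otimes>\<^bsub>G\<^esub> k, z))"
      using s by (simp add: dual_smash_def Let_def)
    also have "\<dots> = (\<Oplus>\<^bsub>K\<^esub>h'\<in>carrier G. if h' = g then (if z = x then E h y (inv\<^bsub>G\<^esub> h' \<otimes>\<^bsub>G\<^esub> k, z) else \<zero>\<^bsub>K\<^esub>) else \<zero>\<^bsub>K\<^esub>)"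
      using s assms by (intro K.finsum_cong') (auto simp: basis_vec_def)
    also have "\<dots> = (if z = x then E h y (inv\<^bsub>G\<^esub> g \<otimes>\<^bsub>G\<^esub> k, z) else \<zero>\<^bsub>K\<^esub>)"
      using s assms finite_G by (intro K.finsum_delta) (auto simp: basis_vec_def)
    also have "\<dots> = (if x = y then E (g \<otimes>\<^bsub>G\<^esub> h) x else \<zero>\<^bsub>A\<^esub>) s"
      using s assms eq by (auto simp: basis_vec_def dual_smash_sel free_module_def)
    finally show ?thesis .
  next
    case False
    then show ?thesis
      by (cases s) (auto simp: dual_smash_def Let_def basis_vec_def free_module_def)
  qed
qed

text \<open>The element \<open>a \<otimes> 1\<close> of \<open>kG \<otimes> k[L]\<close>: as a function it is constant along \<open>L\<close>, because \<open>1\<close> is the sum of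
  all \<open>p\<^sub>x\<close>.\<close>

definition unit_ext :: "('g \<Rightarrow> 'k) \<Rightarrow> 'g \<times> 'l \<Rightarrow> 'k" where
  "unit_ext a = (\<lambda>(g, x)\<in>B. a g)"

lemma unit_ext_linear: "unit_ext \<in> linear_map K kG A"
proof (rule linear_mapI)
  fix a assume "a \<in> carrier kG"
  then have "unit_ext a \<in> B \<rightarrow>\<^sub>E carrier K"
    by (auto simp: unit_ext_def group_algebra_sel free_module_def)
  moreover have "finite (supp K B (unit_ext a))"
    by (rule finite_subset[OF _ finite_B]) (auto simp: supp_def)
  ultimately show "unit_ext a \<in> carrier A"
    by (simp add: dual_smash_sel free_module_def)
qed (auto simp: unit_ext_def group_algebra_sel dual_smash_sel free_module_def)

text \<open>The linear extension to \<open>kG\<close> of the automorphism \<open>\<phi> y\<^sup>-\<^sup>1\<close>, as \<open>twist_e\<close> confirms; the inverse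
  disappears because elements of \<open>kG\<close> are functions on \<open>G\<close>, which are pulled back.\<close>

definition twist :: "'l \<Rightarrow> ('g \<Rightarrow> 'k) \<Rightarrow> 'g \<Rightarrow> 'k" where
  "twist y a = (\<lambda>h\<in>carrier G. a (\<phi> y h))"

lemma twist_linear:
  assumes "y \<in> carrier L"
  shows "twist y \<in> linear_map K kG kG"
proof (rule linear_mapI)
  fix a assume "a \<in> carrier kG"
  then have "twist y a \<in> carrier G \<rightarrow>\<^sub>E carrier K"
    using \<phi>_closed[OF assms] by (auto simp: twist_def group_algebra_sel free_module_def)
  moreover have "finite (supp K (carrier G) (twist y a))"
    by (rule finite_subset[OF _ finite_G]) (auto simp: supp_def)
  ultimately show "twist y a \<in> carrier kG"
    by (simp add: group_algebra_sel free_module_def)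
qed (use assms in \<open>auto simp: twist_def group_algebra_sel free_module_def \<phi>_closed\<close>)

lemma twist_e:
  assumes "y \<in> carrier L" "g \<in> carrier G"
  shows "twist y (e g) = e (\<phi> (inv\<^bsub>L\<^esub> y) g)"
proof
  fix h
  have "\<phi> y h = g \<longleftrightarrow> h = \<phi> (inv\<^bsub>L\<^esub> y) g" if "h \<in> carrier G"
    using assms that \<phi>_inv by auto
  then show "twist y (e g) h = e (\<phi> (inv\<^bsub>L\<^esub> y) g) h"
    using assms by (auto simp: twist_def basis_vec_def \<phi>_closed)
qed

end

locale smash_module = smash_data K G L \<phi> + M: algebra_module K "dual_smash K G L \<phi>" M
  for K :: "('k, 'r) ring_scheme" and G :: "('g, 's) monoid_scheme" and L :: "('l, 't) monoid_scheme"
    and \<phi> and M :: "('k, 'g \<times> 'l \<Rightarrow> 'k, 'm, 'y) rep_scheme"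
begin

abbreviation "P x \<equiv> act M (E \<one>\<^bsub>G\<^esub> x)"
abbreviation "C l \<equiv> component K G L M l"

lemma act_bilinear: "act M \<in> bilinear_map K A M M"
  by (rule algebra_module_bilinear) (rule M.algebra_module_axioms)

lemmas act_linear = bilinear_map_right[OF act_bilinear]
lemmas act_linear_left = bilinear_map_left[OF act_bilinear]

lemma act_expand:
  assumes "b \<in> carrier A" and "m \<in> carrier M"
  shows "act M b m = (\<Oplus>\<^bsub>M\<^esub>s\<in>B. b s \<odot>\<^bsub>M\<^esub> act M (basis_vec K B s) m)"
  using free_module_finite_expand[OF M.module_axioms _ finite_B, of "\<lambda>b. act M b m" b]
    act_linear_left[OF assms(2)] assms(1)
  by (simp add: linear_map_dual_smash dual_smash_sel)

lemma act_E_zero: "g \<in> carrier G \<Longrightarrow> x \<in> carrier L \<Longrightarrow> act M (E g x) \<zero>\<^bsub>M\<^esub> = \<zero>\<^bsub>M\<^esub>"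
  by (rule linear_map_zero[OF M.module_axioms M.module_axioms act_linear]) (rule E_closed)

lemma act_zero: "m \<in> carrier M \<Longrightarrow> act M \<zero>\<^bsub>A\<^esub> m = \<zero>\<^bsub>M\<^esub>"
  by (rule linear_map_zero[OF module_dual_smash[OF cring] M.module_axioms act_linear_left])

lemma act_E_E:
  assumes "g \<in> carrier G" "x \<in> carrier L" "h \<in> carrier G" "y \<in> carrier L" "m \<in> carrier M"
  shows "act M (E g x) (act M (E h y) m) = (if x = y then act M (E (g \<otimes>\<^bsub>G\<^esub> h) x) m else \<zero>\<^bsub>M\<^esub>)"
  using M.act_mult[OF E_closed E_closed, of g x h y m, symmetric] assms
  by (simp add: E_mult act_zero)

text \<open>The element \<open>1 \<otimes> p\<^sub>x\<close> is central in \<open>A\<close>, since it commutes with every basis vector.\<close>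

lemma P_commute:
  assumes "b \<in> carrier A" "x \<in> carrier L" "m \<in> carrier M"
  shows "P x (act M b m) = act M b (P x m)"
proof (rule free_module_ext[OF M.module_axioms _ _ finite_B, of "\<lambda>b. P x (act M b m)" "\<lambda>b. act M b (P x m)"])
  have Px: "P x \<in> linear_map K M M" using assms by (intro act_linear E_closed) auto
  show "(\<lambda>b. P x (act M b m)) \<in> linear_map K (free_module K B) M"
    using linear_map_comp[OF act_linear_left[OF assms(3)] Px] by (simp add: linear_map_dual_smash)
  show "(\<lambda>b. act M b (P x m)) \<in> linear_map K (free_module K B) M"
    using act_linear_left[OF linear_map_closed[OF Px assms(3)]] by (simp add: linear_map_dual_smash)
  show "b \<in> carrier (free_module K B)" using assms by (simp add: dual_smash_sel)
  show "P x (act M (basis_vec K B s) m) = act M (basis_vec K B s) (P x m)" if "s \<in> B" for s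
    using that assms by (auto simp: act_E_E)
qed

lemma C_sel:
  "carrier (C l) = {m \<in> carrier M. \<forall>x\<in>carrier L. P x m = (if x = l then m else \<zero>\<^bsub>M\<^esub>)}"
  "ring.zero (C l) = ring.zero M" "add (C l) = add M" "smult (C l) = smult M"
  "act (C l) a = act M (unit_ext a)"
  by (simp_all add: component_def unit_ext_def)

lemma C_carrier: "m \<in> carrier (C l) \<Longrightarrow> m \<in> carrier M"
  by (simp add: C_sel)

lemma C_P: "m \<in> carrier (C l) \<Longrightarrow> x \<in> carrier L \<Longrightarrow> P x m = (if x = l then m else \<zero>\<^bsub>M\<^esub>)"
  by (simp add: C_sel)

lemma P_in_C: "l \<in> carrier L \<Longrightarrow> m \<in> carrier M \<Longrightarrow> P l m \<in> carrier (C l)"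
  by (auto simp: C_sel act_E_E M.act_closed E_closed)

text \<open>From \<open>g \<otimes> p\<^sub>x = (g \<otimes> p\<^sub>x)(1 \<otimes> p\<^sub>x)\<close>: the action of \<open>g \<otimes> p\<^sub>x\<close> factors through \<open>P\<^sub>x\<close>, which vanishes on
  the components other than \<open>M\<^sub>x\<close>.\<close>

lemma act_E_C:
  assumes "g \<in> carrier G" "x \<in> carrier L" "m \<in> carrier (C l)"
  shows "act M (E g x) m = (if x = l then act M (E g l) m else \<zero>\<^bsub>M\<^esub>)"
proof -
  have "act M (E g x) m = act M (E g x) (P x m)"
    using assms C_carrier by (simp add: act_E_E)
  then show ?thesis
    using assms C_P[OF assms(3,2)] by (auto simp: act_E_zero)
qed

lemma act_in_C:
  assumes "b \<in> carrier A" "m \<in> carrier (C l)"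
  shows "act M b m \<in> carrier (C l)"
proof -
  have "act M b \<zero>\<^bsub>M\<^esub> = \<zero>\<^bsub>M\<^esub>"
    by (rule linear_map_zero[OF M.module_axioms M.module_axioms act_linear[OF assms(1)]])
  then show ?thesis
    using assms C_carrier[OF assms(2)] by (auto simp: C_sel P_commute M.act_closed)
qed

lemma C_submodule: "submodule (carrier (C l)) K M"
proof -
  have Px: "P x \<in> linear_map K M M" if "x \<in> carrier L" for x
    using that by (intro act_linear E_closed) auto
  show ?thesis
    by (rule M.submoduleI)
      (auto simp: C_sel linear_map_zero[OF M.module_axioms M.module_axioms Px]
        linear_map_minus[OF M.module_axioms M.module_axioms Px] linear_map_add[OF Px] linear_map_smult[OF Px])
qed

lemma module_C: "module K (C l)"
  by (rule module_sel_cong[OF submodule.submodule_is_module[OF C_submodule M.module_axioms]])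
    (auto simp: C_sel)

lemma C_incl: "(\<lambda>m. m) \<in> linear_map K (C l) M"
  by (rule linear_mapI) (auto simp: C_sel)

lemma linear_map_into_C:
  assumes "f \<in> linear_map K V M" and "\<And>v. v \<in> carrier V \<Longrightarrow> f v \<in> carrier (C l)"
  shows "f \<in> linear_map K V (C l)"
  by (rule linear_mapI) (use assms in \<open>auto simp: C_sel(3,4) linear_map_add linear_map_smult\<close>)

lemma P_linear_C: "l \<in> carrier L \<Longrightarrow> P l \<in> linear_map K M (C l)"
  by (intro linear_map_into_C act_linear E_closed P_in_C) auto

lemma C_act_bilinear: "act (C l) \<in> bilinear_map K kG (C l) (C l)"
proof (rule bilinear_mapI)
  fix a assume "a \<in> carrier kG"
  then have a: "unit_ext a \<in> carrier A" by (rule linear_map_closed[OF unit_ext_linear])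
  show "act (C l) a \<in> linear_map K (C l) (C l)"
    unfolding C_sel(5)
    by (intro linear_map_into_C linear_map_comp[OF C_incl act_linear[OF a]] act_in_C a)
next
  fix m assume m: "m \<in> carrier (C l)"
  show "(\<lambda>a. act (C l) a m) \<in> linear_map K kG (C l)"
    unfolding C_sel(5)
    by (intro linear_map_into_C linear_map_comp[OF unit_ext_linear act_linear_left[OF C_carrier[OF m]]]
        act_in_C m linear_map_closed[OF unit_ext_linear])
qed

text \<open>By \<open>act_E_C\<close>, of \<open>g \<otimes> 1 = \<Sum>\<^sub>x g \<otimes> p\<^sub>x\<close> only the term with \<open>x = l\<close> acts on \<open>M\<^sub>l\<close>.\<close>

lemma C_act_expand:
  assumes "a \<in> carrier kG" "m \<in> carrier (C l)" and l: "l \<in> carrier L"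
  shows "act (C l) a m = (\<Oplus>\<^bsub>M\<^esub>g\<in>carrier G. a g \<odot>\<^bsub>M\<^esub> act M (E g l) m)"
proof -
  have m: "m \<in> carrier M" using assms C_carrier by auto
  have a: "unit_ext a \<in> carrier A" using assms(1) by (rule linear_map_closed[OF unit_ext_linear])
  have ag: "a g \<in> carrier K" if "g \<in> carrier G" for g
    using assms(1) that by (auto simp: group_algebra_sel free_module_def)
  note cl = M.smult_closed[OF ag M.act_closed[OF E_closed m]]
  have "act (C l) a m = (\<Oplus>\<^bsub>M\<^esub>s\<in>B. unit_ext a s \<odot>\<^bsub>M\<^esub> act M (basis_vec K B s) m)"
    unfolding C_sel(5) by (rule act_expand[OF a m])
  also have "\<dots> = (\<Oplus>\<^bsub>M\<^esub>s\<in>B. if snd s = l then a (fst s) \<odot>\<^bsub>M\<^esub> act M (E (fst s) l) m else \<zero>\<^bsub>M\<^esub>)"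
  proof (rule M.M.finsum_cong'[OF refl])
    show "(\<lambda>s. if snd s = l then a (fst s) \<odot>\<^bsub>M\<^esub> act M (E (fst s) l) m else \<zero>\<^bsub>M\<^esub>) \<in> B \<rightarrow> carrier M"
      using cl l by auto
    fix s assume "s \<in> B"
    then obtain g x where s: "s = (g, x)" "g \<in> carrier G" "x \<in> carrier L" by auto
    have "unit_ext a s = a g" using s by (simp add: unit_ext_def)
    then show "unit_ext a s \<odot>\<^bsub>M\<^esub> act M (basis_vec K B s) m
        = (if snd s = l then a (fst s) \<odot>\<^bsub>M\<^esub> act M (E (fst s) l) m else \<zero>\<^bsub>M\<^esub>)"
      using s ag by (auto simp: act_E_C[OF s(2,3) assms(2)])
  qed
  also have "\<dots> = (\<Oplus>\<^bsub>M\<^esub>g\<in>carrier G. a g \<odot>\<^bsub>M\<^esub> act M (E g l) m)"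
    using cl l by (intro M.M.finsum_slice finite_G finite_L) auto
  finally show ?thesis .
qed

lemma C_act_e:
  assumes "g \<in> carrier G" "m \<in> carrier (C l)" "l \<in> carrier L"
  shows "act (C l) (e g) m = act M (E g l) m"
  unfolding C_act_expand[OF e_closed[OF assms(1)] assms(2,3)]
  by (rule finsum_basis_vec[OF M.module_axioms finite_G assms(1)])
    (use assms C_carrier in \<open>auto intro!: M.act_closed E_closed\<close>)

lemma conj_sel:
  "carrier (conj_rep G \<phi> y U) = carrier U" "ring.zero (conj_rep G \<phi> y U) = ring.zero U"
  "add (conj_rep G \<phi> y U) = add U" "smult (conj_rep G \<phi> y U) = smult U"
  "act (conj_rep G \<phi> y U) a = act U (twist y a)"
  by (simp_all add: conj_rep_def twist_def)

lemma module_conj_C: "module K (conj_rep G \<phi> y (C l))"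
  by (rule module_sel_cong[OF module_C]) (simp_all add: conj_sel)

lemma conj_C_act_bilinear:
  assumes "y \<in> carrier L"
  shows "act (conj_rep G \<phi> y (C l)) \<in> bilinear_map K kG (conj_rep G \<phi> y (C l)) (conj_rep G \<phi> y (C l))"
proof -
  have id: "(\<lambda>m. m) \<in> linear_map K (C l) (C l)"
    by (rule linear_mapI) auto
  have "(\<lambda>a m. act (C l) (twist y a) m) \<in> bilinear_map K kG (C l) (C l)"
    by (rule bilinear_map_comp[OF C_act_bilinear twist_linear[OF assms] id])
  then show ?thesis
    by (simp add: bilinear_map_def linear_map_def conj_sel)
qed

end

section \<open>Duals\<close>

lemma module_scalar_module: "cring K \<Longrightarrow> module K (scalar_module K)"
proof -
  assume "cring K"
  then interpret K: cring K .
  show ?thesis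
  proof (rule moduleI, fact)
    show "abelian_group (scalar_module K)"
    proof (rule abelian_groupI)
      fix x assume "x \<in> carrier (scalar_module K)"
      then show "\<exists>y\<in>carrier (scalar_module K). y \<oplus>\<^bsub>scalar_module K\<^esub> x = \<zero>\<^bsub>scalar_module K\<^esub>"
        by (intro bexI[of _ "\<ominus>\<^bsub>K\<^esub> x"]) (auto simp: scalar_module_def K.l_neg)
    qed (auto simp: scalar_module_def K.a_ac)
  qed (auto simp: scalar_module_def K.l_distr K.r_distr K.m_assoc)
qed

lemma dual_rep_sel:
  "carrier (dual_rep K H M) = linear_map K M (scalar_module K) \<inter> extensional (carrier M)"
  "ring.zero (dual_rep K H M) = (\<lambda>m\<in>carrier M. \<zero>\<^bsub>K\<^esub>)"
  "add (dual_rep K H M) = (\<lambda>f h. \<lambda>m\<in>carrier M. f m \<oplus>\<^bsub>K\<^esub> h m)"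
  "smult (dual_rep K H M) = (\<lambda>c f. \<lambda>m\<in>carrier M. c \<otimes>\<^bsub>K\<^esub> f m)"
  "act (dual_rep K H M) a f = (\<lambda>m\<in>carrier M. f (act M (antipode H a) m))"
  by (simp_all add: dual_rep_def)

context smash_module
begin

lemma antipode_E:
  assumes g: "g \<in> carrier G" and x: "x \<in> carrier L"
  shows "antipode A (E g x) = E (\<phi> (inv\<^bsub>L\<^esub> x) (inv\<^bsub>G\<^esub> g)) (inv\<^bsub>L\<^esub> x)"
proof -
  let ?f = "\<lambda>s. case s of (g, l) \<Rightarrow> E (\<phi> (inv\<^bsub>L\<^esub> l) (inv\<^bsub>G\<^esub> g)) (inv\<^bsub>L\<^esub> l)"
  have "?f \<in> B \<rightarrow> carrier (free_module K B)"
    by (auto intro!: basis_vec_closed(1) cring \<phi>_closed)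
  from finsum_basis_vec[OF module_free_module[OF cring] finite_B _ this, of "(g, x)"] g x
  show ?thesis by (simp add: dual_smash_def Let_def)
qed

lemma act_antipode:
  assumes b: "b \<in> carrier A" and m: "m \<in> carrier M"
  shows "act M (antipode A b) m
    = (\<Oplus>\<^bsub>M\<^esub>s\<in>B. b s \<odot>\<^bsub>M\<^esub> act M (E (\<phi> (inv\<^bsub>L\<^esub> (snd s)) (inv\<^bsub>G\<^esub> (fst s))) (inv\<^bsub>L\<^esub> (snd s))) m)"
proof -
  interpret F: module K "free_module K B" by (rule module_free_module) (rule cring)
  have lin: "(\<lambda>b. act M b m) \<in> linear_map K (free_module K B) M"
    using act_linear_left[OF m] by (simp add: linear_map_dual_smash)
  have bs: "b s \<in> carrier K" if "s \<in> B" for s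
    using b that by (auto simp: dual_smash_sel free_module_def)
  have E: "E (\<phi> (inv\<^bsub>L\<^esub> (snd s)) (inv\<^bsub>G\<^esub> (fst s))) (inv\<^bsub>L\<^esub> (snd s)) \<in> carrier (free_module K B)" if "s \<in> B" for s
    using that by (intro basis_vec_closed(1) cring) (auto intro!: \<phi>_closed)
  have "antipode A b = (\<Oplus>\<^bsub>free_module K B\<^esub>s\<in>B. b s \<odot>\<^bsub>free_module K B\<^esub>
      E (\<phi> (inv\<^bsub>L\<^esub> (snd s)) (inv\<^bsub>G\<^esub> (fst s))) (inv\<^bsub>L\<^esub> (snd s)))"
    by (simp add: dual_smash_def Let_def case_prod_beta)
  then have "act M (antipode A b) m = (\<Oplus>\<^bsub>M\<^esub>s\<in>B. act M (b s \<odot>\<^bsub>free_module K B\<^esub>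
      E (\<phi> (inv\<^bsub>L\<^esub> (snd s)) (inv\<^bsub>G\<^esub> (fst s))) (inv\<^bsub>L\<^esub> (snd s))) m)"
    using linear_map_finsum[OF F.module_axioms M.module_axioms lin finite_B] bs E by simp
  also have "\<dots> = (\<Oplus>\<^bsub>M\<^esub>s\<in>B. b s \<odot>\<^bsub>M\<^esub> act M (E (\<phi> (inv\<^bsub>L\<^esub> (snd s)) (inv\<^bsub>G\<^esub> (fst s))) (inv\<^bsub>L\<^esub> (snd s))) m)"
    using E bs
    by (intro M.M.finsum_cong' linear_map_smult[OF lin]) (auto intro!: M.smult_closed linear_map_closed[OF lin])
  finally show ?thesis .
qed

lemma antipode_kG_closed:
  assumes "a \<in> carrier kG"
  shows "antipode kG a \<in> carrier kG"
proof -
  have "antipode kG a \<in> carrier G \<rightarrow>\<^sub>E carrier K"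
    using assms by (auto simp: group_algebra_def Let_def free_module_def)
  moreover have "finite (supp K (carrier G) (antipode kG a))"
    by (rule finite_subset[OF _ finite_G]) (auto simp: supp_def)
  ultimately show ?thesis by (simp add: group_algebra_sel free_module_def)
qed

text \<open>The antipode of \<open>g \<otimes> 1\<close> is \<open>\<Sum>\<^sub>x \<phi> x\<^sup>-\<^sup>1 g\<^sup>-\<^sup>1 \<otimes> p\<^sub>y\<close> with \<open>y = x\<^sup>-\<^sup>1\<close>, and on the component at \<open>l\<^sup>-\<^sup>1\<close> only
  \<open>x = l\<close> contributes. As \<open>\<phi> l\<^sup>-\<^sup>1\<close> commutes with inversion in \<open>G\<close>, this is the antipode of the twist of
  \<open>g\<close> in \<open>kG\<close>; for functions \<open>a\<close> on \<open>G\<close> the comparison is a substitution in the sum over \<open>G\<close>.\<close>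

lemma act_antipode_C:
  assumes a: "a \<in> carrier kG" and l: "l \<in> carrier L" and m: "m \<in> carrier (C (inv\<^bsub>L\<^esub> l))"
  shows "act M (antipode A (unit_ext a)) m = act (C (inv\<^bsub>L\<^esub> l)) (antipode kG (twist l a)) m"
proof -
  let ?l = "inv\<^bsub>L\<^esub> l"
  let ?h = "\<lambda>g. \<phi> ?l (inv\<^bsub>G\<^esub> g)"
  have l': "?l \<in> carrier L" using l by simp
  have mM: "m \<in> carrier M" using m by (rule C_carrier)
  have ag: "a g \<in> carrier K" if "g \<in> carrier G" for g
    using a that by (auto simp: group_algebra_sel free_module_def)
  have hG: "?h g \<in> carrier G" if "g \<in> carrier G" for g using that l' \<phi>_closed by simp
  have S: "antipode kG (twist l a) g = a (\<phi> l (inv\<^bsub>G\<^esub> g))" if "g \<in> carrier G" for g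
    using that by (simp add: group_algebra_def Let_def twist_def)
  have S_closed: "antipode kG (twist l a) \<in> carrier kG"
    by (intro antipode_kG_closed linear_map_closed[OF twist_linear[OF l]] a)
  \<comment> \<open>The substitution \<open>g \<mapsto> ?h g\<close> is a permutation of \<open>G\<close> turning the coefficients of the right-hand side into \<open>a\<close>.\<close>
  have Sh: "antipode kG (twist l a) (?h g) = a g" if "g \<in> carrier G" for g
    using that l hG by (simp add: S \<phi>_inv flip: \<phi>_G_inv)
  have inj: "inj_on ?h (carrier G)"
    by (rule inj_onI) (metis G.inv_closed G.inv_inv \<phi>_inv(1) l)
  have surj: "?h ` carrier G = carrier G"
  proof
    show "carrier G \<subseteq> ?h ` carrier G"
    proof
      fix g assume g: "g \<in> carrier G"
      then have "g = ?h (inv\<^bsub>G\<^esub> (\<phi> l g))" using l by (simp add: \<phi>_inv \<phi>_closed)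
      then show "g \<in> ?h ` carrier G" using g l by (metis G.inv_closed \<phi>_closed imageI)
    qed
  qed (use hG in auto)
  have inv_eq: "inv\<^bsub>L\<^esub> x = ?l \<longleftrightarrow> x = l" if "x \<in> carrier L" for x
    using that l by (metis L.inv_inv)
  have cl: "a g \<odot>\<^bsub>M\<^esub> act M (E (?h g) ?l) m \<in> carrier M" if "g \<in> carrier G" for g
    using that by (intro M.smult_closed ag M.act_closed E_closed hG l' mM)
  have "act M (antipode A (unit_ext a)) m
      = (\<Oplus>\<^bsub>M\<^esub>s\<in>B. unit_ext a s \<odot>\<^bsub>M\<^esub> act M (E (\<phi> (inv\<^bsub>L\<^esub> (snd s)) (inv\<^bsub>G\<^esub> (fst s))) (inv\<^bsub>L\<^esub> (snd s))) m)"
    by (rule act_antipode[OF linear_map_closed[OF unit_ext_linear a] mM])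
  also have "\<dots> = (\<Oplus>\<^bsub>M\<^esub>s\<in>B. if snd s = l then a (fst s) \<odot>\<^bsub>M\<^esub> act M (E (?h (fst s)) ?l) m else \<zero>\<^bsub>M\<^esub>)"
  proof (rule M.M.finsum_cong'[OF refl])
    show "(\<lambda>s. if snd s = l then a (fst s) \<odot>\<^bsub>M\<^esub> act M (E (?h (fst s)) ?l) m else \<zero>\<^bsub>M\<^esub>) \<in> B \<rightarrow> carrier M"
      using cl by auto
    fix s assume "s \<in> B"
    then obtain g x where s: "s = (g, x)" "g \<in> carrier G" "x \<in> carrier L" by auto
    have "act M (E (\<phi> (inv\<^bsub>L\<^esub> x) (inv\<^bsub>G\<^esub> g)) (inv\<^bsub>L\<^esub> x)) m = (if x = l then act M (E (?h g) ?l) m else \<zero>\<^bsub>M\<^esub>)"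
      using act_E_C[OF _ _ m, of "\<phi> (inv\<^bsub>L\<^esub> x) (inv\<^bsub>G\<^esub> g)" "inv\<^bsub>L\<^esub> x"] s \<phi>_closed inv_eq by auto
    moreover have "unit_ext a s = a g" using s by (simp add: unit_ext_def)
    ultimately show "unit_ext a s \<odot>\<^bsub>M\<^esub> act M (E (\<phi> (inv\<^bsub>L\<^esub> (snd s)) (inv\<^bsub>G\<^esub> (fst s))) (inv\<^bsub>L\<^esub> (snd s))) m
        = (if snd s = l then a (fst s) \<odot>\<^bsub>M\<^esub> act M (E (?h (fst s)) ?l) m else \<zero>\<^bsub>M\<^esub>)"
      using s ag by simp
  qed
  also have "\<dots> = (\<Oplus>\<^bsub>M\<^esub>g\<in>carrier G. a g \<odot>\<^bsub>M\<^esub> act M (E (?h g) ?l) m)"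
    using cl l by (intro M.M.finsum_slice finite_G finite_L) auto
  also have "\<dots> = (\<Oplus>\<^bsub>M\<^esub>g\<in>carrier G. antipode kG (twist l a) (?h g) \<odot>\<^bsub>M\<^esub> act M (E (?h g) ?l) m)"
    using cl by (intro M.M.finsum_cong') (auto simp: Sh)
  also have "\<dots> = (\<Oplus>\<^bsub>M\<^esub>g\<in>?h ` carrier G. antipode kG (twist l a) g \<odot>\<^bsub>M\<^esub> act M (E g ?l) m)"
    using cl by (intro M.M.finsum_reindex[symmetric] inj) (auto simp: Sh)
  also have "\<dots> = act (C ?l) (antipode kG (twist l a)) m"
    unfolding surj by (rule C_act_expand[OF S_closed m l', symmetric])
  finally show ?thesis .
qed

text \<open>As \<open>1 \<otimes> p\<^sub>x\<close> acts on forms by \<open>f \<mapsto> f \<circ> P\<^sub>y\<close> with \<open>y = x\<^sup>-\<^sup>1\<close>, the defining condition at \<open>x = l\<close> is the one below,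
  and it implies the conditions at \<open>x \<noteq> l\<close> by orthogonality of the projections.\<close>

lemma dual_component_carrier:
  assumes l: "l \<in> carrier L"
  shows "carrier (component K G L (dual_rep K A M) l)
    = {f \<in> carrier (dual_rep K A M). \<forall>m\<in>carrier M. f (P (inv\<^bsub>L\<^esub> l) m) = f m}"
proof -
  let ?D = "dual_rep K A M"
  have P_act: "act ?D (E \<one>\<^bsub>G\<^esub> x) f = (\<lambda>m\<in>carrier M. f (P (inv\<^bsub>L\<^esub> x) m))" if "x \<in> carrier L" for x f
    using that by (simp add: dual_rep_sel antipode_E \<phi>_G_one)
  have ext: "f \<in> extensional (carrier M)" if "f \<in> carrier ?D" for f
    using that by (simp add: dual_rep_sel)
  show ?thesis
  proof (intro equalityI subsetI)
    fix f assume f: "f \<in> carrier (component K G L ?D l)"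
    then have fD: "f \<in> carrier ?D" and "act ?D (E \<one>\<^bsub>G\<^esub> l) f = f"
      using l by (auto simp: component_def)
    then have fl: "(\<lambda>m\<in>carrier M. f (P (inv\<^bsub>L\<^esub> l) m)) = f" using P_act[OF l] by simp
    have "f (P (inv\<^bsub>L\<^esub> l) m) = f m" if "m \<in> carrier M" for m
      using that fun_cong[OF fl, of m] by simp
    then show "f \<in> {f \<in> carrier ?D. \<forall>m\<in>carrier M. f (P (inv\<^bsub>L\<^esub> l) m) = f m}" using fD by auto
  next
    fix f assume "f \<in> {f \<in> carrier ?D. \<forall>m\<in>carrier M. f (P (inv\<^bsub>L\<^esub> l) m) = f m}"
    then have fD: "f \<in> carrier ?D" and fP: "\<And>m. m \<in> carrier M \<Longrightarrow> f (P (inv\<^bsub>L\<^esub> l) m) = f m" by auto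
    have f0: "f \<zero>\<^bsub>M\<^esub> = \<zero>\<^bsub>K\<^esub>"
      using linear_map_zero[OF M.module_axioms module_scalar_module[OF cring], of f] fD
      by (simp add: dual_rep_sel scalar_module_def)
    have "act ?D (E \<one>\<^bsub>G\<^esub> x) f = (if x = l then f else \<zero>\<^bsub>?D\<^esub>)" if x: "x \<in> carrier L" for x
    proof (cases "x = l")
      case True
      then show ?thesis
        unfolding P_act[OF x] using fP ext[OF fD] by (auto intro!: extensionalityI[of _ "carrier M"])
    next
      case False
      have "f (P (inv\<^bsub>L\<^esub> x) m) = \<zero>\<^bsub>K\<^esub>" if m: "m \<in> carrier M" for m
      proof -
        have "inv\<^bsub>L\<^esub> l \<noteq> inv\<^bsub>L\<^esub> x" using False x l by (metis L.inv_inv)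
        then have "P (inv\<^bsub>L\<^esub> l) (P (inv\<^bsub>L\<^esub> x) m) = \<zero>\<^bsub>M\<^esub>"
          using x l m by (simp add: act_E_E)
        then show ?thesis
          using fP[of "P (inv\<^bsub>L\<^esub> x) m"] f0 x m by (simp add: M.act_closed E_closed)
      qed
      then show ?thesis
        unfolding P_act[OF x] using False by (auto simp: dual_rep_sel intro!: restrict_ext)
    qed
    then show "f \<in> carrier (component K G L ?D l)" using fD by (auto simp: component_def)
  qed
qed

text \<open>The inverse of the restriction map extends a form \<open>h\<close> on the component by zero on the other
  components, that is, to \<open>h \<circ> P\<close> with \<open>P\<close> the projection onto the component.\<close>

lemma dual_component_iso:
  assumes l: "l \<in> carrier L"
  shows "(\<lambda>f. restrict f (carrier (C (inv\<^bsub>L\<^esub> l))))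
    \<in> rep_iso K kG (component K G L (dual_rep K A M) l)
        (conj_rep G \<phi> l (dual_rep K kG (C (inv\<^bsub>L\<^esub> l))))"
proof -
  let ?l = "inv\<^bsub>L\<^esub> l"
  let ?D = "dual_rep K A M" and ?S = "scalar_module K"
  let ?V = "component K G L ?D l" and ?W = "conj_rep G \<phi> l (dual_rep K kG (C ?l))"
  let ?R = "\<lambda>f. restrict f (carrier (C ?l))"
  let ?Q = "\<lambda>h. \<lambda>m\<in>carrier M. h (P ?l m)"
  have l': "?l \<in> carrier L" using l by simp
  note V = dual_component_carrier[OF l]
  have W: "carrier ?W = linear_map K (C ?l) ?S \<inter> extensional (carrier (C ?l))"
    by (simp add: conj_sel dual_rep_sel)
  have V_ops: "f \<oplus>\<^bsub>?V\<^esub> h = (\<lambda>m\<in>carrier M. f m \<oplus>\<^bsub>K\<^esub> h m)" "c \<odot>\<^bsub>?V\<^esub> f = (\<lambda>m\<in>carrier M. c \<otimes>\<^bsub>K\<^esub> f m)"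
    "act ?V a f = (\<lambda>m\<in>carrier M. f (act M (antipode A (unit_ext a)) m))" for f h c a
    by (simp_all add: component_def dual_rep_sel unit_ext_def)
  have W_ops: "f \<oplus>\<^bsub>?W\<^esub> h = (\<lambda>m\<in>carrier (C ?l). f m \<oplus>\<^bsub>K\<^esub> h m)"
    "c \<odot>\<^bsub>?W\<^esub> f = (\<lambda>m\<in>carrier (C ?l). c \<otimes>\<^bsub>K\<^esub> f m)"
    "act ?W a f = (\<lambda>m\<in>carrier (C ?l). f (act (C ?l) (antipode kG (twist l a)) m))" for f h c a
    by (simp_all add: conj_sel dual_rep_sel)
  have R: "?R f \<in> carrier ?W" if "f \<in> carrier ?V" for f
  proof -
    have "f \<in> linear_map K M ?S" using that by (simp add: V dual_rep_sel)
    then have "f \<in> linear_map K (C ?l) ?S"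
      using linear_map_comp[OF C_incl] by blast
    then show ?thesis
      using linear_map_cong[OF module_C, of f ?l ?S "?R f"] by (simp add: W)
  qed
  have Q: "?Q h \<in> carrier ?V" if "h \<in> carrier ?W" for h
  proof -
    have "h \<in> linear_map K (C ?l) ?S" using that by (simp add: W)
    then have "(\<lambda>m. h (P ?l m)) \<in> linear_map K M ?S"
      by (rule linear_map_comp[OF P_linear_C[OF l']])
    then have "?Q h \<in> carrier ?D"
      using linear_map_cong[OF M.module_axioms, of "\<lambda>m. h (P ?l m)" ?S "?Q h"] by (simp add: dual_rep_sel)
    moreover have "?Q h (P ?l m) = ?Q h m" if "m \<in> carrier M" for m
      using that l' by (simp add: act_E_E M.act_closed E_closed)
    ultimately show ?thesis by (simp add: V)
  qed
  have "?R \<in> linear_map K ?V ?W"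
  proof (rule linear_mapI)
    show "?R f \<in> carrier ?W" if "f \<in> carrier ?V" for f by (rule R[OF that])
  qed (auto simp: V_ops W_ops C_carrier intro!: restrict_ext)
  moreover have "bij_betw ?R (carrier ?V) (carrier ?W)"
  proof (rule bij_betw_byWitness[where f' = ?Q])
    show "\<forall>f\<in>carrier ?V. ?Q (?R f) = f"
    proof
      fix f assume f: "f \<in> carrier ?V"
      then have "f \<in> extensional (carrier M)" by (simp add: V dual_rep_sel)
      then show "?Q (?R f) = f"
        by (rule extensionalityI[rotated]) (use f l' in \<open>auto simp: V P_in_C\<close>)
    qed
    show "\<forall>h\<in>carrier ?W. ?R (?Q h) = h"
    proof
      fix h assume h: "h \<in> carrier ?W"
      then have "h \<in> extensional (carrier (C ?l))" by (simp add: W)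
      then show "?R (?Q h) = h"
        by (rule extensionalityI[rotated]) (use l' in \<open>auto simp: C_P C_carrier\<close>)
    qed
  qed (use R Q in auto)
  moreover have "?R (act ?V a f) = act ?W a (?R f)" if a: "a \<in> carrier kG" and f: "f \<in> carrier ?V" for a f
  proof -
    have eq: "act M (antipode A (unit_ext a)) m = act (C ?l) (antipode kG (twist l a)) m"
      if "m \<in> carrier (C ?l)" for m
      by (rule act_antipode_C[OF a l that])
    have "antipode kG (twist l a) \<in> carrier kG"
      by (intro antipode_kG_closed linear_map_closed[OF twist_linear[OF l]] a)
    then have cl: "act (C ?l) (antipode kG (twist l a)) m \<in> carrier (C ?l)" if "m \<in> carrier (C ?l)" for m
      using that by (rule bilinear_map_closed[OF C_act_bilinear])
    show ?thesis
    proof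
      fix m
      show "?R (act ?V a f) m = act ?W a (?R f) m"
        by (cases "m \<in> carrier (C ?l)") (simp_all add: V_ops(3) W_ops(3) C_carrier eq cl)
    qed
  qed
  ultimately show ?thesis by (simp add: rep_iso_def)
qed

end

section \<open>Tensor products of modules over the dual of the smash product\<close>

locale smash_module_pair = M: smash_module K G L \<phi> M + N: smash_module K G L \<phi> N
  for K :: "('k, 'r) ring_scheme" and G :: "('g, 's) monoid_scheme" and L :: "('l, 't) monoid_scheme"
    and \<phi> and M :: "('k, 'g \<times> 'l \<Rightarrow> 'k, 'm, 'y) rep_scheme"
    and N :: "('k, 'g \<times> 'l \<Rightarrow> 'k, 'n, 'z) rep_scheme"
begin

abbreviation "conj_N l1 l2 \<equiv> conj_rep G \<phi> l1 (N.C l2)"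
abbreviation "TMN \<equiv> tensor K M N"
abbreviation "tens \<equiv> pure_tensor K M N"
abbreviation "TC l1 l2 \<equiv> tensor K (M.C l1) (conj_N l1 l2)"
abbreviation "tensC l1 l2 \<equiv> pure_tensor K (M.C l1) (conj_N l1 l2)"
abbreviation "VC l1 l2 \<equiv> tensor_rep K M.kG (M.C l1) (conj_N l1 l2)"
abbreviation "VMN \<equiv> tensor_rep K M.A M N"

sublocale T: tensor_modules K M N
  by (intro tensor_modules.intro M.M.module_axioms N.M.module_axioms)

sublocale TC: tensor_modules K "M.C l1" "conj_N l1 l2" for l1 l2
  by (intro tensor_modules.intro M.module_C N.module_conj_C)

sublocale TA: tensor_modules K M.A M.A
  by (intro tensor_modules.intro module_dual_smash M.cring)

sublocale TG: tensor_modules K M.kG M.kG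
  by (intro tensor_modules.intro module_group_algebra M.cring)

lemma comult_kG:
  "comult M.kG a = (\<Oplus>\<^bsub>tensor K M.kG M.kG\<^esub>g\<in>carrier G. a g \<odot>\<^bsub>tensor K M.kG M.kG\<^esub>
     pure_tensor K M.kG M.kG (M.e g) (M.e g))"
proof -
  have "tensor K M.kG M.kG = tensor K (free_module K (carrier G)) (free_module K (carrier G))"
    "pure_tensor K M.kG M.kG = pure_tensor K (free_module K (carrier G)) (free_module K (carrier G))"
    by (rule tensor_cong; simp add: group_algebra_sel)+
  then show ?thesis by (simp add: group_algebra_def Let_def)
qed

lemma comult_A:
  "comult M.A b = (\<Oplus>\<^bsub>tensor K M.A M.A\<^esub>s\<in>M.B. b s \<odot>\<^bsub>tensor K M.A M.A\<^esub>
     (\<Oplus>\<^bsub>tensor K M.A M.A\<^esub>x\<in>carrier L. pure_tensor K M.A M.A (M.E (fst s) x)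
        (M.E (\<phi> (inv\<^bsub>L\<^esub> x) (fst s)) (inv\<^bsub>L\<^esub> x \<otimes>\<^bsub>L\<^esub> snd s))))"
proof -
  have "tensor K M.A M.A = tensor K (free_module K M.B) (free_module K M.B)"
    "pure_tensor K M.A M.A = pure_tensor K (free_module K M.B) (free_module K M.B)"
    by (rule tensor_cong; simp add: dual_smash_sel)+
  then show ?thesis by (simp add: dual_smash_def Let_def case_prod_beta)
qed

lemma kG_coeff: "a \<in> carrier M.kG \<Longrightarrow> g \<in> carrier G \<Longrightarrow> a g \<in> carrier K"
  by (auto simp: group_algebra_sel free_module_def)

lemma A_coeff: "b \<in> carrier M.A \<Longrightarrow> s \<in> M.B \<Longrightarrow> b s \<in> carrier K"
  by (auto simp: dual_smash_sel free_module_def)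

lemma comult_kG_closed: "a \<in> carrier M.kG \<Longrightarrow> comult M.kG a \<in> carrier (tensor K M.kG M.kG)"
  unfolding comult_kG
  by (intro TG.T.M.finsum_closed) (auto intro!: TG.T.smult_closed TG.pure_tensor_closed M.e_closed kG_coeff)

lemma comult_A_inner_closed:
  "s \<in> M.B \<Longrightarrow> (\<Oplus>\<^bsub>tensor K M.A M.A\<^esub>x\<in>carrier L. pure_tensor K M.A M.A (M.E (fst s) x)
        (M.E (\<phi> (inv\<^bsub>L\<^esub> x) (fst s)) (inv\<^bsub>L\<^esub> x \<otimes>\<^bsub>L\<^esub> snd s))) \<in> carrier (tensor K M.A M.A)"
  by (intro TA.T.M.finsum_closed) (auto intro!: TA.pure_tensor_closed M.E_closed M.\<phi>_closed)

lemma comult_A_closed: "b \<in> carrier M.A \<Longrightarrow> comult M.A b \<in> carrier (tensor K M.A M.A)"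
  unfolding comult_A
  by (intro TA.T.M.finsum_closed funcsetI TA.T.smult_closed A_coeff comult_A_inner_closed)

lemmas VC_axioms = module_group_algebra[OF M.cring] M.module_C N.module_conj_C
  M.C_act_bilinear N.conj_C_act_bilinear comult_kG_closed

lemma VC_act_linear:
  assumes "l1 \<in> carrier L" "a \<in> carrier M.kG"
  shows "act (VC l1 l2) a \<in> linear_map K (TC l1 l2) (TC l1 l2)"
  using assms by (intro tensor_rep_act_linear VC_axioms)

text \<open>The group algebra has \<open>\<Delta> g = g \<otimes> g\<close>. On the first factor \<open>g\<close> acts as \<open>g \<otimes> p\<^sub>a\<close> with \<open>a = l1\<close>, and on the
  conjugated second factor as \<open>\<phi> a\<^sup>-\<^sup>1 g \<otimes> p\<^sub>b\<close> with \<open>b = l2\<close>.\<close>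

lemma VC_act_pure:
  assumes a: "a \<in> carrier M.kG" and l: "l1 \<in> carrier L" "l2 \<in> carrier L"
    and m: "m \<in> carrier (M.C l1)" and n: "n \<in> carrier (N.C l2)"
  shows "act (VC l1 l2) a (tensC l1 l2 m n)
    = (\<Oplus>\<^bsub>TC l1 l2\<^esub>g\<in>carrier G. a g \<odot>\<^bsub>TC l1 l2\<^esub>
        tensC l1 l2 (act M (M.E g l1) m) (act N (M.E (\<phi> (inv\<^bsub>L\<^esub> l1) g) l2) n))"
proof -
  let ?W = "TC l1 l2"
  let ?\<beta> = "\<lambda>b c. tensC l1 l2 (act (M.C l1) b m) (act (conj_N l1 l2) c n)"
  have n': "n \<in> carrier (conj_N l1 l2)" using n by (simp add: N.conj_sel)
  have \<beta>: "?\<beta> \<in> bilinear_map K M.kG M.kG ?W"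
    by (intro bilinear_map_comp[OF TC.pure_tensor_bilinear] bilinear_map_left[OF M.C_act_bilinear m]
        bilinear_map_left[OF N.conj_C_act_bilinear n'] l)
  have lin: "tensor_lift K M.kG M.kG ?W ?\<beta> \<in> linear_map K (tensor K M.kG M.kG) ?W"
    by (rule TG.tensor_lift_linear[OF TC.module_tensor \<beta>])
  have pure: "tensor_lift K M.kG M.kG ?W ?\<beta> (pure_tensor K M.kG M.kG (M.e g) (M.e g))
      = tensC l1 l2 (act M (M.E g l1) m) (act N (M.E (\<phi> (inv\<^bsub>L\<^esub> l1) g) l2) n)" if g: "g \<in> carrier G" for g
    unfolding TG.tensor_lift_pure[OF TC.module_tensor \<beta> M.e_closed[OF g] M.e_closed[OF g]]
    using g l m n by (simp add: M.C_act_e N.conj_sel M.twist_e N.C_act_e M.\<phi>_closed)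
  have cl: "pure_tensor K M.kG M.kG (M.e g) (M.e g) \<in> carrier (tensor K M.kG M.kG)" if "g \<in> carrier G" for g
    using that by (intro TG.pure_tensor_closed M.e_closed)
  have "act (VC l1 l2) a (tensC l1 l2 m n) = tensor_lift K M.kG M.kG ?W ?\<beta> (comult M.kG a)"
    using l a m n' by (intro tensor_rep_act_pure VC_axioms)
  also have "\<dots> = (\<Oplus>\<^bsub>?W\<^esub>g\<in>carrier G. tensor_lift K M.kG M.kG ?W ?\<beta>
      (a g \<odot>\<^bsub>tensor K M.kG M.kG\<^esub> pure_tensor K M.kG M.kG (M.e g) (M.e g)))"
    unfolding comult_kG
    by (rule linear_map_finsum[OF TG.module_tensor TC.module_tensor lin M.finite_G])
      (auto intro!: TG.T.smult_closed cl kG_coeff a)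
  also have "\<dots> = (\<Oplus>\<^bsub>?W\<^esub>g\<in>carrier G. a g \<odot>\<^bsub>?W\<^esub>
        tensC l1 l2 (act M (M.E g l1) m) (act N (M.E (\<phi> (inv\<^bsub>L\<^esub> l1) g) l2) n))"
  proof (rule TC.T.M.finsum_cong'[OF refl])
    fix g assume g: "g \<in> carrier G"
    show "tensor_lift K M.kG M.kG ?W ?\<beta> (a g \<odot>\<^bsub>tensor K M.kG M.kG\<^esub> pure_tensor K M.kG M.kG (M.e g) (M.e g))
      = a g \<odot>\<^bsub>?W\<^esub> tensC l1 l2 (act M (M.E g l1) m) (act N (M.E (\<phi> (inv\<^bsub>L\<^esub> l1) g) l2) n)"
      unfolding linear_map_smult[OF lin kG_coeff[OF a g] cl[OF g]] pure[OF g] ..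
  next
    show "(\<lambda>g. a g \<odot>\<^bsub>?W\<^esub> tensC l1 l2 (act M (M.E g l1) m) (act N (M.E (\<phi> (inv\<^bsub>L\<^esub> l1) g) l2) n))
        \<in> carrier G \<rightarrow> carrier ?W"
      using l m n a
      by (auto intro!: TC.T.smult_closed TC.pure_tensor_closed kG_coeff M.act_in_C N.act_in_C M.E_closed
          M.\<phi>_closed simp: N.conj_sel)
  qed
  finally show ?thesis .
qed

lemmas VMN_axioms = module_dual_smash[OF M.cring] M.M.module_axioms N.M.module_axioms
  M.act_bilinear N.act_bilinear comult_A_closed

lemma VMN_act_linear:
  assumes "b \<in> carrier M.A"
  shows "act VMN b \<in> linear_map K TMN TMN"
  using assms by (intro tensor_rep_act_linear VMN_axioms)

lemma VMN_act_pure: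
  assumes b: "b \<in> carrier M.A" and m: "m \<in> carrier M" and n: "n \<in> carrier N"
  shows "act VMN b (tens m n)
    = (\<Oplus>\<^bsub>TMN\<^esub>s\<in>M.B. b s \<odot>\<^bsub>TMN\<^esub> (\<Oplus>\<^bsub>TMN\<^esub>x\<in>carrier L. tens (act M (M.E (fst s) x) m)
        (act N (M.E (\<phi> (inv\<^bsub>L\<^esub> x) (fst s)) (inv\<^bsub>L\<^esub> x \<otimes>\<^bsub>L\<^esub> snd s)) n)))"
proof -
  let ?\<beta> = "\<lambda>b c. tens (act M b m) (act N c n)"
  let ?f = "tensor_lift K M.A M.A TMN ?\<beta>"
  let ?p = "\<lambda>s x. pure_tensor K M.A M.A (M.E (fst s) x)
        (M.E (\<phi> (inv\<^bsub>L\<^esub> x) (fst s)) (inv\<^bsub>L\<^esub> x \<otimes>\<^bsub>L\<^esub> snd s))"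
  have \<beta>: "?\<beta> \<in> bilinear_map K M.A M.A TMN"
    by (intro bilinear_map_comp[OF T.pure_tensor_bilinear] M.act_linear_left N.act_linear_left m n)
  have lin: "?f \<in> linear_map K (tensor K M.A M.A) TMN"
    by (rule TA.tensor_lift_linear[OF T.module_tensor \<beta>])
  have p_cl: "?p s x \<in> carrier (tensor K M.A M.A)" if "s \<in> M.B" "x \<in> carrier L" for s x
    using that by (auto intro!: TA.pure_tensor_closed M.E_closed M.\<phi>_closed)
  have pure: "?f (?p s x) = tens (act M (M.E (fst s) x) m)
        (act N (M.E (\<phi> (inv\<^bsub>L\<^esub> x) (fst s)) (inv\<^bsub>L\<^esub> x \<otimes>\<^bsub>L\<^esub> snd s)) n)" if "s \<in> M.B" "x \<in> carrier L" for s x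
    using that by (intro TA.tensor_lift_pure[OF T.module_tensor \<beta>]) (auto intro!: M.E_closed M.\<phi>_closed)
  have f_cl: "?f (?p s x) \<in> carrier TMN" if "s \<in> M.B" "x \<in> carrier L" for s x
    using linear_map_closed[OF lin p_cl[OF that]] .
  have inner: "?f (\<Oplus>\<^bsub>tensor K M.A M.A\<^esub>x\<in>carrier L. ?p s x) = (\<Oplus>\<^bsub>TMN\<^esub>x\<in>carrier L.
      tens (act M (M.E (fst s) x) m) (act N (M.E (\<phi> (inv\<^bsub>L\<^esub> x) (fst s)) (inv\<^bsub>L\<^esub> x \<otimes>\<^bsub>L\<^esub> snd s)) n))"
    if s: "s \<in> M.B" for s
  proof -
    have "?f (\<Oplus>\<^bsub>tensor K M.A M.A\<^esub>x\<in>carrier L. ?p s x) = (\<Oplus>\<^bsub>TMN\<^esub>x\<in>carrier L. ?f (?p s x))"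
      using p_cl[OF s] by (intro linear_map_finsum[OF TA.module_tensor T.module_tensor lin M.finite_L]) auto
    also have "\<dots> = (\<Oplus>\<^bsub>TMN\<^esub>x\<in>carrier L.
      tens (act M (M.E (fst s) x) m) (act N (M.E (\<phi> (inv\<^bsub>L\<^esub> x) (fst s)) (inv\<^bsub>L\<^esub> x \<otimes>\<^bsub>L\<^esub> snd s)) n))"
      by (rule T.T.M.finsum_cong'[OF refl funcsetI pure[OF s]])
        (use pure[OF s] f_cl[OF s] in simp)
    finally show ?thesis .
  qed
  have "act VMN b (tens m n) = ?f (comult M.A b)"
    using b m n by (intro tensor_rep_act_pure VMN_axioms)
  also have "\<dots> = (\<Oplus>\<^bsub>TMN\<^esub>s\<in>M.B. ?f (b s \<odot>\<^bsub>tensor K M.A M.A\<^esub> (\<Oplus>\<^bsub>tensor K M.A M.A\<^esub>x\<in>carrier L. ?p s x)))"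
    unfolding comult_A
    by (rule linear_map_finsum[OF TA.module_tensor T.module_tensor lin M.finite_B])
      (intro funcsetI TA.T.smult_closed comult_A_inner_closed A_coeff b)
  also have "\<dots> = (\<Oplus>\<^bsub>TMN\<^esub>s\<in>M.B. b s \<odot>\<^bsub>TMN\<^esub> (\<Oplus>\<^bsub>TMN\<^esub>x\<in>carrier L.
      tens (act M (M.E (fst s) x) m) (act N (M.E (\<phi> (inv\<^bsub>L\<^esub> x) (fst s)) (inv\<^bsub>L\<^esub> x \<otimes>\<^bsub>L\<^esub> snd s)) n)))"
  proof (rule T.T.M.finsum_cong'[OF refl])
    fix s assume s: "s \<in> M.B"
    show "?f (b s \<odot>\<^bsub>tensor K M.A M.A\<^esub> (\<Oplus>\<^bsub>tensor K M.A M.A\<^esub>x\<in>carrier L. ?p s x)) = b s \<odot>\<^bsub>TMN\<^esub> (\<Oplus>\<^bsub>TMN\<^esub>x\<in>carrier L.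
      tens (act M (M.E (fst s) x) m) (act N (M.E (\<phi> (inv\<^bsub>L\<^esub> x) (fst s)) (inv\<^bsub>L\<^esub> x \<otimes>\<^bsub>L\<^esub> snd s)) n))"
      unfolding linear_map_smult[OF lin A_coeff[OF b s] comult_A_inner_closed[OF s]] inner[OF s] ..
  next
    show "(\<lambda>s. b s \<odot>\<^bsub>TMN\<^esub> (\<Oplus>\<^bsub>TMN\<^esub>x\<in>carrier L.
      tens (act M (M.E (fst s) x) m) (act N (M.E (\<phi> (inv\<^bsub>L\<^esub> x) (fst s)) (inv\<^bsub>L\<^esub> x \<otimes>\<^bsub>L\<^esub> snd s)) n)))
      \<in> M.B \<rightarrow> carrier TMN"
      using linear_map_closed[OF lin comult_A_inner_closed] inner
      by (intro funcsetI T.T.smult_closed A_coeff b) auto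
  qed
  finally show ?thesis .
qed

text \<open>The idempotent of \<open>M \<otimes> N\<close> at \<open>y\<close> as the sum of all \<open>P\<^sub>a \<otimes> P\<^sub>b\<close> with \<open>a b = y\<close>, indexed by the first
  coordinate.\<close>

lemma VMN_act_E_one:
  assumes y: "y \<in> carrier L" and m: "m \<in> carrier M" and n: "n \<in> carrier N"
  shows "act VMN (M.E \<one>\<^bsub>G\<^esub> y) (tens m n) = (\<Oplus>\<^bsub>TMN\<^esub>x\<in>carrier L. tens (M.P x m) (N.P (inv\<^bsub>L\<^esub> x \<otimes>\<^bsub>L\<^esub> y) n))"
proof -
  let ?f = "\<lambda>s. \<Oplus>\<^bsub>TMN\<^esub>x\<in>carrier L. tens (act M (M.E (fst s) x) m)
        (act N (M.E (\<phi> (inv\<^bsub>L\<^esub> x) (fst s)) (inv\<^bsub>L\<^esub> x \<otimes>\<^bsub>L\<^esub> snd s)) n)"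
  have cl: "tens (act M (M.E g x) m) (act N (M.E (\<phi> (inv\<^bsub>L\<^esub> x) g) (inv\<^bsub>L\<^esub> x \<otimes>\<^bsub>L\<^esub> z)) n) \<in> carrier TMN"
    if "g \<in> carrier G" "x \<in> carrier L" "z \<in> carrier L" for g x z
    using that m n by (intro T.pure_tensor_closed M.M.act_closed N.M.act_closed M.E_closed M.\<phi>_closed) auto
  have "act VMN (M.E \<one>\<^bsub>G\<^esub> y) (tens m n) = ?f (\<one>\<^bsub>G\<^esub>, y)"
    unfolding VMN_act_pure[OF M.E_closed[OF M.G.one_closed y] m n]
    using y cl by (intro finsum_basis_vec[OF T.module_tensor M.finite_B]) (auto intro!: T.T.M.finsum_closed)
  also have "\<dots> = (\<Oplus>\<^bsub>TMN\<^esub>x\<in>carrier L. tens (M.P x m) (N.P (inv\<^bsub>L\<^esub> x \<otimes>\<^bsub>L\<^esub> y) n))"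
    using y cl[OF M.G.one_closed] by (intro T.T.M.finsum_cong') (auto simp: M.\<phi>_G_one)
  finally show ?thesis .
qed

text \<open>In \<open>\<Delta>(g \<otimes> p\<^sub>y) = \<Sum>\<^sub>x (g \<otimes> p\<^sub>x) \<otimes> (\<phi> x\<^sup>-\<^sup>1 g \<otimes> p\<^sub>z)\<close>, \<open>z = x\<^sup>-\<^sup>1 y\<close>, the first factor forces \<open>x = l1\<close> and the second
  one \<open>z = l2\<close>, so \<open>y = l1 l2\<close>. The surviving term is the one occurring in \<open>VC_act_pure\<close>, which is why
  the second component has to be conjugated by \<open>l1\<close>.\<close>

lemma VMN_act_C:
  assumes b: "b \<in> carrier M.A" and l: "l1 \<in> carrier L" "l2 \<in> carrier L"
    and m: "m \<in> carrier (M.C l1)" and n: "n \<in> carrier (N.C l2)"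
  shows "act VMN b (tens m n) = (\<Oplus>\<^bsub>TMN\<^esub>g\<in>carrier G. b (g, l1 \<otimes>\<^bsub>L\<^esub> l2) \<odot>\<^bsub>TMN\<^esub>
    tens (act M (M.E g l1) m) (act N (M.E (\<phi> (inv\<^bsub>L\<^esub> l1) g) l2) n))"
proof -
  let ?t = "\<lambda>g. tens (act M (M.E g l1) m) (act N (M.E (\<phi> (inv\<^bsub>L\<^esub> l1) g) l2) n)"
  have mM: "m \<in> carrier M" and nN: "n \<in> carrier N" using m n M.C_carrier N.C_carrier by auto
  have t_cl: "?t g \<in> carrier TMN" if "g \<in> carrier G" for g
    using that mM nN l by (intro T.pure_tensor_closed M.M.act_closed N.M.act_closed M.E_closed M.\<phi>_closed) auto
  \<comment> \<open>The double sum collapses: for fixed \<open>(g, y)\<close> only \<open>x = l1\<close> survives, and then only for \<open>y = l1 l2\<close>.\<close>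
  have inner: "(\<Oplus>\<^bsub>TMN\<^esub>x\<in>carrier L. tens (act M (M.E g x) m) (act N (M.E (\<phi> (inv\<^bsub>L\<^esub> x) g) (inv\<^bsub>L\<^esub> x \<otimes>\<^bsub>L\<^esub> y)) n))
      = (if y = l1 \<otimes>\<^bsub>L\<^esub> l2 then ?t g else \<zero>\<^bsub>TMN\<^esub>)" if g: "g \<in> carrier G" and y: "y \<in> carrier L" for g y
  proof -
    have l1y: "inv\<^bsub>L\<^esub> l1 \<otimes>\<^bsub>L\<^esub> y = l2 \<longleftrightarrow> y = l1 \<otimes>\<^bsub>L\<^esub> l2"
      using l y M.L.inv_solve_left' by auto
    have "(\<Oplus>\<^bsub>TMN\<^esub>x\<in>carrier L. tens (act M (M.E g x) m) (act N (M.E (\<phi> (inv\<^bsub>L\<^esub> x) g) (inv\<^bsub>L\<^esub> x \<otimes>\<^bsub>L\<^esub> y)) n))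
        = (\<Oplus>\<^bsub>TMN\<^esub>x\<in>carrier L. if x = l1 then (if y = l1 \<otimes>\<^bsub>L\<^esub> l2 then ?t g else \<zero>\<^bsub>TMN\<^esub>) else \<zero>\<^bsub>TMN\<^esub>)"
    proof (rule T.T.M.finsum_cong'[OF refl])
      fix x assume x: "x \<in> carrier L"
      have xy: "inv\<^bsub>L\<^esub> x \<otimes>\<^bsub>L\<^esub> y \<in> carrier L" "\<phi> (inv\<^bsub>L\<^esub> x) g \<in> carrier G" using x y g M.\<phi>_closed by auto
      show "tens (act M (M.E g x) m) (act N (M.E (\<phi> (inv\<^bsub>L\<^esub> x) g) (inv\<^bsub>L\<^esub> x \<otimes>\<^bsub>L\<^esub> y)) n)
          = (if x = l1 then (if y = l1 \<otimes>\<^bsub>L\<^esub> l2 then ?t g else \<zero>\<^bsub>TMN\<^esub>) else \<zero>\<^bsub>TMN\<^esub>)"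
        unfolding M.act_E_C[OF g x m] N.act_E_C[OF xy(2,1) n]
        using l1y l g x y xy mM nN
        by (auto simp: T.pure_tensor_zero M.M.act_closed N.M.act_closed M.E_closed M.\<phi>_closed)
    qed (use t_cl[OF g] in auto)
    also have "\<dots> = (if y = l1 \<otimes>\<^bsub>L\<^esub> l2 then ?t g else \<zero>\<^bsub>TMN\<^esub>)"
      using l t_cl[OF g] by (intro T.T.M.finsum_delta M.finite_L) auto
    finally show ?thesis .
  qed
  have cl: "b (g, l1 \<otimes>\<^bsub>L\<^esub> l2) \<odot>\<^bsub>TMN\<^esub> ?t g \<in> carrier TMN" if "g \<in> carrier G" for g
    using that l by (intro T.T.smult_closed A_coeff b t_cl) auto
  have "act VMN b (tens m n)
      = (\<Oplus>\<^bsub>TMN\<^esub>s\<in>M.B. if snd s = l1 \<otimes>\<^bsub>L\<^esub> l2 then b (fst s, l1 \<otimes>\<^bsub>L\<^esub> l2) \<odot>\<^bsub>TMN\<^esub> ?t (fst s) else \<zero>\<^bsub>TMN\<^esub>)"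
    unfolding VMN_act_pure[OF b mM nN]
    using cl A_coeff[OF b] by (intro T.T.M.finsum_cong') (auto simp: inner)
  also have "\<dots> = (\<Oplus>\<^bsub>TMN\<^esub>g\<in>carrier G. b (g, l1 \<otimes>\<^bsub>L\<^esub> l2) \<odot>\<^bsub>TMN\<^esub> ?t g)"
    using cl l by (intro T.T.M.finsum_slice M.finite_G M.finite_L) auto
  finally show ?thesis .
qed

end

section \<open>Components of tensor products\<close>

context smash_module_pair
begin

text \<open>The inclusions of \<open>M\<^sub>a\<close> and \<open>N\<^sub>b\<close> and the projections \<open>P\<^sub>a\<close>, \<open>P\<^sub>b\<close> onto them (with \<open>a = l1\<close>, \<open>b = l2\<close>) induce
  the following maps between \<open>M\<^sub>a \<otimes> N\<^sub>b\<close> and \<open>M \<otimes> N\<close>.\<close>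

definition comp_incl :: "'l \<Rightarrow> 'l \<Rightarrow> ('m \<times> 'n \<Rightarrow> 'k) set \<Rightarrow> ('m \<times> 'n \<Rightarrow> 'k) set" where
  "comp_incl l1 l2 = tensor_lift K (M.C l1) (conj_N l1 l2) TMN tens"

definition comp_proj :: "'l \<Rightarrow> 'l \<Rightarrow> ('m \<times> 'n \<Rightarrow> 'k) set \<Rightarrow> ('m \<times> 'n \<Rightarrow> 'k) set" where
  "comp_proj l1 l2 = tensor_lift K M N (TC l1 l2) (\<lambda>m n. tensC l1 l2 (M.P l1 m) (N.P l2 n))"

lemma tens_bilinear_C: "tens \<in> bilinear_map K (M.C l1) (conj_N l1 l2) TMN"
proof -
  have "(\<lambda>n. n) \<in> linear_map K (conj_N l1 l2) N"
    using N.C_incl by (simp add: linear_map_def N.conj_sel)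
  from bilinear_map_comp[OF T.pure_tensor_bilinear M.C_incl this] show ?thesis .
qed

lemma tensC_P_bilinear:
  assumes "l1 \<in> carrier L" "l2 \<in> carrier L"
  shows "(\<lambda>m n. tensC l1 l2 (M.P l1 m) (N.P l2 n)) \<in> bilinear_map K M N (TC l1 l2)"
proof -
  have "N.P l2 \<in> linear_map K N (conj_N l1 l2)"
    using N.P_linear_C[OF assms(2)] by (simp add: linear_map_def N.conj_sel)
  from bilinear_map_comp[OF TC.pure_tensor_bilinear M.P_linear_C[OF assms(1)] this] show ?thesis .
qed

lemma comp_incl_linear: "comp_incl l1 l2 \<in> linear_map K (TC l1 l2) TMN"
  unfolding comp_incl_def by (rule TC.tensor_lift_linear[OF T.module_tensor tens_bilinear_C])

lemma comp_incl_pure: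
  "m \<in> carrier (M.C l1) \<Longrightarrow> n \<in> carrier (N.C l2) \<Longrightarrow> comp_incl l1 l2 (tensC l1 l2 m n) = tens m n"
  unfolding comp_incl_def
  by (rule TC.tensor_lift_pure[OF T.module_tensor tens_bilinear_C]) (simp_all add: N.conj_sel)

lemma comp_proj_linear:
  "l1 \<in> carrier L \<Longrightarrow> l2 \<in> carrier L \<Longrightarrow> comp_proj l1 l2 \<in> linear_map K TMN (TC l1 l2)"
  unfolding comp_proj_def by (rule T.tensor_lift_linear[OF TC.module_tensor tensC_P_bilinear])

lemma comp_proj_pure:
  "l1 \<in> carrier L \<Longrightarrow> l2 \<in> carrier L \<Longrightarrow> m \<in> carrier M \<Longrightarrow> n \<in> carrier N \<Longrightarrow>
    comp_proj l1 l2 (tens m n) = tensC l1 l2 (M.P l1 m) (N.P l2 n)"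
  unfolding comp_proj_def by (rule T.tensor_lift_pure[OF TC.module_tensor tensC_P_bilinear])

text \<open>Orthogonality of the projections in each factor.\<close>

lemma comp_proj_incl:
  assumes l: "l1 \<in> carrier L" "l2 \<in> carrier L" "k1 \<in> carrier L" "k2 \<in> carrier L"
    and t: "t \<in> carrier (TC k1 k2)"
  shows "comp_proj l1 l2 (comp_incl k1 k2 t) = (if (k1, k2) = (l1, l2) then t else \<zero>\<^bsub>TC l1 l2\<^esub>)"
proof -
  have lin: "(\<lambda>t. comp_proj l1 l2 (comp_incl k1 k2 t)) \<in> linear_map K (TC k1 k2) (TC l1 l2)"
    by (rule linear_map_comp[OF comp_incl_linear comp_proj_linear[OF l(1,2)]])
  have pure: "comp_proj l1 l2 (comp_incl k1 k2 (tensC k1 k2 m n))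
      = (if (k1, k2) = (l1, l2) then tensC k1 k2 m n else \<zero>\<^bsub>TC l1 l2\<^esub>)"
    if m: "m \<in> carrier (M.C k1)" and n: "n \<in> carrier (N.C k2)" for m n
  proof -
    have "comp_proj l1 l2 (comp_incl k1 k2 (tensC k1 k2 m n)) = tensC l1 l2 (M.P l1 m) (N.P l2 n)"
      using l m n by (simp add: comp_incl_pure comp_proj_pure M.C_carrier N.C_carrier)
    moreover have "M.P l1 m \<in> carrier (M.C l1)" "N.P l2 n \<in> carrier (conj_N l1 l2)"
      using l m n by (simp_all add: M.P_in_C N.P_in_C M.C_carrier N.C_carrier N.conj_sel)
    moreover have "M.P l1 m = (if l1 = k1 then m else \<zero>\<^bsub>M.C l1\<^esub>)" "N.P l2 n = (if l2 = k2 then n else \<zero>\<^bsub>conj_N l1 l2\<^esub>)"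
      using M.C_P[OF m l(1)] N.C_P[OF n l(2)] by (simp_all add: M.C_sel N.conj_sel N.C_sel)
    ultimately show ?thesis
      by (auto simp: TC.pure_tensor_zero)
  qed
  show ?thesis
  proof (cases "(k1, k2) = (l1, l2)")
    case True
    have "(\<lambda>t. t) \<in> linear_map K (TC l1 l2) (TC l1 l2)" by (rule linear_mapI) auto
    from TC.tensor_ext[OF TC.module_tensor lin[simplified True[simplified]] this] show ?thesis
      using t pure True by (auto simp: N.conj_sel)
  next
    case False
    from TC.tensor_ext[OF TC.module_tensor lin zero_linear_map[OF TC.module_tensor]] show ?thesis
      using t pure False by (auto simp: N.conj_sel)
  qed
qed

lemma VMN_act_E_one_C:
  assumes y: "y \<in> carrier L" and l: "l1 \<in> carrier L" "l2 \<in> carrier L"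
    and m: "m \<in> carrier (M.C l1)" and n: "n \<in> carrier (N.C l2)"
  shows "act VMN (M.E \<one>\<^bsub>G\<^esub> y) (tens m n) = (if y = l1 \<otimes>\<^bsub>L\<^esub> l2 then tens m n else \<zero>\<^bsub>TMN\<^esub>)"
proof -
  have mM: "m \<in> carrier M" and nN: "n \<in> carrier N" using m n M.C_carrier N.C_carrier by auto
  have l1y: "inv\<^bsub>L\<^esub> l1 \<otimes>\<^bsub>L\<^esub> y = l2 \<longleftrightarrow> y = l1 \<otimes>\<^bsub>L\<^esub> l2"
    using l y M.L.inv_solve_left' by auto
  have "act VMN (M.E \<one>\<^bsub>G\<^esub> y) (tens m n)
      = (\<Oplus>\<^bsub>TMN\<^esub>x\<in>carrier L. if x = l1 then (if y = l1 \<otimes>\<^bsub>L\<^esub> l2 then tens m n else \<zero>\<^bsub>TMN\<^esub>) else \<zero>\<^bsub>TMN\<^esub>)"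
    unfolding VMN_act_E_one[OF y mM nN]
  proof (rule T.T.M.finsum_cong'[OF refl])
    fix x assume x: "x \<in> carrier L"
    have xy: "inv\<^bsub>L\<^esub> x \<otimes>\<^bsub>L\<^esub> y \<in> carrier L" using x y by auto
    show "tens (M.P x m) (N.P (inv\<^bsub>L\<^esub> x \<otimes>\<^bsub>L\<^esub> y) n)
        = (if x = l1 then (if y = l1 \<otimes>\<^bsub>L\<^esub> l2 then tens m n else \<zero>\<^bsub>TMN\<^esub>) else \<zero>\<^bsub>TMN\<^esub>)"
      unfolding M.C_P[OF m x] N.C_P[OF n xy]
      using l1y mM nN by (auto simp: T.pure_tensor_zero)
  qed (use T.pure_tensor_closed[OF mM nN] in auto)
  also have "\<dots> = (if y = l1 \<otimes>\<^bsub>L\<^esub> l2 then tens m n else \<zero>\<^bsub>TMN\<^esub>)"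
    using l T.pure_tensor_closed[OF mM nN] by (intro T.T.M.finsum_delta M.finite_L) auto
  finally show ?thesis .
qed

text \<open>The image of \<open>M\<^sub>a \<otimes> N\<^sub>b\<close> lies in the component of \<open>M \<otimes> N\<close> at \<open>a b\<close>.\<close>

lemma VMN_act_E_one_incl:
  assumes y: "y \<in> carrier L" and l: "l1 \<in> carrier L" "l2 \<in> carrier L" and t: "t \<in> carrier (TC l1 l2)"
  shows "act VMN (M.E \<one>\<^bsub>G\<^esub> y) (comp_incl l1 l2 t) = (if y = l1 \<otimes>\<^bsub>L\<^esub> l2 then comp_incl l1 l2 t else \<zero>\<^bsub>TMN\<^esub>)"
proof -
  have act_lin: "act VMN (M.E \<one>\<^bsub>G\<^esub> y) \<in> linear_map K TMN TMN"
    using y by (intro VMN_act_linear M.E_closed) auto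
  have lin: "(\<lambda>t. act VMN (M.E \<one>\<^bsub>G\<^esub> y) (comp_incl l1 l2 t)) \<in> linear_map K (TC l1 l2) TMN"
    by (rule linear_map_comp[OF comp_incl_linear act_lin])
  show ?thesis
  proof (rule TC.tensor_ext[OF T.module_tensor lin _ _ t])
    show "(\<lambda>t. if y = l1 \<otimes>\<^bsub>L\<^esub> l2 then comp_incl l1 l2 t else \<zero>\<^bsub>TMN\<^esub>) \<in> linear_map K (TC l1 l2) TMN"
      by (cases "y = l1 \<otimes>\<^bsub>L\<^esub> l2") (simp_all add: comp_incl_linear zero_linear_map[OF T.module_tensor])
  qed (use y l in \<open>simp add: N.conj_sel comp_incl_pure VMN_act_E_one_C\<close>)
qed

text \<open>Equivariance on a single summand: the expansions of the two actions on pure tensors have the same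
  terms.\<close>

lemma VMN_act_unit_ext_incl:
  assumes a: "a \<in> carrier M.kG" and l: "l1 \<in> carrier L" "l2 \<in> carrier L" and t: "t \<in> carrier (TC l1 l2)"
  shows "act VMN (M.unit_ext a) (comp_incl l1 l2 t) = comp_incl l1 l2 (act (VC l1 l2) a t)"
proof -
  have ua: "M.unit_ext a \<in> carrier M.A" by (rule linear_map_closed[OF M.unit_ext_linear a])
  show ?thesis
  proof (rule TC.tensor_ext[OF T.module_tensor _ _ _ t])
    show "(\<lambda>t. act VMN (M.unit_ext a) (comp_incl l1 l2 t)) \<in> linear_map K (TC l1 l2) TMN"
      by (rule linear_map_comp[OF comp_incl_linear VMN_act_linear[OF ua]])
    show "(\<lambda>t. comp_incl l1 l2 (act (VC l1 l2) a t)) \<in> linear_map K (TC l1 l2) TMN"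
      by (rule linear_map_comp[OF VC_act_linear[OF l(1) a] comp_incl_linear])
    fix m n assume m: "m \<in> carrier (M.C l1)" and "n \<in> carrier (conj_N l1 l2)"
    then have n: "n \<in> carrier (N.C l2)" by (simp add: N.conj_sel)
    let ?m = "\<lambda>g. act M (M.E g l1) m" and ?n = "\<lambda>g. act N (M.E (\<phi> (inv\<^bsub>L\<^esub> l1) g) l2) n"
    have mn: "?m g \<in> carrier (M.C l1)" "?n g \<in> carrier (N.C l2)" "a g \<in> carrier K" if "g \<in> carrier G" for g
      using that l m n by (auto intro!: M.act_in_C N.act_in_C M.E_closed M.\<phi>_closed kG_coeff a)
    have tC: "tensC l1 l2 (?m g) (?n g) \<in> carrier (TC l1 l2)" if "g \<in> carrier G" for g
      using mn[OF that] by (intro TC.pure_tensor_closed) (simp_all add: N.conj_sel)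
    have tM: "tens (?m g) (?n g) \<in> carrier TMN" if "g \<in> carrier G" for g
      using mn[OF that] by (intro T.pure_tensor_closed M.C_carrier N.C_carrier)
    have "comp_incl l1 l2 (act (VC l1 l2) a (tensC l1 l2 m n))
        = (\<Oplus>\<^bsub>TMN\<^esub>g\<in>carrier G. comp_incl l1 l2 (a g \<odot>\<^bsub>TC l1 l2\<^esub> tensC l1 l2 (?m g) (?n g)))"
      unfolding VC_act_pure[OF a l m n] using tC mn
      by (intro linear_map_finsum[OF TC.module_tensor T.module_tensor comp_incl_linear M.finite_G]) auto
    also have "\<dots> = (\<Oplus>\<^bsub>TMN\<^esub>g\<in>carrier G. a g \<odot>\<^bsub>TMN\<^esub> tens (?m g) (?n g))"
      using tC tM mn
      by (intro T.T.M.finsum_cong') (auto simp: linear_map_smult[OF comp_incl_linear] comp_incl_pure)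
    also have "\<dots> = (\<Oplus>\<^bsub>TMN\<^esub>g\<in>carrier G. M.unit_ext a (g, l1 \<otimes>\<^bsub>L\<^esub> l2) \<odot>\<^bsub>TMN\<^esub> tens (?m g) (?n g))"
      using tM mn l by (intro T.T.M.finsum_cong') (auto simp: M.unit_ext_def)
    also have "\<dots> = act VMN (M.unit_ext a) (comp_incl l1 l2 (tensC l1 l2 m n))"
      unfolding comp_incl_pure[OF m n] by (rule VMN_act_C[OF ua l m n, symmetric])
    finally show "act VMN (M.unit_ext a) (comp_incl l1 l2 (tensC l1 l2 m n))
      = comp_incl l1 l2 (act (VC l1 l2) a (tensC l1 l2 m n))" ..
  qed
qed

text \<open>The sum \<open>\<Phi>\<close> of the inclusions has the tuple \<open>\<Psi>\<close> of the projections as its inverse: \<open>\<Psi> \<circ> \<Phi>\<close> is the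
  identity by \<open>comp_proj_incl\<close>, and \<open>\<Phi> \<circ> \<Psi>\<close> is the action of \<open>1 \<otimes> p\<^sub>l\<close> by \<open>VMN_act_E_one\<close>, which is the
  identity on the component at \<open>l\<close> only.\<close>

lemma tensor_component_iso:
  fixes l
  defines "I \<equiv> {(l1, l2). l1 \<in> carrier L \<and> l2 \<in> carrier L \<and> l1 \<otimes>\<^bsub>L\<^esub> l2 = l}"
  defines "V \<equiv> \<lambda>(l1, l2). VC l1 l2"
  assumes l: "l \<in> carrier L"
  shows "\<exists>\<Phi> \<in> rep_iso K M.kG (direct_sum_rep I V) (component K G L VMN l).
    \<forall>(l1, l2)\<in>I. \<forall>m\<in>carrier (M.C l1). \<forall>n\<in>carrier (N.C l2).
      \<Phi> (direct_sum_inj I V (l1, l2) (tensC l1 l2 m n)) = tens m n"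
proof -
  let ?C = "component K G L VMN l"
  define \<iota> where "\<iota> i = comp_incl (fst i) (snd i)" for i
  define \<kappa> where "\<kappa> i = comp_proj (fst i) (snd i)" for i
  define U where "U i = TC (fst i) (snd i)" for i
  define \<Phi> where "\<Phi> t = (\<Oplus>\<^bsub>TMN\<^esub>i\<in>I. \<iota> i (t i))" for t
  define \<Psi> where "\<Psi> t = (\<lambda>i\<in>I. \<kappa> i t)" for t
  have I_L: "fst i \<in> carrier L" "snd i \<in> carrier L" "fst i \<otimes>\<^bsub>L\<^esub> snd i = l" if "i \<in> I" for i
    using that by (auto simp: I_def)
  \<comment> \<open>A pair with product \<open>l\<close> is determined by its first entry; this matches \<open>I\<close> with the index set of \<open>VMN_act_E_one\<close>.\<close>
  have I_image: "I = (\<lambda>x. (x, inv\<^bsub>L\<^esub> x \<otimes>\<^bsub>L\<^esub> l)) ` carrier L"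
  proof (intro equalityI subsetI)
    fix i assume i: "i \<in> I"
    then have "snd i = inv\<^bsub>L\<^esub> (fst i) \<otimes>\<^bsub>L\<^esub> l"
      using I_L(1,2)[OF i] unfolding I_L(3)[OF i, symmetric] by (simp add: M.L.m_assoc[symmetric])
    then show "i \<in> (\<lambda>x. (x, inv\<^bsub>L\<^esub> x \<otimes>\<^bsub>L\<^esub> l)) ` carrier L"
      using I_L(1)[OF i] by (intro image_eqI[of _ _ "fst i"]) (simp_all add: prod_eq_iff)
  qed (use l in \<open>auto simp: I_def M.L.m_assoc[symmetric]\<close>)
  have fin_I: "finite I" unfolding I_image using M.finite_L by simp
  have V_eq: "V i = VC (fst i) (snd i)" for i
    by (cases i) (simp add: V_def)
  have V_sel: "carrier (V i) = carrier (U i)" "ring.zero (V i) = ring.zero (U i)"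
    "add (V i) = add (U i)" "smult (V i) = smult (U i)" for i
    by (simp_all add: V_eq U_def tensor_rep_sel)
  have U_mod: "module K (U i)" for i unfolding U_def by (rule TC.module_tensor)
  have \<iota>_lin: "\<iota> i \<in> linear_map K (U i) TMN" for i
    unfolding \<iota>_def U_def by (rule comp_incl_linear)
  have \<kappa>_lin: "\<kappa> i \<in> linear_map K TMN (U i)" if "i \<in> I" for i
    unfolding \<kappa>_def U_def using I_L[OF that] by (intro comp_proj_linear)
  have \<kappa>\<iota>: "\<kappa> i (\<iota> j t) = (if j = i then t else \<zero>\<^bsub>U i\<^esub>)" if "i \<in> I" "j \<in> I" "t \<in> carrier (U j)" for i j t
    using comp_proj_incl[of "fst i" "snd i" "fst j" "snd j" t] I_L[OF that(1)] I_L[OF that(2)] that(3)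
    by (simp add: \<kappa>_def \<iota>_def U_def)
  have D: "t i \<in> carrier (U i)" if "t \<in> carrier (direct_sum_rep I V)" "i \<in> I" for t i
    using that by (auto simp: direct_sum_rep_def V_sel)
  have \<iota>_fun: "(\<lambda>i. \<iota> i (t i)) \<in> I \<rightarrow> carrier TMN" if "t \<in> carrier (direct_sum_rep I V)" for t
    using D[OF that] by (auto intro: linear_map_closed[OF \<iota>_lin])
  have \<Phi>_T: "\<Phi> t \<in> carrier TMN" if "t \<in> carrier (direct_sum_rep I V)" for t
    unfolding \<Phi>_def by (rule T.T.M.finsum_closed[OF \<iota>_fun[OF that]])
  have C_carrier: "carrier ?C = {t \<in> carrier TMN. \<forall>x\<in>carrier L.
      act VMN (M.E \<one>\<^bsub>G\<^esub> x) t = (if x = l then t else \<zero>\<^bsub>TMN\<^esub>)}"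
    by (simp add: component_def tensor_rep_sel)
  have C_ops: "add ?C = add TMN" "smult ?C = smult TMN" "act ?C a = act VMN (M.unit_ext a)" for a
    by (simp_all add: component_def tensor_rep_sel M.unit_ext_def)
  have act_\<Phi>: "act VMN b (\<Phi> t) = (\<Oplus>\<^bsub>TMN\<^esub>i\<in>I. act VMN b (\<iota> i (t i)))"
    if "b \<in> carrier M.A" "t \<in> carrier (direct_sum_rep I V)" for b t
    unfolding \<Phi>_def
    by (rule linear_map_finsum[OF T.module_tensor T.module_tensor VMN_act_linear[OF that(1)] fin_I \<iota>_fun[OF that(2)]])
  have \<Phi>_C: "\<Phi> t \<in> carrier ?C" if t: "t \<in> carrier (direct_sum_rep I V)" for t
  proof -
    have "act VMN (M.E \<one>\<^bsub>G\<^esub> x) (\<Phi> t) = (if x = l then \<Phi> t else \<zero>\<^bsub>TMN\<^esub>)" if x: "x \<in> carrier L" for x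
    proof -
      have "act VMN (M.E \<one>\<^bsub>G\<^esub> x) (\<Phi> t) = (\<Oplus>\<^bsub>TMN\<^esub>i\<in>I. if x = l then \<iota> i (t i) else \<zero>\<^bsub>TMN\<^esub>)"
        unfolding act_\<Phi>[OF M.E_closed[OF M.G.one_closed x] t]
      proof (rule T.T.M.finsum_cong'[OF refl])
        show "(\<lambda>i. if x = l then \<iota> i (t i) else \<zero>\<^bsub>TMN\<^esub>) \<in> I \<rightarrow> carrier TMN"
          using \<iota>_fun[OF t] by auto
        show "act VMN (M.E \<one>\<^bsub>G\<^esub> x) (\<iota> i (t i)) = (if x = l then \<iota> i (t i) else \<zero>\<^bsub>TMN\<^esub>)" if i: "i \<in> I" for i
          using VMN_act_E_one_incl[OF x I_L(1,2)[OF i]] D[OF t i] I_L(3)[OF i] by (simp add: \<iota>_def U_def)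
      qed
      then show ?thesis by (simp add: \<Phi>_def)
    qed
    then show ?thesis using \<Phi>_T[OF t] by (simp add: C_carrier)
  qed
  have \<Psi>_D: "\<Psi> t \<in> carrier (direct_sum_rep I V)" if "t \<in> carrier TMN" for t
    using linear_map_closed[OF \<kappa>_lin that] fin_I by (auto simp: \<Psi>_def direct_sum_rep_def V_sel)
  have \<Phi>\<Psi>: "\<Phi> (\<Psi> t) = act VMN (M.E \<one>\<^bsub>G\<^esub> l) t" if t: "t \<in> carrier TMN" for t
  proof -
    have \<Phi>\<Psi>_eq: "\<Phi> (\<Psi> t) = (\<Oplus>\<^bsub>TMN\<^esub>i\<in>I. \<iota> i (\<kappa> i t))" if "t \<in> carrier TMN" for t
      unfolding \<Phi>_def \<Psi>_def
      by (rule T.T.M.finsum_cong') (auto intro!: linear_map_closed[OF \<iota>_lin] linear_map_closed[OF \<kappa>_lin] that)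
    have "(\<Oplus>\<^bsub>TMN\<^esub>i\<in>I. \<iota> i (\<kappa> i t)) = act VMN (M.E \<one>\<^bsub>G\<^esub> l) t"
    proof (rule T.tensor_ext[OF T.module_tensor _ _ _ t])
      show "(\<lambda>t. \<Oplus>\<^bsub>TMN\<^esub>i\<in>I. \<iota> i (\<kappa> i t)) \<in> linear_map K TMN TMN"
        by (intro finsum_linear_map T.module_tensor fin_I linear_map_comp[OF \<kappa>_lin \<iota>_lin])
      show "act VMN (M.E \<one>\<^bsub>G\<^esub> l) \<in> linear_map K TMN TMN"
        using l by (intro VMN_act_linear M.E_closed) auto
      fix m n assume mn: "m \<in> carrier M" "n \<in> carrier N"
      have cl: "tens (M.P x m) (N.P (inv\<^bsub>L\<^esub> x \<otimes>\<^bsub>L\<^esub> l) n) \<in> carrier TMN" if "x \<in> carrier L" for x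
        using that mn l by (intro T.pure_tensor_closed M.M.act_closed N.M.act_closed M.E_closed) auto
      have ik: "\<iota> i (\<kappa> i (tens m n)) = tens (M.P (fst i) m) (N.P (snd i) n)" if "i \<in> I" for i
        using I_L[OF that] mn by (simp add: \<iota>_def \<kappa>_def comp_proj_pure comp_incl_pure M.P_in_C N.P_in_C)
      have ik': "\<iota> (x, inv\<^bsub>L\<^esub> x \<otimes>\<^bsub>L\<^esub> l) (\<kappa> (x, inv\<^bsub>L\<^esub> x \<otimes>\<^bsub>L\<^esub> l) (tens m n))
          = tens (M.P x m) (N.P (inv\<^bsub>L\<^esub> x \<otimes>\<^bsub>L\<^esub> l) n)" if "x \<in> carrier L" for x
        using ik[of "(x, inv\<^bsub>L\<^esub> x \<otimes>\<^bsub>L\<^esub> l)"] that by (auto simp: I_image)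
      have "(\<Oplus>\<^bsub>TMN\<^esub>i\<in>I. \<iota> i (\<kappa> i (tens m n)))
          = (\<Oplus>\<^bsub>TMN\<^esub>x\<in>carrier L. \<iota> (x, inv\<^bsub>L\<^esub> x \<otimes>\<^bsub>L\<^esub> l) (\<kappa> (x, inv\<^bsub>L\<^esub> x \<otimes>\<^bsub>L\<^esub> l) (tens m n)))"
        unfolding I_image using cl by (intro T.T.M.finsum_reindex) (auto simp: ik' inj_on_def)
      also have "\<dots> = (\<Oplus>\<^bsub>TMN\<^esub>x\<in>carrier L. tens (M.P x m) (N.P (inv\<^bsub>L\<^esub> x \<otimes>\<^bsub>L\<^esub> l) n))"
        using cl by (intro T.T.M.finsum_cong') (auto simp: ik')
      also have "\<dots> = act VMN (M.E \<one>\<^bsub>G\<^esub> l) (tens m n)"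
        by (rule VMN_act_E_one[OF l mn, symmetric])
      finally show "(\<Oplus>\<^bsub>TMN\<^esub>i\<in>I. \<iota> i (\<kappa> i (tens m n))) = act VMN (M.E \<one>\<^bsub>G\<^esub> l) (tens m n)" .
    qed
    then show ?thesis using \<Phi>\<Psi>_eq[OF t] by simp
  qed
  have \<Psi>\<Phi>: "\<Psi> (\<Phi> t) = t" if t: "t \<in> carrier (direct_sum_rep I V)" for t
  proof (rule extensionalityI[of _ I])
    show "t \<in> extensional I" using t by (auto simp: direct_sum_rep_def PiE_def)
    fix i assume i: "i \<in> I"
    interpret U: module K "U i" by (rule U_mod)
    have "\<Psi> (\<Phi> t) i = \<kappa> i (\<Phi> t)" using i by (simp add: \<Psi>_def)
    also have "\<dots> = (\<Oplus>\<^bsub>U i\<^esub>j\<in>I. \<kappa> i (\<iota> j (t j)))"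
      unfolding \<Phi>_def by (rule linear_map_finsum[OF T.module_tensor U_mod \<kappa>_lin[OF i] fin_I \<iota>_fun[OF t]])
    also have "\<dots> = (\<Oplus>\<^bsub>U i\<^esub>j\<in>I. if j = i then t i else \<zero>\<^bsub>U i\<^esub>)"
      using i D[OF t] by (intro U.M.finsum_cong') (auto simp: \<kappa>\<iota>)
    also have "\<dots> = t i"
      using i D[OF t i] fin_I by (intro U.M.finsum_delta) auto
    finally show "\<Psi> (\<Phi> t) i = t i" .
  qed (simp add: \<Psi>_def)
  have lin: "\<Phi> \<in> linear_map K (direct_sum_rep I V) ?C"
  proof (rule linear_mapI)
    fix t u assume t: "t \<in> carrier (direct_sum_rep I V)" and u: "u \<in> carrier (direct_sum_rep I V)"
    have "\<Phi> (t \<oplus>\<^bsub>direct_sum_rep I V\<^esub> u) = (\<Oplus>\<^bsub>TMN\<^esub>i\<in>I. \<iota> i (t i) \<oplus>\<^bsub>TMN\<^esub> \<iota> i (u i))"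
      unfolding \<Phi>_def
    proof (rule T.T.M.finsum_cong'[OF refl])
      show "(\<lambda>i. \<iota> i (t i) \<oplus>\<^bsub>TMN\<^esub> \<iota> i (u i)) \<in> I \<rightarrow> carrier TMN"
        using \<iota>_fun[OF t] \<iota>_fun[OF u] by auto
      fix i assume i: "i \<in> I"
      then show "\<iota> i ((t \<oplus>\<^bsub>direct_sum_rep I V\<^esub> u) i) = \<iota> i (t i) \<oplus>\<^bsub>TMN\<^esub> \<iota> i (u i)"
        using linear_map_add[OF \<iota>_lin D[OF t i] D[OF u i]] by (simp add: direct_sum_rep_def V_sel)
    qed
    also have "\<dots> = \<Phi> t \<oplus>\<^bsub>?C\<^esub> \<Phi> u"
      unfolding \<Phi>_def C_ops by (rule T.T.M.finsum_addf[OF \<iota>_fun[OF t] \<iota>_fun[OF u]])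
    finally show "\<Phi> (t \<oplus>\<^bsub>direct_sum_rep I V\<^esub> u) = \<Phi> t \<oplus>\<^bsub>?C\<^esub> \<Phi> u" .
  next
    fix c t assume c: "c \<in> carrier K" and t: "t \<in> carrier (direct_sum_rep I V)"
    have "\<Phi> (c \<odot>\<^bsub>direct_sum_rep I V\<^esub> t) = (\<Oplus>\<^bsub>TMN\<^esub>i\<in>I. c \<odot>\<^bsub>TMN\<^esub> \<iota> i (t i))"
      unfolding \<Phi>_def
    proof (rule T.T.M.finsum_cong'[OF refl])
      show "(\<lambda>i. c \<odot>\<^bsub>TMN\<^esub> \<iota> i (t i)) \<in> I \<rightarrow> carrier TMN"
        using \<iota>_fun[OF t] c by auto
      fix i assume i: "i \<in> I"
      then show "\<iota> i ((c \<odot>\<^bsub>direct_sum_rep I V\<^esub> t) i) = c \<odot>\<^bsub>TMN\<^esub> \<iota> i (t i)"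
        using linear_map_smult[OF \<iota>_lin c D[OF t i]] by (simp add: direct_sum_rep_def V_sel)
    qed
    also have "\<dots> = c \<odot>\<^bsub>?C\<^esub> \<Phi> t"
      unfolding \<Phi>_def C_ops by (rule T.T.finsum_smult_ldistr[OF fin_I c \<iota>_fun[OF t], symmetric])
    finally show "\<Phi> (c \<odot>\<^bsub>direct_sum_rep I V\<^esub> t) = c \<odot>\<^bsub>?C\<^esub> \<Phi> t" .
  qed (rule \<Phi>_C)
  have bij: "bij_betw \<Phi> (carrier (direct_sum_rep I V)) (carrier ?C)"
  proof (rule bij_betw_byWitness[where f' = \<Psi>])
    show "\<forall>t\<in>carrier ?C. \<Phi> (\<Psi> t) = t"
      using \<Phi>\<Psi> l by (simp add: C_carrier)
    show "\<Psi> ` carrier ?C \<subseteq> carrier (direct_sum_rep I V)"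
      using \<Psi>_D by (auto simp: C_carrier)
  qed (use \<Psi>\<Phi> \<Phi>_C in auto)
  have equivariant: "\<Phi> (act (direct_sum_rep I V) a t) = act ?C a (\<Phi> t)"
    if a: "a \<in> carrier M.kG" and t: "t \<in> carrier (direct_sum_rep I V)" for a t
  proof -
    have "act ?C a (\<Phi> t) = (\<Oplus>\<^bsub>TMN\<^esub>i\<in>I. act VMN (M.unit_ext a) (\<iota> i (t i)))"
      unfolding C_ops by (rule act_\<Phi>[OF linear_map_closed[OF M.unit_ext_linear a] t])
    also have "\<dots> = \<Phi> (act (direct_sum_rep I V) a t)"
      unfolding \<Phi>_def
    proof (rule T.T.M.finsum_cong'[OF refl])
      have eq: "act VMN (M.unit_ext a) (\<iota> i (t i)) = \<iota> i (act (direct_sum_rep I V) a t i)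
          \<and> act (direct_sum_rep I V) a t i \<in> carrier (U i)" if i: "i \<in> I" for i
      proof -
        have "act (direct_sum_rep I V) a t i = act (VC (fst i) (snd i)) a (t i)"
          using i by (simp add: direct_sum_rep_def V_eq)
        moreover have "t i \<in> carrier (TC (fst i) (snd i))" using D[OF t i] by (simp add: U_def)
        ultimately show ?thesis
          using VMN_act_unit_ext_incl[OF a I_L(1,2)[OF i]]
            linear_map_closed[OF VC_act_linear[OF I_L(1)[OF i] a]]
          by (simp add: \<iota>_def U_def)
      qed
      then show "act VMN (M.unit_ext a) (\<iota> i (t i)) = \<iota> i (act (direct_sum_rep I V) a t i)" if "i \<in> I" for i
        using that by blast
      show "(\<lambda>i. \<iota> i (act (direct_sum_rep I V) a t i)) \<in> I \<rightarrow> carrier TMN"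
        using eq by (auto intro: linear_map_closed[OF \<iota>_lin])
    qed
    finally show ?thesis ..
  qed
  have inj: "\<Phi> (direct_sum_inj I V i v) = \<iota> i v" if i: "i \<in> I" and v: "v \<in> carrier (U i)" for i v
  proof -
    have "\<Phi> (direct_sum_inj I V i v) = (\<Oplus>\<^bsub>TMN\<^esub>j\<in>I. if j = i then \<iota> i v else \<zero>\<^bsub>TMN\<^esub>)"
      unfolding \<Phi>_def
    proof (rule T.T.M.finsum_cong'[OF refl])
      show "(\<lambda>j. if j = i then \<iota> i v else \<zero>\<^bsub>TMN\<^esub>) \<in> I \<rightarrow> carrier TMN"
        using linear_map_closed[OF \<iota>_lin v] by auto
      show "\<iota> j (direct_sum_inj I V i v j) = (if j = i then \<iota> i v else \<zero>\<^bsub>TMN\<^esub>)" if "j \<in> I" for j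
        using that linear_map_zero[OF U_mod T.module_tensor \<iota>_lin]
        by (simp add: direct_sum_inj_def V_sel)
    qed
    also have "\<dots> = \<iota> i v"
      using i linear_map_closed[OF \<iota>_lin v] fin_I by (intro T.T.M.finsum_delta) auto
    finally show ?thesis .
  qed
  have "\<Phi> \<in> rep_iso K M.kG (direct_sum_rep I V) ?C"
    using lin bij equivariant by (simp add: rep_iso_def)
  moreover have "\<Phi> (direct_sum_inj I V (l1, l2) (tensC l1 l2 m n)) = tens m n"
    if "(l1, l2) \<in> I" "m \<in> carrier (M.C l1)" "n \<in> carrier (N.C l2)" for l1 l2 m n
    using inj[OF that(1), of "tensC l1 l2 m n"] that TC.pure_tensor_closed[of m l1 n l2]
    by (simp add: U_def \<iota>_def comp_incl_pure N.conj_sel)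
  ultimately show ?thesis by blast
qed

end

theorem theorem2p1:
  fixes K :: "('k, 'r) ring_scheme" and p :: nat
    and G :: "('g, 's) monoid_scheme" and L :: "('l, 't) monoid_scheme"
    and \<phi> :: "'l \<Rightarrow> 'g \<Rightarrow> 'g"
    and M :: "('k, 'g \<times> 'l \<Rightarrow> 'k, 'm) rep" and N :: "('k, 'g \<times> 'l \<Rightarrow> 'k, 'n) rep"
    and l :: 'l
  assumes "algebraically_closed K" and "ring_char K = p" and "p dvd order G"
    and "group G" and "finite (carrier G)" and "group L" and "finite (carrier L)"
    and "\<phi> \<in> hom L (AutoGroup G)"
    and "algebra_module K (dual_smash K G L \<phi>) M"
    and "algebra_module K (dual_smash K G L \<phi>) N"
    and "l \<in> carrier L"
  shows "(let I = {(l1, l2). l1 \<in> carrier L \<and> l2 \<in> carrier L \<and> l1 \<otimes>\<^bsub>L\<^esub> l2 = l};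
              V = (\<lambda>(l1, l2). tensor_rep K (group_algebra K G)
                     (component K G L M l1) (conj_rep G \<phi> l1 (component K G L N l2)))
          in \<exists>\<Phi> \<in> rep_iso K (group_algebra K G) (direct_sum_rep I V)
                    (component K G L (tensor_rep K (dual_smash K G L \<phi>) M N) l).
               \<forall>(l1, l2)\<in>I. \<forall>m\<in>carrier (component K G L M l1). \<forall>n\<in>carrier (component K G L N l2).
                 \<Phi> (direct_sum_inj I V (l1, l2)
                      (pure_tensor K (component K G L M l1) (conj_rep G \<phi> l1 (component K G L N l2)) m n))
                 = pure_tensor K M N m n)
    \<and> (\<lambda>f. restrict f (carrier (component K G L M (inv\<^bsub>L\<^esub> l))))
        \<in> rep_iso K (group_algebra K G)
            (component K G L (dual_rep K (dual_smash K G L \<phi>) M) l)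
            (conj_rep G \<phi> l (dual_rep K (group_algebra K G) (component K G L M (inv\<^bsub>L\<^esub> l))))"
proof -
  interpret alg: algebra_module K "dual_smash K G L \<phi>" M by fact
  interpret smash_data K G L \<phi>
    by (intro smash_data.intro alg.R.is_cring assms)
  interpret M: smash_module K G L \<phi> M
    by (intro smash_module.intro smash_data_axioms assms)
  interpret N: smash_module K G L \<phi> N
    by (intro smash_module.intro smash_data_axioms assms)
  interpret smash_module_pair K G L \<phi> M N
    by (intro smash_module_pair.intro M.smash_module_axioms N.smash_module_axioms)
  show ?thesis
    unfolding Let_def
    using tensor_component_iso[OF \<open>l \<in> carrier L\<close>] M.dual_component_iso[OF \<open>l \<in> carrier L\<close>]
    by (rule conjI)
qed

end
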